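(* Let $n\geq 2$ be an integer, let $0<p_1,\ldots,p_n<\infty$ satisfy $\frac12\leq\frac1{p_1}+\cdots+\frac1{p_n}<1$, and let $\frac2n\leq q<\infty$. Then the multi-ideals $\tau_{p_1,\ldots,p_n}$ and $\mathcal{C}_q^n$ are regular and ultrastable and, therefore, are maximal.
   Context: All Banach spaces are over $\mathbb{K}=\mathbb{R}$ or $\mathbb{C}$; $\mathcal{L}(E_1,\ldots,E_n;F)$ is the space of continuous $n$-linear operators from $E_1\times\cdots\times E_n$ to $F$. Let $(r_j)_{j=1}^\infty$ be the Rademacher functions on $[0,1]$. For a finite sequence $(x_j)_{j=1}^k$ in $E$ put $\|(x_j)_{j=1}^k\|_{\mathrm{Rad}(E)} = \left(\int_0^1 \| \sum_{j=1}^k r_j(t)x_j\|^2 dt\right)^{1/2}$ and $\|(x_j)_{j=1}^k\|_{p} = (\sum_{j=1}^k\|x_j\|^p)^{1/p}$. $T \in \mathcal{L}(E_1,\ldots,E_n;F)$ has type $(p_1,\ldots,p_n)$ if there is $C>0$ such that for all $k\in\mathbb{N}$ and $x_j^{(i)}\in E_i$ ($1\le i\le n$, $1\le j\le k$), $$\|(T(x_j^{(1)},\ldots,x_j^{(n)}))_{j=1}^k\|_{\mathrm{Rad}(F)} \leq C\prod_{i=1}^n \|(x_j^{(i)})_{j=1}^k\|_{p_i};$$ the infimum of such $C$ is $\|T\|_{\tau_{p_1,\ldots,p_n}}$. $T$ has cotype $q$ if there is $M>0$ such that for all $k\in\mathbb{N}$ and $x_j^{(i)}\in E_i$ ($1\le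 i\le n$, $1\le j\le k$), $$\|(T(x_j^{(1)},\ldots,x_j^{(n)}))_{j=1}^k\|_{q} \leq M\prod_{i=1}^n \|(x_j^{(i)})_{j=1}^k\|_{\mathrm{Rad}(E_i)};$$ the infimum of such $M$ is $\|T\|_{\mathcal{C}^n_q}$. The classes of all such operators are $\tau_{p_1,\ldots,p_n}$ and $\mathcal{C}^n_q$. Let $\mathcal{M}$ be a quasi-Banach ideal of $n$-linear operators (multi-ideal) with (quasi-)norm $\|\cdot\|_{\mathcal{M}}$, that is, for some $0<s\leq 1$: $\mathcal{M}$ is a class of continuous $n$-linear operators between Banach spaces such that each component $\mathcal{M}(E_1,\ldots,E_n;F):=\mathcal{L}(E_1,\ldots,E_n;F)\cap\mathcal{M}$ is a linear subspace of $\mathcal{L}(E_1,\ldots,E_n;F)$ on which $\|\cdot\|_{\mathcal{M}}$ is a complete $s$-norm; each component contains all linear combinations of operators of the form $(x_1,\ldots,x_n)\mapsto\varphi_1(x_1)\cdots\varphi_n(x_n)b$ with $\varphi_i\in E_i'$, $b\in F$; the operator $I_n\colon\mathbb{K}^n\to\mathbb{K}$, $I_n(\lambda_1,\ldots,\lambda_n)=\lambda_1\cdots\lambda_n$, satisfies $\|I_n\|_{\mathcal{M}}=1$; and if $A\in\mathcal{M}(E_1,\ldots,E_n;F)$, $u_m\in\mathcal{L}(G_m;E_m)$ for $m=1,\ldots,n$, and $t\in\mathcal{L}(F;H)$, then $t\circ A\circ(u_1,\ldots,u_n)\in\mathcal{M}(G_1,\ldots,G_n;H)$ and $\|t\circ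 A\circ(u_1,\ldots,u_n)\|_{\mathcal{M}}\leq\|t\|\cdot\|A\|_{\mathcal{M}}\cdot\|u_1\|\cdots\|u_n\|$. (The classes $\tau_{p_1,\ldots,p_n}$ and $\mathcal{C}^n_q$, with $\|\cdot\|_{\tau_{p_1,\ldots,p_n}}$ and $\|\cdot\|_{\mathcal{C}^n_q}$ respectively, are of this kind.) Let $J_F\colon F\to F''$ be the canonical embedding. For an ultrafilter $\mathcal{U}$ on a set $I$ and a family $(E_\lambda)_{\lambda\in I}$ of Banach spaces, $(E_\lambda)_{\mathcal{U}}$ denotes the Banach space ultraproduct, with norm $\|(x_\lambda)_{\mathcal{U}}\|=\lim_{\mathcal{U}}\|x_\lambda\|$. For $T_\lambda\in\mathcal{L}(E_{1,\lambda},\ldots,E_{n,\lambda};F_\lambda)$ with $\sup_\lambda\|T_\lambda\|<\infty$, define $\overline{(T_\lambda)}_{\mathcal{U}}\colon(E_{1,\lambda})_{\mathcal{U}}\times\cdots\times(E_{n,\lambda})_{\mathcal{U}}\to(F_\lambda)_{\mathcal{U}}$ by $\overline{(T_\lambda)}_{\mathcal{U}}((x^1_\lambda)_{\mathcal{U}},\ldots,(x^n_\lambda)_{\mathcal{U}})=(T_\lambda(x^1_\lambda,\ldots,x^n_\lambda))_{\mathcal{U}}$. Then $\mathcal{M}$ is called: - regular if, for $T\in\mathcal{L}(E_1,\ldots,E_n;F)$, $J_F\circ T\in\mathcal{M}(E_1,\ldots,E_n;F'')$ implies $T\in\mathcal{M}(E_1,\ldots,E_n;F)$ and $\|T\|_{\mathcal{M}}=\|J_F\circ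 T\|_{\mathcal{M}}$; - ultrastable if for every ultrafilter $\mathcal{U}$ on a set $I$ and every family $T_\lambda\in\mathcal{M}(E_{1,\lambda},\ldots,E_{n,\lambda};F_\lambda)$, $\lambda\in I$, with $\sup_\lambda\|T_\lambda\|_{\mathcal{M}}<\infty$, one has $\overline{(T_\lambda)}_{\mathcal{U}}\in\mathcal{M}((E_{1,\lambda})_{\mathcal{U}},\ldots,(E_{n,\lambda})_{\mathcal{U}};(F_\lambda)_{\mathcal{U}})$ and $\|\overline{(T_\lambda)}_{\mathcal{U}}\|_{\mathcal{M}}\leq\sup_\lambda\|T_\lambda\|_{\mathcal{M}}$; - maximal if, for $T\in\mathcal{L}(E_1,\ldots,E_n;F)$, the condition $$\|T\|_{\mathcal{M}^{\max}}:=\sup\{\|Q^F_L\circ T|_{M_1\times\cdots\times M_n}\|_{\mathcal{M}}: M_j\in\mathrm{FIN}(E_j),\ L\in\mathrm{COFIN}(F)\}<\infty$$ implies $T\in\mathcal{M}(E_1,\ldots,E_n;F)$ and $\|T\|_{\mathcal{M}}=\|T\|_{\mathcal{M}^{\max}}$, where $Q^F_L\colon F\to F/L$ is the quotient map, $\mathrm{FIN}(E_j)$ is the set of finite-dimensional subspaces of $E_j$ and $\mathrm{COFIN}(F)$ is the set of finite-codimensional closed subspaces of $F$. *)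

theory Defs
  imports
    "HOL-Analysis.Analysis"
    "HOL-Algebra.Module"
    "HOL-Algebra.AbelCoset"
    "HOL-Algebra.Algebraic_Closure_Type"
begin

subsection \<open>Scalars\<close>

text \<open>
  The scalar field is the field of real or of complex numbers. The axiom says that the type is, up
  to an isometric isomorphism of fields, one of the two; \<open>real\<close> and \<open>complex\<close> are instances.
\<close>

class real_or_complex = real_normed_field +
  assumes real_or_complex:
    "(\<forall>z. \<exists>a. z = a *\<^sub>R 1) \<or>
     (\<exists>j. j * j = - 1 \<and> (\<forall>z. \<exists>a b. z = a *\<^sub>R 1 + b *\<^sub>R j) \<and>
       (\<forall>a b. norm (a *\<^sub>R 1 + b *\<^sub>R j) = sqrt (a\<^sup>2 + b\<^sup>2)))"

instance real :: real_or_complex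
  by standard simp

instance complex :: real_or_complex
proof
  have "\<exists>a b. z = a *\<^sub>R 1 + b *\<^sub>R \<i>" for z
    by (rule exI[of _ "Re z"], rule exI[of _ "Im z"]) (simp add: complex_eq_iff)
  moreover have "norm (a *\<^sub>R 1 + b *\<^sub>R \<i>) = sqrt (a\<^sup>2 + b\<^sup>2)" for a b
    by (simp add: cmod_def)
  ultimately show "(\<forall>z::complex. \<exists>a. z = a *\<^sub>R 1) \<or>
     (\<exists>j::complex. j * j = - 1 \<and> (\<forall>z. \<exists>a b. z = a *\<^sub>R 1 + b *\<^sub>R j) \<and>
       (\<forall>a b. norm (a *\<^sub>R 1 + b *\<^sub>R j) = sqrt (a\<^sup>2 + b\<^sup>2)))"
    by (intro disjI2 exI[of _ "\<i>"]) simp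
qed


subsection \<open>Banach spaces\<close>

text \<open>
  Subspaces, quotients, duals and ultraproducts occur as objects, so a normed space is a module with
  an explicit carrier, equipped with a norm. The fields \<open>mult\<close> and \<open>one\<close>, which the module record
  inherits from rings, play no role. An \<open>n\<close>-tuple of spaces is a function on \<open>{1..n}\<close>; having all
  its members in one type \<open>'a\<close> is no restriction, as they may sit in disjoint parts of \<open>'a\<close>.
\<close>

record ('k, 'a) nspace = "('k, 'a) module" +
  nrm :: "'a \<Rightarrow> real"

text \<open>
  The locale \<open>Metric_space\<close> wants the distance to be nonnegative and symmetric off the carrier too.
\<close>

definition ndist :: "('k, 'a) nspace \<Rightarrow> 'a \<Rightarrow> 'a \<Rightarrow> real" where
  "ndist E x y = (if x \<in> carrier E \<and> y \<in> carrier E then nrm E (x \<ominus>\<^bsub>E\<^esub> y) else 0)"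

definition ntopology :: "('k, 'a) nspace \<Rightarrow> 'a topology" where
  "ntopology E = Metric_space.mtopology (carrier E) (ndist E)"

definition normed_space :: "('k::real_or_complex, 'a) nspace \<Rightarrow> bool" where
  "normed_space E \<longleftrightarrow> module ring_of_type_algebra E \<and>
     (\<forall>x\<in>carrier E. 0 \<le> nrm E x \<and> (nrm E x = 0 \<longleftrightarrow> x = \<zero>\<^bsub>E\<^esub>)) \<and>
     (\<forall>c. \<forall>x\<in>carrier E. nrm E (c \<odot>\<^bsub>E\<^esub> x) = norm c * nrm E x) \<and>
     (\<forall>x\<in>carrier E. \<forall>y\<in>carrier E. nrm E (x \<oplus>\<^bsub>E\<^esub> y) \<le> nrm E x + nrm E y)"

definition banach_space :: "('k::real_or_complex, 'a) nspace \<Rightarrow> bool" where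
  "banach_space E \<longleftrightarrow> normed_space E \<and> Metric_space.mcomplete (carrier E) (ndist E)"

definition finite_dimensional :: "('k, 'a) nspace \<Rightarrow> bool" where
  "finite_dimensional E \<longleftrightarrow> (\<exists>B. finite B \<and> B \<subseteq> carrier E \<and>
     carrier E = {finsum E (\<lambda>b. c b \<odot>\<^bsub>E\<^esub> b) B | c. True})"

definition subspace_of :: "('k, 'a) nspace \<Rightarrow> 'a set \<Rightarrow> ('k, 'a) nspace" where
  "subspace_of E M = E\<lparr>carrier := M\<rparr>"

text \<open>
  In the quotient by \<open>L\<close>, adding \<open>L\<close> in the scalar multiplication matters only for the scalar \<open>0\<close>.
\<close>

definition quotient_space :: "('k, 'a) nspace \<Rightarrow> 'a set \<Rightarrow> ('k, 'a set) nspace" where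
  "quotient_space F L = \<lparr>carrier = a_rcosets\<^bsub>F\<^esub> L, monoid.mult = undefined, one = undefined,
     zero = L, add = set_add F, smult = (\<lambda>c A. set_add F L ((\<lambda>x. c \<odot>\<^bsub>F\<^esub> x) ` A)),
     nrm = (\<lambda>A. INF x\<in>A. nrm F x)\<rparr>"

definition quotient_map :: "('k, 'a) nspace \<Rightarrow> 'a set \<Rightarrow> 'a \<Rightarrow> 'a set" where
  "quotient_map F L x = L +>\<^bsub>F\<^esub> x"

definition FIN :: "('k::real_or_complex, 'a) nspace \<Rightarrow> 'a set set" where
  "FIN E = {M. submodule M (ring_of_type_algebra :: 'k ring) E \<and>
     finite_dimensional (subspace_of E M)}"

definition COFIN :: "('k::real_or_complex, 'a) nspace \<Rightarrow> 'a set set" where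
  "COFIN F = {L. submodule L (ring_of_type_algebra :: 'k ring) F \<and> closedin (ntopology F) L \<and>
     finite_dimensional (quotient_space F L)}"

text \<open>Functionals are taken to be \<open>undefined\<close> off the carrier, so that equal functionals are equal.\<close>

definition dual_space :: "('k::real_or_complex, 'a) nspace \<Rightarrow> ('k, 'a \<Rightarrow> 'k) nspace" where
  "dual_space E = \<lparr>carrier = {\<phi> \<in> extensional (carrier E).
       (\<forall>x\<in>carrier E. \<forall>y\<in>carrier E. \<phi> (x \<oplus>\<^bsub>E\<^esub> y) = \<phi> x + \<phi> y) \<and>
       (\<forall>c. \<forall>x\<in>carrier E. \<phi> (c \<odot>\<^bsub>E\<^esub> x) = c * \<phi> x) \<and>
       continuous_map (ntopology E) euclidean \<phi>},
     monoid.mult = undefined, one = undefined,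
     zero = (\<lambda>x\<in>carrier E. 0), add = (\<lambda>\<phi> \<psi>. \<lambda>x\<in>carrier E. \<phi> x + \<psi> x),
     smult = (\<lambda>c \<phi>. \<lambda>x\<in>carrier E. c * \<phi> x),
     nrm = (\<lambda>\<phi>. SUP x\<in>{x \<in> carrier E. nrm E x \<le> 1}. norm (\<phi> x))\<rparr>"

definition canonical_embedding ::
    "('k::real_or_complex, 'a) nspace \<Rightarrow> 'a \<Rightarrow> ('a \<Rightarrow> 'k) \<Rightarrow> 'k" where
  "canonical_embedding F y = (\<lambda>\<phi>\<in>carrier (dual_space F). \<phi> y)"


subsection \<open>Ultraproducts\<close>

text \<open>
  The index set is the type \<open>'i\<close>. An element of an ultraproduct is a coset of the null families in
  the space of bounded families, and its norm is the limit of the norms of any representative.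
\<close>

definition ultrafilter :: "'i filter \<Rightarrow> bool" where
  "ultrafilter U \<longleftrightarrow> U \<noteq> bot \<and> (\<forall>P. eventually P U \<or> eventually (\<lambda>i. \<not> P i) U)"

definition linfty_space :: "('i \<Rightarrow> ('k, 'a) nspace) \<Rightarrow> ('k, 'i \<Rightarrow> 'a) nspace" where
  "linfty_space E = \<lparr>carrier = {x. (\<forall>i. x i \<in> carrier (E i)) \<and> bdd_above (range (\<lambda>i. nrm (E i) (x i)))},
     monoid.mult = undefined, one = undefined,
     zero = (\<lambda>i. \<zero>\<^bsub>E i\<^esub>), add = (\<lambda>x y i. x i \<oplus>\<^bsub>E i\<^esub> y i), smult = (\<lambda>c x i. c \<odot>\<^bsub>E i\<^esub> x i),
     nrm = (\<lambda>x. SUP i. nrm (E i) (x i))\<rparr>"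

definition null_families :: "'i filter \<Rightarrow> ('i \<Rightarrow> ('k, 'a) nspace) \<Rightarrow> ('i \<Rightarrow> 'a) set" where
  "null_families U E = {x \<in> carrier (linfty_space E). ((\<lambda>i. nrm (E i) (x i)) \<longlongrightarrow> 0) U}"

definition ultraclass :: "'i filter \<Rightarrow> ('i \<Rightarrow> ('k, 'a) nspace) \<Rightarrow> ('i \<Rightarrow> 'a) \<Rightarrow> ('i \<Rightarrow> 'a) set" where
  "ultraclass U E x = quotient_map (linfty_space E) (null_families U E) x"

definition representative :: "'a set \<Rightarrow> 'a" where
  "representative A = (SOME x. x \<in> A)"

definition ultraproduct ::
    "'i filter \<Rightarrow> ('i \<Rightarrow> ('k, 'a) nspace) \<Rightarrow> ('k, ('i \<Rightarrow> 'a) set) nspace" where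
  "ultraproduct U E = (quotient_space (linfty_space E) (null_families U E))
     \<lparr>nrm := (\<lambda>A. Lim U (\<lambda>i. nrm (E i) (representative A i)))\<rparr>"


subsection \<open>Continuous multilinear operators\<close>

definition multilinear_ops ::
    "nat \<Rightarrow> (nat \<Rightarrow> ('k::real_or_complex, 'a) nspace) \<Rightarrow> ('k, 'b) nspace \<Rightarrow> ((nat \<Rightarrow> 'a) \<Rightarrow> 'b) set" where
  "multilinear_ops n E F = {T.
     T \<in> (\<Pi>\<^sub>E m\<in>{1..n}. carrier (E m)) \<rightarrow> carrier F \<and>
     (\<forall>x\<in>(\<Pi>\<^sub>E m\<in>{1..n}. carrier (E m)). \<forall>m\<in>{1..n}.
        (\<forall>u\<in>carrier (E m). \<forall>v\<in>carrier (E m).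
           T (x(m := u \<oplus>\<^bsub>E m\<^esub> v)) = T (x(m := u)) \<oplus>\<^bsub>F\<^esub> T (x(m := v))) \<and>
        (\<forall>c. \<forall>u\<in>carrier (E m). T (x(m := c \<odot>\<^bsub>E m\<^esub> u)) = c \<odot>\<^bsub>F\<^esub> T (x(m := u)))) \<and>
     continuous_map (product_topology (\<lambda>m. ntopology (E m)) {1..n}) (ntopology F) T}"

definition ultraproduct_op ::
    "nat \<Rightarrow> 'i filter \<Rightarrow> ('i \<Rightarrow> ('k, 'b) nspace) \<Rightarrow> ('i \<Rightarrow> (nat \<Rightarrow> 'a) \<Rightarrow> 'b)
      \<Rightarrow> (nat \<Rightarrow> ('i \<Rightarrow> 'a) set) \<Rightarrow> ('i \<Rightarrow> 'b) set" where
  "ultraproduct_op n U F T A =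
     ultraclass U F (\<lambda>i. T i (\<lambda>m\<in>{1..n}. representative (A m) i))"


subsection \<open>Multi-ideals\<close>

text \<open>
  A class of operators together with a (quasi-)norm contains operators between spaces of
  all types, whereas a variable of HOL has a single type. The properties below therefore take the
  instances of one class at the types they involve: \<open>M\<close> at the original spaces, and \<open>M'\<close> at the
  derived ones. They are meant to be applied to two instances of the same polymorphic constant.
  They only look at the class and its norm; the axioms of a multi-ideal are not part of them.
  Norms take values in \<open>[0, \<infinity>]\<close>, with \<open>\<infinity>\<close> off the class.
\<close>

record ('k, 'a, 'b) multi_ideal =
  ops :: "(nat \<Rightarrow> ('k, 'a) nspace) \<Rightarrow> ('k, 'b) nspace \<Rightarrow> ((nat \<Rightarrow> 'a) \<Rightarrow> 'b) set"
  inorm :: "(nat \<Rightarrow> ('k, 'a) nspace) \<Rightarrow> ('k, 'b) nspace \<Rightarrow> ((nat \<Rightarrow> 'a) \<Rightarrow> 'b) \<Rightarrow> ennreal"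

definition regular ::
    "nat \<Rightarrow> ('k::real_or_complex, 'a, 'b) multi_ideal \<Rightarrow> ('k, 'a, ('b \<Rightarrow> 'k) \<Rightarrow> 'k) multi_ideal \<Rightarrow> bool" where
  "regular n M M' \<longleftrightarrow>
     (\<forall>E F T. (\<forall>m\<in>{1..n}. banach_space (E m)) \<and> banach_space F \<and> T \<in> multilinear_ops n E F \<and>
        canonical_embedding F \<circ> T \<in> ops M' E (dual_space (dual_space F)) \<longrightarrow>
        T \<in> ops M E F \<and>
        inorm M E F T = inorm M' E (dual_space (dual_space F)) (canonical_embedding F \<circ> T))"

definition ultrastable ::
    "nat \<Rightarrow> ('k::real_or_complex, 'a, 'b) multi_ideal
      \<Rightarrow> ('k, ('i \<Rightarrow> 'a) set, ('i \<Rightarrow> 'b) set) multi_ideal \<Rightarrow> bool" where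
  "ultrastable n M M' \<longleftrightarrow>
     (\<forall>(U :: 'i filter) E F T. ultrafilter U \<and>
        (\<forall>i. (\<forall>m\<in>{1..n}. banach_space (E i m)) \<and> banach_space (F i) \<and> T i \<in> ops M (E i) (F i)) \<and>
        (SUP i. inorm M (E i) (F i) (T i)) < \<infinity> \<longrightarrow>
        ultraproduct_op n U F T \<in> ops M' (\<lambda>m. ultraproduct U (\<lambda>i. E i m)) (ultraproduct U F) \<and>
        inorm M' (\<lambda>m. ultraproduct U (\<lambda>i. E i m)) (ultraproduct U F) (ultraproduct_op n U F T)
          \<le> (SUP i. inorm M (E i) (F i) (T i)))"

definition max_norm ::
    "nat \<Rightarrow> ('k::real_or_complex, 'a, 'b set) multi_ideal \<Rightarrow> (nat \<Rightarrow> ('k, 'a) nspace) \<Rightarrow> ('k, 'b) nspace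
      \<Rightarrow> ((nat \<Rightarrow> 'a) \<Rightarrow> 'b) \<Rightarrow> ennreal" where
  "max_norm n M' E F T = (SUP (D, L)\<in>{(D, L). (\<forall>m\<in>{1..n}. D m \<in> FIN (E m)) \<and> L \<in> COFIN F}.
     inorm M' (\<lambda>m. subspace_of (E m) (D m)) (quotient_space F L)
       (restrict (quotient_map F L \<circ> T) (\<Pi>\<^sub>E m\<in>{1..n}. D m)))"

definition maximal ::
    "nat \<Rightarrow> ('k::real_or_complex, 'a, 'b) multi_ideal \<Rightarrow> ('k, 'a, 'b set) multi_ideal \<Rightarrow> bool" where
  "maximal n M M' \<longleftrightarrow>
     (\<forall>E F T. (\<forall>m\<in>{1..n}. banach_space (E m)) \<and> banach_space F \<and> T \<in> multilinear_ops n E F \<and>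
        max_norm n M' E F T < \<infinity> \<longrightarrow>
        T \<in> ops M E F \<and> inorm M E F T = max_norm n M' E F T)"


subsection \<open>Type and cotype\<close>

definition rademacher :: "nat \<Rightarrow> real \<Rightarrow> real" where
  "rademacher j t = sgn (sin (2 ^ j * pi * t))"

definition rad_norm :: "('k::real_or_complex, 'a) nspace \<Rightarrow> nat \<Rightarrow> (nat \<Rightarrow> 'a) \<Rightarrow> real" where
  "rad_norm E k x = sqrt (set_lebesgue_integral lborel {0..1}
     (\<lambda>t. (nrm E (\<Oplus>\<^bsub>E\<^esub>j\<in>{1..k}. of_real (rademacher j t) \<odot>\<^bsub>E\<^esub> x j))\<^sup>2))"

definition lp_norm :: "real \<Rightarrow> ('k, 'a) nspace \<Rightarrow> nat \<Rightarrow> (nat \<Rightarrow> 'a) \<Rightarrow> real" where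
  "lp_norm p E k x = (\<Sum>j=1..k. nrm E (x j) powr p) powr (1 / p)"

text \<open>In the next two definitions \<open>x j m\<close> is the \<open>j\<close>-th vector in the \<open>m\<close>-th space.\<close>

definition type_bound ::
    "nat \<Rightarrow> (nat \<Rightarrow> real) \<Rightarrow> (nat \<Rightarrow> ('k::real_or_complex, 'a) nspace) \<Rightarrow> ('k, 'b) nspace
      \<Rightarrow> ((nat \<Rightarrow> 'a) \<Rightarrow> 'b) \<Rightarrow> real \<Rightarrow> bool" where
  "type_bound n p E F T C \<longleftrightarrow>
     (\<forall>k x. (\<forall>j\<in>{1..k}. x j \<in> (\<Pi>\<^sub>E m\<in>{1..n}. carrier (E m))) \<longrightarrow>
        rad_norm F k (\<lambda>j. T (x j)) \<le> C * (\<Prod>m=1..n. lp_norm (p m) (E m) k (\<lambda>j. x j m)))"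

definition cotype_bound ::
    "nat \<Rightarrow> real \<Rightarrow> (nat \<Rightarrow> ('k::real_or_complex, 'a) nspace) \<Rightarrow> ('k, 'b) nspace
      \<Rightarrow> ((nat \<Rightarrow> 'a) \<Rightarrow> 'b) \<Rightarrow> real \<Rightarrow> bool" where
  "cotype_bound n q E F T C \<longleftrightarrow>
     (\<forall>k x. (\<forall>j\<in>{1..k}. x j \<in> (\<Pi>\<^sub>E m\<in>{1..n}. carrier (E m))) \<longrightarrow>
        lp_norm q F k (\<lambda>j. T (x j)) \<le> C * (\<Prod>m=1..n. rad_norm (E m) k (\<lambda>j. x j m)))"

definition type_ideal :: "nat \<Rightarrow> (nat \<Rightarrow> real) \<Rightarrow> ('k::real_or_complex, 'a, 'b) multi_ideal" where
  "type_ideal n p =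
     \<lparr>ops = (\<lambda>E F. {T \<in> multilinear_ops n E F. \<exists>C>0. type_bound n p E F T C}),
      inorm = (\<lambda>E F T. INF C\<in>{C. 0 < C \<and> type_bound n p E F T C}. ennreal C)\<rparr>"

definition cotype_ideal :: "nat \<Rightarrow> real \<Rightarrow> ('k::real_or_complex, 'a, 'b) multi_ideal" where
  "cotype_ideal n q =
     \<lparr>ops = (\<lambda>E F. {T \<in> multilinear_ops n E F. \<exists>C>0. cotype_bound n q E F T C}),
      inorm = (\<lambda>E F T. INF C\<in>{C. 0 < C \<and> cotype_bound n q E F T C}. ennreal C)\<rparr>"

end

theory Submission
  imports Defs
begin

text \<open>
  The type and cotype conditions compare, for each \<open>k\<close>, expressions that depend monotonically and
  continuously on the norms of finitely many linear combinations of \<open>k\<close> vectors. Such an expression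
  is preserved by an isometry and decreases under a linear contraction. By Hahn--Banach, \<open>J\<^sub>F\<close> is
  isometric, which gives regularity, and norms in an ultraproduct are limits of norms, which gives
  ultrastability. Maximality needs no ultraproducts: the inequality for given \<open>x\<^sub>1, \<dots>, x\<^sub>k\<close> only
  involves finite-dimensional spans, and the quotient by the common kernel of functionals norming the
  finitely many relevant combinations of the \<open>T x\<^sub>j\<close> does not decrease their norms.
\<close>

subsection \<open>Modules over the scalar field\<close>

text \<open>The delicate point of ultrastability is the operator rather than the inequality.
  \<open>ultraproduct_op\<close> is evaluated at chosen representatives, so its independence of the
  choice, its multilinearity and its continuity all have to come from an operator bound that is
  uniform over the family, whereas the hypothesis only bounds the ideal norms. The link is the
  sequence inequality at length 1: there every sequence norm is the norm of the single vector, so an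
  admissible constant is also a bound of the operator. The Rademacher norm becomes a functional of
  finitely many norms because the vector of signs takes finitely many values on the unit interval;
  its squared integral is then a finite sum with nonnegative weights. The ideal norm is an infimum
  over positive real constants, with values in \<open>ennreal\<close>. Estimates are therefore
  carried out for real \<open>C\<close> strictly above the desired bound, where one constant serves
  all members of a family or all pairs of subspaces and quotients; only afterwards does
  \<open>C\<close> decrease to the bound.\<close>

lemma ring_of_type_algebra_simps [simp]:
  "carrier (ring_of_type_algebra :: 'k::real_or_complex ring) = UNIV"
  "x \<otimes>\<^bsub>(ring_of_type_algebra :: 'k ring)\<^esub> y = x * y"
  "x \<oplus>\<^bsub>(ring_of_type_algebra :: 'k ring)\<^esub> y = x + y"
  "\<one>\<^bsub>(ring_of_type_algebra :: 'k ring)\<^esub> = 1"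
  "\<zero>\<^bsub>(ring_of_type_algebra :: 'k ring)\<^esub> = 0"
  by (simp_all add: ring_of_type_algebra_def)

locale kmodule = module "ring_of_type_algebra :: 'k::real_or_complex ring" E
  for E :: "('k::real_or_complex, 'a) nspace" (structure)
begin

lemma smult_closed' [simp, intro]: "x \<in> carrier E \<Longrightarrow> c \<odot> x \<in> carrier E"
  using smult_closed by simp

lemma add_closed [simp, intro]: "x \<in> carrier E \<Longrightarrow> y \<in> carrier E \<Longrightarrow> x \<oplus> y \<in> carrier E"
  by (rule add.m_closed)

lemma zero_in_carrier [simp, intro]: "\<zero> \<in> carrier E"
  by (rule M.zero_closed)

lemma minus_closed' [simp, intro]: "x \<in> carrier E \<Longrightarrow> y \<in> carrier E \<Longrightarrow> x \<ominus> y \<in> carrier E"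
  by (rule M.minus_closed)

lemma smult_add_left: "x \<in> carrier E \<Longrightarrow> (a + b) \<odot> x = a \<odot> x \<oplus> b \<odot> x"
  using smult_l_distr[of a b x] by simp

lemma smult_add_right: "x \<in> carrier E \<Longrightarrow> y \<in> carrier E \<Longrightarrow> c \<odot> (x \<oplus> y) = c \<odot> x \<oplus> c \<odot> y"
  using smult_r_distr[of c x y] by simp

lemma smult_mult: "x \<in> carrier E \<Longrightarrow> (a * b) \<odot> x = a \<odot> (b \<odot> x)"
  using smult_assoc1[of a b x] by simp

lemma smult_1 [simp]: "x \<in> carrier E \<Longrightarrow> 1 \<odot> x = x"
  using smult_one[of x] by simp

lemma smult_0 [simp]: "x \<in> carrier E \<Longrightarrow> 0 \<odot> x = \<zero>"
  using smult_l_null[of x] by simp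

lemma smult_zero [simp]: "c \<odot> \<zero> = \<zero>"
  using smult_r_null[of c] by simp

lemma smult_minus_1: "x \<in> carrier E \<Longrightarrow> (- 1) \<odot> x = \<ominus> x"
  using smult_add_left[of x "- 1" 1] by (simp add: M.minus_equality)

lemma minus_eq_smult: "x \<in> carrier E \<Longrightarrow> y \<in> carrier E \<Longrightarrow> x \<ominus> y = x \<oplus> (- 1) \<odot> y"
  by (simp add: M.minus_eq smult_minus_1)

lemma minus_self [simp]: "x \<in> carrier E \<Longrightarrow> x \<ominus> x = \<zero>"
  by (simp add: M.minus_eq M.r_neg)

lemma minus_add_cancel [simp]: "x \<in> carrier E \<Longrightarrow> y \<in> carrier E \<Longrightarrow> x \<ominus> y \<oplus> y = x"
  by (simp add: M.minus_eq M.a_assoc M.l_neg)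

lemma eq_if_minus_zero: "x \<in> carrier E \<Longrightarrow> y \<in> carrier E \<Longrightarrow> x \<ominus> y = \<zero> \<Longrightarrow> x = y"
  using minus_add_cancel[of x y] by simp

end

text \<open>Additive inverses need not be supplied: \<open>(- 1) \<odot> x\<close> is one, by
  distributivity and \<open>0 \<odot> x = \<zero>\<close>.\<close>

lemma kmoduleI:
  fixes E :: "('k::real_or_complex, 'a) nspace"
  assumes "\<And>x y. x \<in> carrier E \<Longrightarrow> y \<in> carrier E \<Longrightarrow> x \<oplus>\<^bsub>E\<^esub> y \<in> carrier E"
    and "\<zero>\<^bsub>E\<^esub> \<in> carrier E"
    and "\<And>c x. x \<in> carrier E \<Longrightarrow> c \<odot>\<^bsub>E\<^esub> x \<in> carrier E"
    and "\<And>x y z. x \<in> carrier E \<Longrightarrow> y \<in> carrier E \<Longrightarrow> z \<in> carrier E \<Longrightarrow>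
           (x \<oplus>\<^bsub>E\<^esub> y) \<oplus>\<^bsub>E\<^esub> z = x \<oplus>\<^bsub>E\<^esub> (y \<oplus>\<^bsub>E\<^esub> z)"
    and "\<And>x y. x \<in> carrier E \<Longrightarrow> y \<in> carrier E \<Longrightarrow> x \<oplus>\<^bsub>E\<^esub> y = y \<oplus>\<^bsub>E\<^esub> x"
    and "\<And>x. x \<in> carrier E \<Longrightarrow> \<zero>\<^bsub>E\<^esub> \<oplus>\<^bsub>E\<^esub> x = x"
    and "\<And>a b x. x \<in> carrier E \<Longrightarrow> (a + b) \<odot>\<^bsub>E\<^esub> x = a \<odot>\<^bsub>E\<^esub> x \<oplus>\<^bsub>E\<^esub> b \<odot>\<^bsub>E\<^esub> x"
    and "\<And>c x y. x \<in> carrier E \<Longrightarrow> y \<in> carrier E \<Longrightarrow> c \<odot>\<^bsub>E\<^esub> (x \<oplus>\<^bsub>E\<^esub> y) = c \<odot>\<^bsub>E\<^esub> x \<oplus>\<^bsub>E\<^esub> c \<odot>\<^bsub>E\<^esub> y"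
    and "\<And>a b x. x \<in> carrier E \<Longrightarrow> (a * b) \<odot>\<^bsub>E\<^esub> x = a \<odot>\<^bsub>E\<^esub> (b \<odot>\<^bsub>E\<^esub> x)"
    and "\<And>x. x \<in> carrier E \<Longrightarrow> 1 \<odot>\<^bsub>E\<^esub> x = x"
    and "\<And>x. x \<in> carrier E \<Longrightarrow> 0 \<odot>\<^bsub>E\<^esub> x = \<zero>\<^bsub>E\<^esub>"
  shows "kmodule E"
proof -
  have "\<exists>y\<in>carrier E. y \<oplus>\<^bsub>E\<^esub> x = \<zero>\<^bsub>E\<^esub>" if "x \<in> carrier E" for x
    using assms(3)[OF that, of "- 1"] assms(7)[OF that, of "- 1" 1] assms(10,11)[OF that]
    by (intro bexI[of _ "(- 1) \<odot>\<^bsub>E\<^esub> x"]) auto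
  then have "abelian_group E"
    using assms(1-6) by (intro abelian_groupI) auto
  then show ?thesis
    unfolding kmodule_def using assms by (intro moduleI cring_from_type_algebra) auto
qed

section \<open>Linear maps and finite linear combinations\<close>

definition lin :: "('k::real_or_complex, 'a) nspace \<Rightarrow> ('k, 'b) nspace \<Rightarrow> ('a \<Rightarrow> 'b) \<Rightarrow> bool" where
  "lin E F h \<longleftrightarrow> h \<in> carrier E \<rightarrow> carrier F \<and>
     (\<forall>x\<in>carrier E. \<forall>y\<in>carrier E. h (x \<oplus>\<^bsub>E\<^esub> y) = h x \<oplus>\<^bsub>F\<^esub> h y) \<and>
     (\<forall>c. \<forall>x\<in>carrier E. h (c \<odot>\<^bsub>E\<^esub> x) = c \<odot>\<^bsub>F\<^esub> h x)"

lemma linD: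
  assumes "lin E F h" "x \<in> carrier E"
  shows "h x \<in> carrier F" "y \<in> carrier E \<Longrightarrow> h (x \<oplus>\<^bsub>E\<^esub> y) = h x \<oplus>\<^bsub>F\<^esub> h y"
    "h (c \<odot>\<^bsub>E\<^esub> x) = c \<odot>\<^bsub>F\<^esub> h x"
  using assms by (auto simp: lin_def)

lemma linI:
  assumes "\<And>x. x \<in> carrier E \<Longrightarrow> h x \<in> carrier F"
    and "\<And>x y. x \<in> carrier E \<Longrightarrow> y \<in> carrier E \<Longrightarrow> h (x \<oplus>\<^bsub>E\<^esub> y) = h x \<oplus>\<^bsub>F\<^esub> h y"
    and "\<And>c x. x \<in> carrier E \<Longrightarrow> h (c \<odot>\<^bsub>E\<^esub> x) = c \<odot>\<^bsub>F\<^esub> h x"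
  shows "lin E F h"
  using assms by (auto simp: lin_def)

lemma lin_zero:
  assumes "kmodule E" "kmodule F" "lin E F h"
  shows "h \<zero>\<^bsub>E\<^esub> = \<zero>\<^bsub>F\<^esub>"
proof -
  interpret E: kmodule E by fact
  interpret F: kmodule F by fact
  show ?thesis
    using linD(3)[OF assms(3), of "\<zero>\<^bsub>E\<^esub>" 0] linD(1)[OF assms(3), of "\<zero>\<^bsub>E\<^esub>"] by simp
qed

lemma lin_minus:
  assumes "kmodule E" "kmodule F" "lin E F h" "x \<in> carrier E" "y \<in> carrier E"
  shows "h (x \<ominus>\<^bsub>E\<^esub> y) = h x \<ominus>\<^bsub>F\<^esub> h y"
proof -
  interpret E: kmodule E by fact
  interpret F: kmodule F by fact
  show ?thesis
    using assms(3-5) by (simp add: E.minus_eq_smult F.minus_eq_smult linD)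
qed

lemma lin_finsum:
  assumes "kmodule E" "kmodule F" "lin E F h" "finite A" "f \<in> A \<rightarrow> carrier E"
  shows "h (finsum E f A) = finsum F (\<lambda>a. h (f a)) A"
proof -
  interpret E: kmodule E by fact
  interpret F: kmodule F by fact
  show ?thesis
    using assms(4,5)
  proof (induction A)
    case empty
    then show ?case using lin_zero[OF assms(1-3)] by simp
  next
    case (insert a A)
    then have "f \<in> A \<rightarrow> carrier E" "f a \<in> carrier E" by auto
    moreover from this have "(\<lambda>a. h (f a)) \<in> A \<rightarrow> carrier F"
      using linD(1)[OF assms(3)] by auto
    ultimately show ?case
      using insert linD[OF assms(3)] by (simp add: E.M.finsum_insert F.M.finsum_insert)
  qed
qed

text \<open>The coefficients are real over either scalar field, because Rademacher signs and
  coordinate vectors are.\<close>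

definition lincomb :: "('k::real_or_complex, 'a) nspace \<Rightarrow> nat \<Rightarrow> (nat \<Rightarrow> real) \<Rightarrow> (nat \<Rightarrow> 'a) \<Rightarrow> 'a" where
  "lincomb E k s x = finsum E (\<lambda>j. of_real (s j) \<odot>\<^bsub>E\<^esub> x j) {1..k}"

lemma lincomb_closed:
  assumes "kmodule E" "\<forall>j\<in>{1..k}. x j \<in> carrier E"
  shows "lincomb E k s x \<in> carrier E"
proof -
  interpret E: kmodule E by fact
  show ?thesis unfolding lincomb_def using assms(2) by (intro E.M.finsum_closed) auto
qed

lemma lin_lincomb:
  assumes "kmodule E" "kmodule F" "lin E F h" "\<forall>j\<in>{1..k}. x j \<in> carrier E"
  shows "h (lincomb E k s x) = lincomb F k s (\<lambda>j. h (x j))"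
proof -
  interpret E: kmodule E by fact
  interpret F: kmodule F by fact
  have "h (lincomb E k s x) = finsum F (\<lambda>j. h (of_real (s j) \<odot>\<^bsub>E\<^esub> x j)) {1..k}"
    unfolding lincomb_def by (rule lin_finsum) (use assms in auto)
  also have "\<dots> = lincomb F k s (\<lambda>j. h (x j))"
    unfolding lincomb_def using assms(4) linD[OF assms(3)]
    by (intro F.M.finsum_cong') auto
  finally show ?thesis .
qed

lemma lincomb_cong:
  assumes "kmodule E" "\<forall>j\<in>{1..k}. x j \<in> carrier E" "\<And>j. j \<in> {1..k} \<Longrightarrow> s j = s' j"
    "\<And>j. j \<in> {1..k} \<Longrightarrow> x j = x' j"
  shows "lincomb E k s x = lincomb E k s' x'"
proof -
  interpret E: kmodule E by fact
  show ?thesis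
    unfolding lincomb_def using assms(2-4) by (intro E.M.finsum_cong') auto
qed

lemma lincomb_single:
  assumes "kmodule E" "\<forall>j\<in>{1..k}. x j \<in> carrier E" "i \<in> {1..k}" "\<And>j. j \<in> {1..k} \<Longrightarrow> j \<noteq> i \<Longrightarrow> s j = 0"
  shows "lincomb E k s x = of_real (s i) \<odot>\<^bsub>E\<^esub> x i"
proof -
  interpret E: kmodule E by fact
  have "lincomb E k s x = finsum E (\<lambda>j. if i = j then of_real (s j) \<odot>\<^bsub>E\<^esub> x j else \<zero>\<^bsub>E\<^esub>) {1..k}"
    unfolding lincomb_def using assms(2-4) by (intro E.M.finsum_cong') auto
  also have "\<dots> = of_real (s i) \<odot>\<^bsub>E\<^esub> x i"
    by (rule E.M.finsum_singleton) (use assms in auto)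
  finally show ?thesis .
qed


section \<open>Quotient modules\<close>

locale quotient_of_module = F: kmodule F for F :: "('k::real_or_complex, 'a) nspace" +
  fixes L
  assumes L: "submodule L (ring_of_type_algebra :: 'k ring) F"
begin

lemma L_subset: "L \<subseteq> carrier F"
  and L_smult: "x \<in> L \<Longrightarrow> c \<odot>\<^bsub>F\<^esub> x \<in> L"
  and L_add: "x \<in> L \<Longrightarrow> y \<in> L \<Longrightarrow> x \<oplus>\<^bsub>F\<^esub> y \<in> L"
  and L_zero: "\<zero>\<^bsub>F\<^esub> \<in> L"
  using F.submoduleE[OF L] L F.add.group_axioms by (auto simp: submodule_def dest: subgroup.one_closed)

sublocale abelian_subgroup L F
  using L F.M.abelian_group_axioms
  by (intro abelian_subgroupI3 additive_subgroupI) (auto simp: submodule_def)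

lemma carrier_quotient: "carrier (quotient_space F L) = quotient_map F L ` carrier F"
  by (auto simp: quotient_space_def quotient_map_def A_RCOSETS_def')

lemma zero_quotient: "\<zero>\<^bsub>quotient_space F L\<^esub> = quotient_map F L \<zero>\<^bsub>F\<^esub>"
  using L_subset by (simp add: quotient_space_def quotient_map_def)

lemma add_quotient:
  "x \<in> carrier F \<Longrightarrow> y \<in> carrier F \<Longrightarrow>
     quotient_map F L x \<oplus>\<^bsub>quotient_space F L\<^esub> quotient_map F L y = quotient_map F L (x \<oplus>\<^bsub>F\<^esub> y)"
  by (simp add: quotient_space_def quotient_map_def a_rcos_sum)

lemma mem_quotient_map:
  assumes "x \<in> carrier F"
  shows "y \<in> quotient_map F L x \<longleftrightarrow> y \<in> carrier F \<and> y \<ominus>\<^bsub>F\<^esub> x \<in> L"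
proof
  assume "y \<in> quotient_map F L x"
  then obtain l where "l \<in> L" "y = l \<oplus>\<^bsub>F\<^esub> x" by (auto simp: quotient_map_def a_r_coset_def')
  then show "y \<in> carrier F \<and> y \<ominus>\<^bsub>F\<^esub> x \<in> L"
    using assms L_subset by (auto simp: F.M.minus_eq F.M.a_assoc F.M.r_neg)
next
  assume "y \<in> carrier F \<and> y \<ominus>\<^bsub>F\<^esub> x \<in> L"
  then show "y \<in> quotient_map F L x"
    using assms by (auto simp: quotient_map_def a_r_coset_def' intro!: bexI[of _ "y \<ominus>\<^bsub>F\<^esub> x"])
qed

lemma quotient_map_eq_iff:
  assumes "x \<in> carrier F" "y \<in> carrier F"
  shows "quotient_map F L x = quotient_map F L y \<longleftrightarrow> x \<ominus>\<^bsub>F\<^esub> y \<in> L"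
proof
  assume "quotient_map F L x = quotient_map F L y"
  moreover have "x \<in> quotient_map F L x"
    using assms L_zero by (simp add: mem_quotient_map)
  ultimately show "x \<ominus>\<^bsub>F\<^esub> y \<in> L"
    using mem_quotient_map assms by auto
next
  assume "x \<ominus>\<^bsub>F\<^esub> y \<in> L"
  then have "x \<in> quotient_map F L y" using assms by (simp add: mem_quotient_map)
  then show "quotient_map F L x = quotient_map F L y"
    unfolding quotient_map_def
    using F.M.a_repr_independence[of x L y] assms a_subgroup by simp
qed

text \<open>The change of representative inside the coset contributes \<open>c \<odot> l'\<close>,
  which lies in \<open>L\<close> and is absorbed by the copy of \<open>L\<close> that the scalar
  multiplication adds.\<close>

lemma smult_quotient:
  assumes "x \<in> carrier F"
  shows "c \<odot>\<^bsub>quotient_space F L\<^esub> quotient_map F L x = quotient_map F L (c \<odot>\<^bsub>F\<^esub> x)"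
proof -
  have "(\<exists>l\<in>L. \<exists>l'\<in>L. z = l \<oplus>\<^bsub>F\<^esub> c \<odot>\<^bsub>F\<^esub> (l' \<oplus>\<^bsub>F\<^esub> x)) \<longleftrightarrow> (\<exists>l\<in>L. z = l \<oplus>\<^bsub>F\<^esub> c \<odot>\<^bsub>F\<^esub> x)" for z
  proof
    assume "\<exists>l\<in>L. \<exists>l'\<in>L. z = l \<oplus>\<^bsub>F\<^esub> c \<odot>\<^bsub>F\<^esub> (l' \<oplus>\<^bsub>F\<^esub> x)"
    then obtain l l' where l: "l \<in> L" "l' \<in> L" "z = l \<oplus>\<^bsub>F\<^esub> c \<odot>\<^bsub>F\<^esub> (l' \<oplus>\<^bsub>F\<^esub> x)" by blast
    moreover from this have "l \<in> carrier F" "l' \<in> carrier F" using L_subset by auto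
    ultimately have "z = (l \<oplus>\<^bsub>F\<^esub> c \<odot>\<^bsub>F\<^esub> l') \<oplus>\<^bsub>F\<^esub> c \<odot>\<^bsub>F\<^esub> x"
      using assms by (simp add: F.smult_add_right F.M.a_assoc)
    with l show "\<exists>l\<in>L. z = l \<oplus>\<^bsub>F\<^esub> c \<odot>\<^bsub>F\<^esub> x" using L_add L_smult by blast
  next
    assume "\<exists>l\<in>L. z = l \<oplus>\<^bsub>F\<^esub> c \<odot>\<^bsub>F\<^esub> x"
    then show "\<exists>l\<in>L. \<exists>l'\<in>L. z = l \<oplus>\<^bsub>F\<^esub> c \<odot>\<^bsub>F\<^esub> (l' \<oplus>\<^bsub>F\<^esub> x)"
      using L_zero assms by (metis F.M.l_zero)
  qed
  then show ?thesis
    unfolding quotient_space_def quotient_map_def set_add_def' a_r_coset_def'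
    by (simp add: set_eq_iff)
qed

lemma quotient_kmodule: "kmodule (quotient_space F L)"
  by (rule kmoduleI)
    (auto simp: carrier_quotient zero_quotient add_quotient smult_quotient F.M.a_assoc F.M.a_comm F.M.a_lcomm
      F.smult_add_left F.smult_add_right F.smult_mult)

lemma lin_quotient_map: "lin F (quotient_space F L) (quotient_map F L)"
  by (rule linI) (auto simp: carrier_quotient add_quotient smult_quotient)

end

subsection \<open>Normed modules and sublinear functionals\<close>

locale normed_module = kmodule E for E :: "('k::real_or_complex, 'a) nspace" (structure) +
  assumes nrm_nonneg [simp]: "x \<in> carrier E \<Longrightarrow> 0 \<le> nrm E x"
    and nrm_eq_0_iff: "x \<in> carrier E \<Longrightarrow> nrm E x = 0 \<longleftrightarrow> x = \<zero>"
    and nrm_smult: "x \<in> carrier E \<Longrightarrow> nrm E (c \<odot> x) = norm c * nrm E x"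
    and nrm_triangle: "x \<in> carrier E \<Longrightarrow> y \<in> carrier E \<Longrightarrow> nrm E (x \<oplus> y) \<le> nrm E x + nrm E y"
begin

lemma nrm_zero [simp]: "nrm E \<zero> = 0"
  by (simp add: nrm_eq_0_iff)

lemma nrm_minus_commute:
  assumes "x \<in> carrier E" "y \<in> carrier E"
  shows "nrm E (x \<ominus> y) = nrm E (y \<ominus> x)"
proof -
  have "x \<ominus> y = (- 1) \<odot> (y \<ominus> x)"
    using assms by (simp add: minus_eq_smult smult_add_right M.a_comm flip: smult_mult)
  then show ?thesis using assms by (simp add: nrm_smult)
qed

lemma nrm_minus_triangle:
  assumes "x \<in> carrier E" "y \<in> carrier E" "z \<in> carrier E"
  shows "nrm E (x \<ominus> z) \<le> nrm E (x \<ominus> y) + nrm E (y \<ominus> z)"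
proof -
  have "x \<ominus> z = (x \<ominus> y) \<oplus> (y \<ominus> z)"
    using assms by (simp add: M.minus_eq M.a_assoc M.r_neg1)
  then show ?thesis using assms by (simp add: nrm_triangle)
qed

lemma nrm_diff_le:
  assumes "x \<in> carrier E" "y \<in> carrier E"
  shows "\<bar>nrm E x - nrm E y\<bar> \<le> nrm E (x \<ominus> y)"
proof -
  have "nrm E x \<le> nrm E (x \<ominus> y) + nrm E y"
    using nrm_triangle[of "x \<ominus> y" y] assms by simp
  moreover have "nrm E y \<le> nrm E (y \<ominus> x) + nrm E x"
    using nrm_triangle[of "y \<ominus> x" x] assms by simp
  ultimately show ?thesis using nrm_minus_commute[OF assms] by linarith
qed

lemma Metric_space_ndist: "Metric_space (carrier E) (ndist E)"
proof
  fix x y z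
  show "0 \<le> ndist E x y" by (simp add: ndist_def)
  show "ndist E x y = ndist E y x" by (auto simp: ndist_def nrm_minus_commute)
  show "ndist E x y = 0 \<longleftrightarrow> x = y" if "x \<in> carrier E" "y \<in> carrier E"
    using that eq_if_minus_zero[of x y] by (auto simp: ndist_def nrm_eq_0_iff)
  show "ndist E x z \<le> ndist E x y + ndist E y z"
    if "x \<in> carrier E" "y \<in> carrier E" "z \<in> carrier E"
    using that by (simp add: ndist_def nrm_minus_triangle)
qed

lemma topspace_ntopology [simp]: "topspace (ntopology E) = carrier E"
  unfolding ntopology_def by (rule Metric_space.topspace_mtopology[OF Metric_space_ndist])

text \<open>All later topological arguments go through this description by norms, so that the
  distance \<open>ndist\<close>, which is cut off to 0 outside the carrier, is not met
  again.\<close>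

lemma openin_ntopology:
  "openin (ntopology E) U \<longleftrightarrow> U \<subseteq> carrier E \<and>
     (\<forall>x\<in>U. \<exists>r>0. \<forall>y\<in>carrier E. nrm E (y \<ominus> x) < r \<longrightarrow> y \<in> U)"
proof -
  interpret Metric_space "carrier E" "ndist E" by (rule Metric_space_ndist)
  have ball: "mball x r \<subseteq> U \<longleftrightarrow> (\<forall>y\<in>carrier E. nrm E (y \<ominus> x) < r \<longrightarrow> y \<in> U)" if "x \<in> carrier E" for x r
    using that by (auto simp: subset_iff ndist_def nrm_minus_commute)
  show ?thesis
  proof (cases "U \<subseteq> carrier E")
    case True
    then have "(\<exists>r>0. mball x r \<subseteq> U) \<longleftrightarrow> (\<exists>r>0. \<forall>y\<in>carrier E. nrm E (y \<ominus> x) < r \<longrightarrow> y \<in> U)"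
      if "x \<in> U" for x
      using ball[of x] that by (intro ex_cong1 conj_cong refl) auto
    then show ?thesis
      unfolding ntopology_def openin_mtopology Ball_def by (intro conj_cong refl all_cong1 imp_cong)
  next
    case False
    then show ?thesis unfolding ntopology_def openin_mtopology by (simp only: simp_thms)
  qed
qed

lemma openin_ball: 
  assumes "x \<in> carrier E"
  shows "openin (ntopology E) {y \<in> carrier E. nrm E (y \<ominus> x) < r}"
  unfolding openin_ntopology
proof (intro conjI ballI)
  fix y assume y: "y \<in> {y \<in> carrier E. nrm E (y \<ominus> x) < r}"
  have "z \<in> {y \<in> carrier E. nrm E (y \<ominus> x) < r}"
    if "z \<in> carrier E" "nrm E (z \<ominus> y) < r - nrm E (y \<ominus> x)" for z
    using nrm_minus_triangle[of z y x] y that assms by auto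
  then show "\<exists>r'>0. \<forall>z\<in>carrier E. nrm E (z \<ominus> y) < r' \<longrightarrow> z \<in> {y \<in> carrier E. nrm E (y \<ominus> x) < r}"
    using y by (intro exI[of _ "r - nrm E (y \<ominus> x)"]) auto
qed auto

end

lemma normed_space_iff: "normed_space E \<longleftrightarrow> normed_module E"
proof
  show "normed_space E \<Longrightarrow> normed_module E"
    by (simp add: normed_space_def normed_module_def normed_module_axioms_def kmodule_def)
  show "normed_module E \<Longrightarrow> normed_space E"
    by (simp add: normed_space_def normed_module_def normed_module_axioms_def kmodule_def)
qed

text \<open>Serves to prove subadditivity of functionals that are defined as infima, over a real
  parameter or over a chain.\<close>

lemma le_INF_add_INF:
  fixes c :: real
  assumes "A \<noteq> {}" "B \<noteq> {}" "\<And>s t. s \<in> A \<Longrightarrow> t \<in> B \<Longrightarrow> c \<le> u s + v t"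
  shows "c \<le> (INF s\<in>A. u s) + (INF t\<in>B. v t)"
proof -
  have "c - u s \<le> (INF t\<in>B. v t)" if "s \<in> A" for s
  proof (rule cINF_greatest[OF assms(2)])
    show "c - u s \<le> v t" if "t \<in> B" for t
      using assms(3)[OF \<open>s \<in> A\<close> that] by linarith
  qed
  then have "c - (INF t\<in>B. v t) \<le> (INF s\<in>A. u s)"
    by (intro cINF_greatest[OF assms(1)]) (simp add: diff_le_eq add.commute)
  then show ?thesis by linarith
qed

section \<open>Sublinear functionals and the Hahn-Banach theorem over the reals\<close>

definition sublin :: "('k::real_or_complex, 'a) nspace \<Rightarrow> ('a \<Rightarrow> real) \<Rightarrow> bool" where
  "sublin E f \<longleftrightarrow> (\<forall>x\<in>carrier E. \<forall>y\<in>carrier E. f (x \<oplus>\<^bsub>E\<^esub> y) \<le> f x + f y) \<and>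
     (\<forall>c>0. \<forall>x\<in>carrier E. f (of_real c \<odot>\<^bsub>E\<^esub> x) \<le> c * f x)"

context kmodule
begin

text \<open>The inequalities for \<open>c\<close> and for \<open>1 / c\<close> combine to an
  equality. For \<open>c = 0\<close>, the factors 2 and 1/2 give
  \<open>f \<zero> \<le> 2 * f \<zero>\<close> and \<open>f \<zero> \<le> f \<zero> / 2\<close>,
  which force \<open>f \<zero> = 0\<close>.\<close>

lemma sublin_scale:
  assumes "sublin E f" "x \<in> carrier E" "0 \<le> c"
  shows "f (of_real c \<odot> x) = c * f x"
proof -
  have le: "f (of_real c \<odot> x) \<le> c * f x" if "0 < c" "x \<in> carrier E" for c x
    using assms(1) that by (auto simp: sublin_def)
  show ?thesis
  proof (cases "c = 0")
    case True
    have "f \<zero> \<le> 2 * f \<zero>" "f \<zero> \<le> 1 / 2 * f \<zero>"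
      using le[of 2 "\<zero>"] le[of "1 / 2" "\<zero>"] by auto
    with True assms show ?thesis by simp
  next
    case False
    have "f x = f (of_real (1 / c) \<odot> (of_real c \<odot> x))"
      using False assms(2) by (simp add: flip: smult_mult of_real_mult)
    also have "\<dots> \<le> 1 / c * f (of_real c \<odot> x)"
      using False assms by (intro le) auto
    finally have "c * f x \<le> f (of_real c \<odot> x)" using False assms(3) by (simp add: field_simps)
    with le[of c x] False assms show ?thesis by simp
  qed
qed

lemma sublin_zero: "sublin E f \<Longrightarrow> f \<zero> = 0"
  using sublin_scale[of f \<zero> 0] by simp

lemma sublin_lower_bound:
  assumes "sublin E f" "x \<in> carrier E"
  shows "- f (\<ominus> x) \<le> f x"
proof -
  have "f (x \<oplus> \<ominus> x) \<le> f x + f (\<ominus> x)" using assms by (auto simp: sublin_def)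
  then show ?thesis using sublin_zero[OF assms(1)] assms(2) by (simp add: M.r_neg)
qed

text \<open>The witness is the infimum over \<open>t \<ge> 0\<close> of
  \<open>f (x \<oplus> t y) - t * f y\<close>. It is finite because subadditivity bounds each term
  below by \<open>- f (\<ominus> x)\<close>; the parameters 0 and 1 give the two inequalities. The
  second one has two uses: it forces additivity of a minimal functional, and applied to the norm at
  \<open>\<ominus> y\<close> it produces a functional norming \<open>y\<close>.\<close>

lemma sublin_decrease:
  assumes f: "sublin E f" and y: "y \<in> carrier E"
  obtains g where "sublin E g" "\<And>x. x \<in> carrier E \<Longrightarrow> g x \<le> f x"
    "\<And>x. x \<in> carrier E \<Longrightarrow> g x \<le> f (x \<oplus> y) - f y"
proof
  let ?h = "\<lambda>x t. f (x \<oplus> of_real t \<odot> y) - t * f y"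
  let ?g = "\<lambda>x. INF t\<in>{0..}. ?h x t"
  have add: "f (x \<oplus> z) \<le> f x + f z" if "x \<in> carrier E" "z \<in> carrier E" for x z
    using f that by (auto simp: sublin_def)
  have lower: "- f (\<ominus> x) \<le> ?h x t" if "x \<in> carrier E" "0 \<le> t" for x t
  proof -
    have "x \<oplus> of_real t \<odot> y \<oplus> \<ominus> x = of_real t \<odot> y"
      using that y by (simp add: M.a_ac M.r_neg2)
    moreover have "f (x \<oplus> of_real t \<odot> y \<oplus> \<ominus> x) \<le> f (x \<oplus> of_real t \<odot> y) + f (\<ominus> x)"
      using that y by (intro add) auto
    ultimately show ?thesis using sublin_scale[OF f y that(2)] by simp
  qed
  have bdd: "bdd_below (?h x ` {0..})" if "x \<in> carrier E" for x
    using lower[OF that] by (intro bdd_belowI2[of _ "- f (\<ominus> x)"]) auto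
  have le: "?g x \<le> ?h x t" if "x \<in> carrier E" "0 \<le> t" for x t
    using bdd[OF that(1)] that(2) by (intro cINF_lower) auto
  show "?g x \<le> f x" if "x \<in> carrier E" for x
    using le[OF that, of 0] that y by simp
  show "?g x \<le> f (x \<oplus> y) - f y" if "x \<in> carrier E" for x
    using le[OF that, of 1] that y by simp
  show "sublin E ?g"
    unfolding sublin_def
  proof (intro conjI ballI allI impI)
    fix x z assume xz: "x \<in> carrier E" "z \<in> carrier E"
    have "?g (x \<oplus> z) \<le> ?h x s + ?h z t" if "0 \<le> s" "0 \<le> t" for s t
    proof -
      have "x \<oplus> z \<oplus> of_real (s + t) \<odot> y = (x \<oplus> of_real s \<odot> y) \<oplus> (z \<oplus> of_real t \<odot> y)"
        using xz y by (simp add: smult_add_left M.a_ac)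
      then have "f (x \<oplus> z \<oplus> of_real (s + t) \<odot> y) \<le> f (x \<oplus> of_real s \<odot> y) + f (z \<oplus> of_real t \<odot> y)"
        using xz y by (simp add: add del: of_real_add)
      moreover have "?g (x \<oplus> z) \<le> ?h (x \<oplus> z) (s + t)"
        using xz that by (intro le) auto
      ultimately show ?thesis by (simp add: algebra_simps)
    qed
    then show "?g (x \<oplus> z) \<le> ?g x + ?g z"
      by (intro le_INF_add_INF) auto
  next
    fix c :: real and x assume c: "0 < c" and x: "x \<in> carrier E"
    \<comment> \<open>The term of \<open>c x\<close> at parameter \<open>c * t\<close> is
      \<open>c\<close> times the term of \<open>x\<close> at parameter \<open>t\<close>.\<close>
    have "?g (of_real c \<odot> x) / c \<le> ?h x t" if "0 \<le> t" for t
    proof -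
      have "of_real c \<odot> x \<oplus> of_real (c * t) \<odot> y = of_real c \<odot> (x \<oplus> of_real t \<odot> y)"
        using x y by (simp add: smult_add_right smult_mult)
      moreover have "f (of_real c \<odot> (x \<oplus> of_real t \<odot> y)) = c * f (x \<oplus> of_real t \<odot> y)"
        using x y c by (intro sublin_scale[OF f]) auto
      ultimately have "?h (of_real c \<odot> x) (c * t) = c * ?h x t"
        by (simp only: right_diff_distrib mult.assoc)
      moreover have "?g (of_real c \<odot> x) \<le> ?h (of_real c \<odot> x) (c * t)"
        using x c that by (intro le) auto
      ultimately have "?g (of_real c \<odot> x) \<le> ?h x t * c" by (simp only: mult.commute[of c])
      then show ?thesis using c by (simp only: pos_divide_le_eq)
    qed
    then have "?g (of_real c \<odot> x) / c \<le> ?g x"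
      by (intro cINF_greatest) auto
    then show "?g (of_real c \<odot> x) \<le> c * ?g x" using c by (simp only: pos_divide_le_eq mult.commute[of c])
  qed
qed

text \<open>
  A pointwise minimal sublinear functional is linear, since \<open>sublin_decrease\<close> does not change it.
\<close>

lemma sublin_dominates_linear:
  assumes f: "sublin E f"
  obtains g where "\<And>x y. x \<in> carrier E \<Longrightarrow> y \<in> carrier E \<Longrightarrow> g (x \<oplus> y) = g x + g y"
    "\<And>c x. x \<in> carrier E \<Longrightarrow> g (of_real c \<odot> x) = c * g x"
    "\<And>x. x \<in> carrier E \<Longrightarrow> g x \<le> f x"
proof -
  \<comment> \<open>The value off the carrier is fixed to 0 because the pointwise order and equality
    refer to the whole type.\<close>
  define A where "A = {g. sublin E g \<and> (\<forall>x\<in>carrier E. g x \<le> f x) \<and> (\<forall>x. x \<notin> carrier E \<longrightarrow> g x = 0)}"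
  \<comment> \<open>The order is reversed, so that Zorn's lemma returns a minimal
    functional.\<close>
  let ?P = "\<lambda>g h :: 'a \<Rightarrow> real. h \<le> g"
  define f0 where "f0 = (\<lambda>x. if x \<in> carrier E then f x else 0)"
  have f0: "f0 \<in> A" using f by (auto simp: A_def f0_def sublin_def)
  \<comment> \<open>A lower bound common to all of \<open>A\<close>; it keeps the infimum over a
    chain finite.\<close>
  have lb: "- f (\<ominus> x) \<le> g x" if "g \<in> A" "x \<in> carrier E" for g x
  proof -
    have "sublin E g" "g (\<ominus> x) \<le> f (\<ominus> x)" using that by (auto simp: A_def)
    with sublin_lower_bound[of g x] that(2) show ?thesis by simp
  qed
  have "\<exists>m\<in>A. \<forall>a\<in>A. ?P m a \<longrightarrow> a = m"
  proof (rule predicate_Zorn)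
    show "partial_order_on A (relation_of ?P A)"
      by (rule partial_order_on_relation_ofI) auto
    fix \<C> assume C: "\<C> \<in> Chains (relation_of ?P A)"
    have CA: "\<C> \<subseteq> A" using C by (auto simp: Chains_def relation_of_def)
    have chain: "g \<le> h \<or> h \<le> g" if "g \<in> \<C>" "h \<in> \<C>" for g h
      using C that by (auto simp: Chains_def relation_of_def)
    show "\<exists>u\<in>A. \<forall>a\<in>\<C>. ?P a u"
    proof (cases "\<C> = {}")
      case True
      with f0 show ?thesis by auto
    next
      case False
      let ?u = "\<lambda>x. INF g\<in>\<C>. g x"
      have bdd: "bdd_below ((\<lambda>g. g x) ` \<C>)" for x
      proof (cases "x \<in> carrier E")
        case True
        then show ?thesis using lb CA by (intro bdd_belowI2[of _ "- f (\<ominus> x)"]) auto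
      next
        case False
        then show ?thesis using CA by (intro bdd_belowI2[of _ 0]) (auto simp: A_def)
      qed
      have le: "?u x \<le> g x" if "g \<in> \<C>" for g x
        using that bdd by (intro cINF_lower) auto
      have "sublin E ?u"
        unfolding sublin_def
      proof (intro conjI ballI allI impI)
        fix x y assume xy: "x \<in> carrier E" "y \<in> carrier E"
        \<comment> \<open>The functionals \<open>g\<close> and \<open>h\<close> may differ; in a
          chain the smaller of the two can stand for both.\<close>
        have "?u (x \<oplus> y) \<le> g x + h y" if gh: "g \<in> \<C>" "h \<in> \<C>" for g h
        proof -
          obtain r where r: "r \<in> \<C>" "r \<le> g" "r \<le> h" using chain[OF gh] gh by blast
          have "?u (x \<oplus> y) \<le> r (x \<oplus> y)" by (rule le[OF r(1)])
          also have "\<dots> \<le> r x + r y" using r(1) CA xy by (auto simp: A_def sublin_def)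
          also have "\<dots> \<le> g x + h y" using r(2,3) by (intro add_mono) (auto simp: le_fun_def)
          finally show ?thesis .
        qed
        then show "?u (x \<oplus> y) \<le> ?u x + ?u y"
          using False by (intro le_INF_add_INF) auto
      next
        fix c :: real and x assume c: "0 < c" and x: "x \<in> carrier E"
        have "?u (of_real c \<odot> x) / c \<le> g x" if "g \<in> \<C>" for g
        proof -
          have "?u (of_real c \<odot> x) \<le> g (of_real c \<odot> x)" by (rule le[OF that])
          also have "\<dots> \<le> c * g x" using that CA x c by (auto simp: A_def sublin_def)
          finally show ?thesis using c by (simp add: field_simps)
        qed
        then have "?u (of_real c \<odot> x) / c \<le> ?u x"
          using False by (intro cINF_greatest) auto
        then show "?u (of_real c \<odot> x) \<le> c * ?u x" using c by (simp add: field_simps)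
      qed
      moreover have "?u x \<le> f x" if "x \<in> carrier E" for x
      proof -
        obtain g where "g \<in> \<C>" using False by blast
        with le[of g x] CA that show ?thesis by (fastforce simp: A_def)
      qed
      moreover have "?u x = 0" if "x \<notin> carrier E" for x
      proof -
        have "(\<lambda>g. g x) ` \<C> = {0}" using that CA False by (force simp: A_def)
        then show ?thesis by simp
      qed
      ultimately have "?u \<in> A" by (simp add: A_def)
      moreover have "?u \<le> a" if "a \<in> \<C>" for a
        using le[OF that] by (simp add: le_fun_def)
      ultimately show ?thesis by (intro bexI[of _ ?u]) auto
    qed
  qed
  then obtain m where m: "m \<in> A" and minimal: "\<And>a. a \<in> A \<Longrightarrow> a \<le> m \<Longrightarrow> a = m" by blast
  have mlin: "sublin E m" and mf: "\<And>x. x \<in> carrier E \<Longrightarrow> m x \<le> f x" using m by (auto simp: A_def)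
  have ge: "m x + m y \<le> m (x \<oplus> y)" if xy: "x \<in> carrier E" "y \<in> carrier E" for x y
  proof -
    obtain g where g: "sublin E g" "\<And>x. x \<in> carrier E \<Longrightarrow> g x \<le> m x"
      "\<And>x. x \<in> carrier E \<Longrightarrow> g x \<le> m (x \<oplus> y) - m y"
      using sublin_decrease[OF mlin xy(2)] by blast
    let ?g = "\<lambda>x. if x \<in> carrier E then g x else 0"
    have "sublin E ?g" using g(1) by (auto simp: sublin_def)
    moreover have "g x \<le> f x" if "x \<in> carrier E" for x
      using g(2)[OF that] mf[OF that] by linarith
    ultimately have "?g \<in> A" by (simp add: A_def)
    moreover have "?g \<le> m" using g(2) m by (auto simp: le_fun_def A_def)
    ultimately have "?g = m" by (rule minimal)
    from fun_cong[OF this, of x] have "g x = m x" using xy(1) by simp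
    with g(3)[OF xy(1)] show ?thesis by simp
  qed
  have add: "m (x \<oplus> y) = m x + m y" if "x \<in> carrier E" "y \<in> carrier E" for x y
  proof -
    have "m (x \<oplus> y) \<le> m x + m y" using mlin that unfolding sublin_def by blast
    with ge[OF that] show ?thesis by simp
  qed
  have scale: "m (of_real c \<odot> x) = c * m x" if x: "x \<in> carrier E" for c x
  proof (cases "0 \<le> c")
    case True
    then show ?thesis using sublin_scale[OF mlin x] by simp
  next
    case False
    have "of_real c \<odot> x \<oplus> of_real (- c) \<odot> x = \<zero>"
      using x by (simp flip: smult_add_left)
    then have "m (of_real c \<odot> x) + m (of_real (- c) \<odot> x) = 0"
      using add[of "of_real c \<odot> x" "of_real (- c) \<odot> x"] x sublin_zero[OF mlin] by simp
    then show ?thesis using sublin_scale[OF mlin x, of "- c"] False by simp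
  qed
  show ?thesis by (rule that[OF add scale mf])
qed

end

subsection \<open>Norming functionals and duals\<close>

lemma unimodular_rotation:
  fixes z :: "'k::real_or_complex"
  obtains c where "norm c = 1" "c * z = of_real (norm z)"
proof (cases "z = 0")
  case True
  then show ?thesis using that[of 1] by simp
next
  case False
  then show ?thesis using that[of "of_real (norm z) / z"] by (simp add: norm_divide)
qed

context normed_module
begin

text \<open>The norm is decreased at \<open>y\<close> before a linear functional is taken below it.
  At \<open>\<ominus> y\<close> the decreased functional is at most \<open>- nrm E y\<close>, so the
  linear one is at least \<open>nrm E y\<close> at \<open>y\<close>. This takes the place of
  extending a functional from the line through \<open>y\<close>.\<close>

lemma real_norming_functional:
  assumes y: "y \<in> carrier E"
  obtains f where "\<And>x z. x \<in> carrier E \<Longrightarrow> z \<in> carrier E \<Longrightarrow> f (x \<oplus> z) = f x + f z"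
    "\<And>c x. x \<in> carrier E \<Longrightarrow> f (of_real c \<odot> x) = c * f x"
    "\<And>x. x \<in> carrier E \<Longrightarrow> f x \<le> nrm E x" "f y = nrm E y"
proof -
  have "sublin E (nrm E)"
    by (simp add: sublin_def nrm_triangle nrm_smult)
  then obtain g where g: "sublin E g" "\<And>x. x \<in> carrier E \<Longrightarrow> g x \<le> nrm E x"
      "\<And>x. x \<in> carrier E \<Longrightarrow> g x \<le> nrm E (x \<oplus> y) - nrm E y"
    using sublin_decrease[OF _ y] by blast
  obtain f where f: "\<And>x z. x \<in> carrier E \<Longrightarrow> z \<in> carrier E \<Longrightarrow> f (x \<oplus> z) = f x + f z"
      "\<And>c x. x \<in> carrier E \<Longrightarrow> f (of_real c \<odot> x) = c * f x"
      "\<And>x. x \<in> carrier E \<Longrightarrow> f x \<le> g x"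
    using sublin_dominates_linear[OF g(1)] by blast
  have le: "f x \<le> nrm E x" if "x \<in> carrier E" for x
    using f(3)[OF that] g(2)[OF that] by linarith
  have "f (\<ominus> y) = - f y"
    using f(2)[OF y, of "- 1"] by (simp add: smult_minus_1 y)
  moreover have "f (\<ominus> y) \<le> - nrm E y"
    using f(3)[of "\<ominus> y"] g(3)[of "\<ominus> y"] y by (simp add: M.l_neg)
  ultimately have "f y = nrm E y" using le[OF y] by linarith
  with f(1,2) le show ?thesis by (rule that)
qed

text \<open>
  A real-linear functional \<open>f\<close> is the real part of the \<open>\<complex>\<close>-linear functional \<open>f x - j f (j x)\<close>;
  rotating \<open>x\<close> by a unimodular scalar shows that the latter has the same bound.
\<close>

lemma norming_functional:
  assumes y: "y \<in> carrier E"
  obtains \<phi> where "\<And>x z. x \<in> carrier E \<Longrightarrow> z \<in> carrier E \<Longrightarrow> \<phi> (x \<oplus> z) = \<phi> x + \<phi> z"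
    "\<And>c x. x \<in> carrier E \<Longrightarrow> \<phi> (c \<odot> x) = c * \<phi> x"
    "\<And>x. x \<in> carrier E \<Longrightarrow> norm (\<phi> x) \<le> nrm E x" "norm (\<phi> y) = nrm E y"
proof -
  obtain f where add: "\<And>x z. x \<in> carrier E \<Longrightarrow> z \<in> carrier E \<Longrightarrow> f (x \<oplus> z) = f x + f z"
    and scale: "\<And>c x. x \<in> carrier E \<Longrightarrow> f (of_real c \<odot> x) = c * f x"
    and le: "\<And>x. x \<in> carrier E \<Longrightarrow> f x \<le> nrm E x" and fy: "f y = nrm E y"
    using real_norming_functional[OF y] by blast
  consider (real) "\<forall>z::'k. \<exists>a. z = a *\<^sub>R 1"
    | (complex) j :: 'k where "j * j = - 1" "\<forall>z::'k. \<exists>a b. z = a *\<^sub>R 1 + b *\<^sub>R j"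
        "\<forall>a b. norm (a *\<^sub>R 1 + b *\<^sub>R j) = sqrt (a\<^sup>2 + b\<^sup>2)"
    using real_or_complex[where 'a = 'k] by blast
  then show ?thesis
  proof cases
    case real
    show ?thesis
    proof (rule that[of "\<lambda>x. of_real (f x)"])
      fix c :: 'k and x assume x: "x \<in> carrier E"
      obtain a where "c = a *\<^sub>R 1" using real by blast
      then have "c = of_real a" by (simp add: of_real_def)
      then show "of_real (f (c \<odot> x)) = c * of_real (f x)" using x by (simp add: scale)
    next
      fix x assume x: "x \<in> carrier E"
      have "- f x \<le> nrm E ((- 1) \<odot> x)"
        using le[of "(- 1) \<odot> x"] scale[OF x, of "- 1"] x by simp
      then show "norm (of_real (f x) :: 'k) \<le> nrm E x"
        using le[OF x] x by (simp add: nrm_smult abs_le_iff)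
    qed (use add fy y in auto)
  next
    case (complex j)
    let ?\<phi> = "\<lambda>x. of_real (f x) - j * of_real (f (j \<odot> x)) :: 'k"
    have norm_phi: "norm (of_real a - j * of_real b :: 'k) = sqrt (a\<^sup>2 + b\<^sup>2)" for a b
      using complex(3)[rule_format, of a "- b"] by (simp add: of_real_def)
    have phi_add: "?\<phi> (x \<oplus> z) = ?\<phi> x + ?\<phi> z" if "x \<in> carrier E" "z \<in> carrier E" for x z
      using that by (simp add: add smult_add_right algebra_simps)
    have phi_scale: "?\<phi> (c \<odot> x) = c * ?\<phi> x" if x: "x \<in> carrier E" for c x
    proof -
      obtain a b where "c = a *\<^sub>R 1 + b *\<^sub>R j" using complex(2) by blast
      then have c: "c = of_real a + of_real b * j" by (simp add: of_real_def)
      have jjw: "j * (j * w) = - w" for w :: 'k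
        using complex(1) by (simp flip: mult.assoc)
      have 1: "c \<odot> x = of_real a \<odot> x \<oplus> of_real b \<odot> (j \<odot> x)"
        using x by (simp add: c smult_add_left smult_mult)
      have 2: "j \<odot> (c \<odot> x) = of_real a \<odot> (j \<odot> x) \<oplus> of_real (- b) \<odot> x"
      proof -
        have "j * c = of_real a * j + of_real (- b)"
          by (simp add: c algebra_simps jjw)
        then have "(j * c) \<odot> x = of_real a \<odot> (j \<odot> x) \<oplus> of_real (- b) \<odot> x"
          using x by (simp only: smult_add_left smult_mult)
        then show ?thesis using x by (simp add: smult_mult)
      qed
      have f1: "f (c \<odot> x) = a * f x + b * f (j \<odot> x)"
        unfolding 1 using x by (simp add: add scale)
      have f2: "f (j \<odot> (c \<odot> x)) = a * f (j \<odot> x) - b * f x"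
        unfolding 2 using x by (simp add: add scale del: of_real_minus)
      show ?thesis unfolding f1 f2 by (simp add: c algebra_simps jjw)
    qed
    have phi_le: "norm (?\<phi> x) \<le> nrm E x" if x: "x \<in> carrier E" for x
    proof -
      obtain c where c: "norm c = 1" "c * ?\<phi> x = of_real (norm (?\<phi> x))"
        using unimodular_rotation by blast
      have "?\<phi> (c \<odot> x) = of_real (norm (?\<phi> x))" using phi_scale[OF x] c by simp
      \<comment> \<open>After the rotation the value is a real scalar; \<open>norm_phi\<close>
        separates the two components, so that the one along \<open>j\<close> vanishes and the other
        is \<open>f (c \<odot> x)\<close>.\<close>
      then have "of_real (f (c \<odot> x) - norm (?\<phi> x)) - j * of_real (f (j \<odot> (c \<odot> x))) = 0"
        by (simp add: algebra_simps)
      then have "sqrt ((f (c \<odot> x) - norm (?\<phi> x))\<^sup>2 + (f (j \<odot> (c \<odot> x)))\<^sup>2) = 0"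
        by (metis norm_phi norm_zero)
      then have "norm (?\<phi> x) = f (c \<odot> x)" by simp
      also have "\<dots> \<le> nrm E x" using le[of "c \<odot> x"] x c(1) by (simp add: nrm_smult)
      finally show ?thesis .
    qed
    have "nrm E y \<le> norm (?\<phi> y)"
      unfolding norm_phi using fy y by (simp add: real_le_rsqrt)
    with phi_le[OF y] have "norm (?\<phi> y) = nrm E y" by linarith
    then show ?thesis using that[of ?\<phi>] phi_add phi_scale phi_le by blast
  qed
qed

lemma continuous_functionalI:
  fixes \<phi> :: "'a \<Rightarrow> 'k"
  assumes "\<And>x y. x \<in> carrier E \<Longrightarrow> y \<in> carrier E \<Longrightarrow> \<phi> (x \<oplus> y) = \<phi> x + \<phi> y"
    and "\<And>x. x \<in> carrier E \<Longrightarrow> norm (\<phi> x) \<le> C * nrm E x"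
  shows "continuous_map (ntopology E) euclidean \<phi>"
  unfolding continuous_map_def
proof (intro conjI allI impI)
  fix V :: "'k set" assume "openin euclidean V"
  then have V: "open V" by simp
  show "openin (ntopology E) {x \<in> topspace (ntopology E). \<phi> x \<in> V}"
    unfolding openin_ntopology
  proof (intro conjI ballI)
    fix x assume "x \<in> {x \<in> topspace (ntopology E). \<phi> x \<in> V}"
    then have x: "x \<in> carrier E" "\<phi> x \<in> V" by auto
    obtain e where e: "e > 0" "ball (\<phi> x) e \<subseteq> V" using V x(2) open_contains_ball by blast
    \<comment> \<open>The sign of \<open>C\<close> is not fixed; \<open>\<bar>C\<bar> + 1\<close>
      makes the radius positive in every case.\<close>
    have "\<phi> y \<in> V" if y: "y \<in> carrier E" "nrm E (y \<ominus> x) < e / (\<bar>C\<bar> + 1)" for y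
    proof -
      have "\<phi> y - \<phi> x = \<phi> (y \<ominus> x)" using assms(1)[of "y \<ominus> x" x] x y by simp
      then have "norm (\<phi> y - \<phi> x) \<le> C * nrm E (y \<ominus> x)" using assms(2)[of "y \<ominus> x"] x y by simp
      also have "\<dots> \<le> (\<bar>C\<bar> + 1) * nrm E (y \<ominus> x)" using x y by (intro mult_right_mono) auto
      also have "\<dots> < e" using y(2) by (simp add: pos_less_divide_eq mult.commute)
      finally show ?thesis using e(2) by (auto simp: dist_norm norm_minus_commute)
    qed
    then show "\<exists>r>0. \<forall>y\<in>carrier E. nrm E (y \<ominus> x) < r \<longrightarrow> y \<in> {x \<in> topspace (ntopology E). \<phi> x \<in> V}"
      using e(1) by (intro exI[of _ "e / (\<bar>C\<bar> + 1)"]) auto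
  qed auto
qed auto

lemma continuous_functional_bounded:
  fixes \<phi> :: "'a \<Rightarrow> 'k"
  assumes scale: "\<And>c x. x \<in> carrier E \<Longrightarrow> \<phi> (c \<odot> x) = c * \<phi> x"
    and cont: "continuous_map (ntopology E) euclidean \<phi>"
  obtains C where "0 \<le> C" "\<And>x. x \<in> carrier E \<Longrightarrow> norm (\<phi> x) \<le> C * nrm E x"
proof -
  have phi0: "\<phi> \<zero> = 0" using scale[of \<zero> 0] by simp
  have "openin (ntopology E) {x \<in> carrier E. \<phi> x \<in> ball 0 1}"
    using openin_continuous_map_preimage[OF cont, of "ball 0 1"] by simp
  moreover have "\<zero> \<in> {x \<in> carrier E. \<phi> x \<in> ball 0 1}" using phi0 by simp
  ultimately obtain r where r: "r > 0"
      "\<forall>y\<in>carrier E. nrm E (y \<ominus> \<zero>) < r \<longrightarrow> y \<in> {x \<in> carrier E. \<phi> x \<in> ball 0 1}"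
    unfolding openin_ntopology by blast
  have "norm (\<phi> x) \<le> 2 / r * nrm E x" if x: "x \<in> carrier E" for x
  proof (cases "x = \<zero>")
    case True
    then show ?thesis using phi0 by simp
  next
    case False
    \<comment> \<open>Scales \<open>x\<close> to norm \<open>r / 2\<close>, hence into the ball on
      which \<open>\<phi>\<close> is below 1.\<close>
    define c where "c = r / (2 * nrm E x)"
    have pos: "0 < nrm E x" using False x nrm_eq_0_iff[OF x] nrm_nonneg[OF x] by linarith
    have c: "0 < c" "c * nrm E x = r / 2" using pos r(1) by (simp_all add: c_def)
    have "of_real c \<odot> x \<ominus> \<zero> = of_real c \<odot> x" using x by (simp add: minus_eq_smult)
    then have "nrm E (of_real c \<odot> x \<ominus> \<zero>) < r" using x c r(1) by (simp add: nrm_smult)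
    then have "norm (\<phi> (of_real c \<odot> x)) < 1" using r(2) x by auto
    then have "c * norm (\<phi> x) < 1" using x c by (simp add: scale norm_mult)
    then show ?thesis using pos r(1) by (simp add: c_def field_simps)
  qed
  then show ?thesis using that[of "2 / r"] r(1) by auto
qed

end

lemma dual_space_simps [simp]:
  "\<zero>\<^bsub>dual_space E\<^esub> = (\<lambda>x\<in>carrier E. 0)"
  "\<phi> \<oplus>\<^bsub>dual_space E\<^esub> \<psi> = (\<lambda>x\<in>carrier E. \<phi> x + \<psi> x)"
  "c \<odot>\<^bsub>dual_space E\<^esub> \<phi> = (\<lambda>x\<in>carrier E. c * \<phi> x)"
  by (simp_all add: dual_space_def)

lemma nrm_dual_space: "nrm (dual_space E) \<phi> = (SUP x\<in>{x \<in> carrier E. nrm E x \<le> 1}. norm (\<phi> x))"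
  by (simp add: dual_space_def)

context normed_module
begin

text \<open>Trades continuity for the existence of a bound, the form in which the dual and bidual
  are handled from here on.\<close>

lemma mem_dual_space_iff:
  "\<phi> \<in> carrier (dual_space E) \<longleftrightarrow> \<phi> \<in> extensional (carrier E) \<and>
     (\<forall>x\<in>carrier E. \<forall>y\<in>carrier E. \<phi> (x \<oplus> y) = \<phi> x + \<phi> y) \<and>
     (\<forall>c. \<forall>x\<in>carrier E. \<phi> (c \<odot> x) = c * \<phi> x) \<and>
     (\<exists>C. \<forall>x\<in>carrier E. norm (\<phi> x) \<le> C * nrm E x)"
  (is "_ \<longleftrightarrow> ?A \<and> ?B \<and> ?C \<and> ?D")
proof -
  have "continuous_map (ntopology E) euclidean \<phi> \<longleftrightarrow> ?D" if B: ?B and C: ?C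
  proof
    assume "continuous_map (ntopology E) euclidean \<phi>"
    then show ?D using continuous_functional_bounded[of \<phi>] C by metis
  next
    assume ?D
    then show "continuous_map (ntopology E) euclidean \<phi>" using continuous_functionalI[of \<phi>] B by metis
  qed
  then show ?thesis unfolding dual_space_def by auto
qed

lemma dual_kmodule: "kmodule (dual_space E)"
proof (rule kmoduleI)
  fix \<phi> \<psi> assume "\<phi> \<in> carrier (dual_space E)" "\<psi> \<in> carrier (dual_space E)"
  then obtain C D where *: "\<forall>x\<in>carrier E. norm (\<phi> x) \<le> C * nrm E x"
      "\<forall>x\<in>carrier E. norm (\<psi> x) \<le> D * nrm E x"
      and **: "\<phi> \<in> carrier (dual_space E)" "\<psi> \<in> carrier (dual_space E)"
    by (auto simp: mem_dual_space_iff)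
  have "norm (\<phi> x + \<psi> x) \<le> (C + D) * nrm E x" if "x \<in> carrier E" for x
    using * that norm_triangle_ineq[of "\<phi> x" "\<psi> x"] by (fastforce simp: distrib_right)
  then have "\<exists>C. \<forall>x\<in>carrier E. norm (\<phi> x + \<psi> x) \<le> C * nrm E x" by blast
  then show "\<phi> \<oplus>\<^bsub>dual_space E\<^esub> \<psi> \<in> carrier (dual_space E)"
    using ** unfolding mem_dual_space_iff by (auto simp: algebra_simps)
next
  show "\<zero>\<^bsub>dual_space E\<^esub> \<in> carrier (dual_space E)"
    by (auto simp: mem_dual_space_iff intro!: exI[of _ 0])
next
  fix c \<phi> assume *: "\<phi> \<in> carrier (dual_space E)"
  then obtain C where "\<forall>x\<in>carrier E. norm (\<phi> x) \<le> C * nrm E x"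
    by (auto simp: mem_dual_space_iff)
  then have "norm (c * \<phi> x) \<le> (norm c * C) * nrm E x" if "x \<in> carrier E" for x
    using that by (simp add: norm_mult mult_left_mono mult.assoc)
  then have "\<exists>C. \<forall>x\<in>carrier E. norm (c * \<phi> x) \<le> C * nrm E x" by blast
  then show "c \<odot>\<^bsub>dual_space E\<^esub> \<phi> \<in> carrier (dual_space E)"
    using * unfolding mem_dual_space_iff by (auto simp: algebra_simps)
qed (auto simp: fun_eq_iff algebra_simps mem_dual_space_iff extensional_def)

lemma bdd_above_dual:
  assumes phi: "\<phi> \<in> carrier (dual_space E)"
  shows "bdd_above ((\<lambda>x. norm (\<phi> x)) ` {x \<in> carrier E. nrm E x \<le> 1})"
proof -
  obtain C where C: "\<forall>x\<in>carrier E. norm (\<phi> x) \<le> C * nrm E x"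
    using phi by (auto simp: mem_dual_space_iff)
  have "norm (\<phi> x) \<le> \<bar>C\<bar>" if "x \<in> carrier E" "nrm E x \<le> 1" for x
  proof -
    have "norm (\<phi> x) \<le> C * nrm E x" using C that by auto
    also have "\<dots> \<le> \<bar>C\<bar> * 1" using that by (intro mult_mono) auto
    finally show ?thesis by simp
  qed
  then show ?thesis by (intro bdd_aboveI2[of _ _ "\<bar>C\<bar>"]) auto
qed

lemma norm_le_nrm_dual:
  assumes phi: "\<phi> \<in> carrier (dual_space E)" and x: "x \<in> carrier E"
  shows "norm (\<phi> x) \<le> nrm (dual_space E) \<phi> * nrm E x"
proof -
  have scale: "\<phi> (c \<odot> x) = c * \<phi> x" if "x \<in> carrier E" for c x
    using phi that by (auto simp: mem_dual_space_iff)
  show ?thesis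
  proof (cases "nrm E x = 0")
    case True
    then have "x = \<zero>" using x by (simp add: nrm_eq_0_iff)
    then show ?thesis using scale[of \<zero> 0] by simp
  next
    case False
    with x have pos: "0 < nrm E x" by (simp add: order_less_le)
    have "norm (\<phi> (of_real (1 / nrm E x) \<odot> x)) \<le> nrm (dual_space E) \<phi>"
      unfolding nrm_dual_space using pos x by (intro cSUP_upper bdd_above_dual phi) (auto simp: nrm_smult norm_divide)
    then show ?thesis using pos x by (simp add: scale norm_divide divide_le_eq)
  qed
qed

lemma nrm_dual_le:
  assumes "\<And>x. x \<in> carrier E \<Longrightarrow> nrm E x \<le> 1 \<Longrightarrow> norm (\<phi> x) \<le> C"
  shows "nrm (dual_space E) \<phi> \<le> C"
  unfolding nrm_dual_space using assms
  by (intro cSUP_least) (auto intro!: exI[of _ \<zero>])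

lemma dual_normed_module: "normed_module (dual_space E)"
proof -
  interpret D: kmodule "dual_space E" by (rule dual_kmodule)
  note le = norm_le_nrm_dual
  have le1: "norm (\<phi> x) \<le> nrm (dual_space E) \<phi>"
    if "\<phi> \<in> carrier (dual_space E)" "x \<in> carrier E" "nrm E x \<le> 1" for \<phi> x
  proof -
    have "norm (\<phi> \<zero>) \<le> nrm (dual_space E) \<phi>"
      unfolding nrm_dual_space using bdd_above_dual[OF that(1)] by (intro cSUP_upper) auto
    then have "0 \<le> nrm (dual_space E) \<phi>" by (meson norm_ge_zero order_trans)
    then have "nrm (dual_space E) \<phi> * nrm E x \<le> nrm (dual_space E) \<phi>"
      using that by (intro mult_left_le) auto
    with le[OF that(1,2)] show ?thesis by linarith
  qed
  have nonneg: "0 \<le> nrm (dual_space E) \<phi>" if "\<phi> \<in> carrier (dual_space E)" for \<phi>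
    using order_trans[OF norm_ge_zero le1[OF that, of \<zero>]] by simp
  have smult_le: "nrm (dual_space E) (c \<odot>\<^bsub>dual_space E\<^esub> \<phi>) \<le> norm c * nrm (dual_space E) \<phi>"
    if "\<phi> \<in> carrier (dual_space E)" for c \<phi>
    using le1[OF that] by (intro nrm_dual_le) (auto simp: norm_mult intro: mult_left_mono)
  show ?thesis
  proof (unfold_locales)
    fix \<phi> assume phi: "\<phi> \<in> carrier (dual_space E)"
    show "0 \<le> nrm (dual_space E) \<phi>" by (rule nonneg[OF phi])
    show "nrm (dual_space E) \<phi> = 0 \<longleftrightarrow> \<phi> = \<zero>\<^bsub>dual_space E\<^esub>"
    proof
      assume "nrm (dual_space E) \<phi> = 0"
      then have "\<phi> x = 0" if "x \<in> carrier E" for x using le[OF phi that] by simp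
      then show "\<phi> = \<zero>\<^bsub>dual_space E\<^esub>"
        using phi by (auto simp: fun_eq_iff mem_dual_space_iff extensional_def)
    next
      assume "\<phi> = \<zero>\<^bsub>dual_space E\<^esub>"
      then have "nrm (dual_space E) \<phi> \<le> 0" by (intro nrm_dual_le) auto
      with nonneg[OF phi] show "nrm (dual_space E) \<phi> = 0" by simp
    qed
    fix c
    show "nrm (dual_space E) (c \<odot>\<^bsub>dual_space E\<^esub> \<phi>) = norm c * nrm (dual_space E) \<phi>"
    proof (cases "c = 0")
      case True
      then show ?thesis
        using smult_le[OF phi, of 0] nonneg[of "0 \<odot>\<^bsub>dual_space E\<^esub> \<phi>"] phi
        by (simp del: dual_space_simps)
    next
      case False
      \<comment> \<open>The reverse inequality is the one already obtained, applied to the scalar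
        \<open>inverse c\<close> and the functional \<open>c \<odot> \<phi>\<close>.\<close>
      have "nrm (dual_space E) (inverse c \<odot>\<^bsub>dual_space E\<^esub> (c \<odot>\<^bsub>dual_space E\<^esub> \<phi>))
          \<le> norm (inverse c) * nrm (dual_space E) (c \<odot>\<^bsub>dual_space E\<^esub> \<phi>)"
        using phi by (intro smult_le D.smult_closed')
      moreover have "inverse c \<odot>\<^bsub>dual_space E\<^esub> (c \<odot>\<^bsub>dual_space E\<^esub> \<phi>) = \<phi>"
        using phi False by (simp del: dual_space_simps flip: D.smult_mult)
      ultimately have "nrm (dual_space E) \<phi> \<le> nrm (dual_space E) (c \<odot>\<^bsub>dual_space E\<^esub> \<phi>) / norm c"
        by (simp add: norm_inverse divide_inverse mult.commute del: dual_space_simps)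
      then have "norm c * nrm (dual_space E) \<phi> \<le> nrm (dual_space E) (c \<odot>\<^bsub>dual_space E\<^esub> \<phi>)"
        using False by (simp add: pos_le_divide_eq mult.commute del: dual_space_simps)
      with smult_le[OF phi, of c] show ?thesis by linarith
    qed
    fix \<psi> assume psi: "\<psi> \<in> carrier (dual_space E)"
    show "nrm (dual_space E) (\<phi> \<oplus>\<^bsub>dual_space E\<^esub> \<psi>) \<le> nrm (dual_space E) \<phi> + nrm (dual_space E) \<psi>"
    proof (rule nrm_dual_le)
      fix x assume x: "x \<in> carrier E" "nrm E x \<le> 1"
      have "norm (\<phi> x + \<psi> x) \<le> norm (\<phi> x) + norm (\<psi> x)" by (rule norm_triangle_ineq)
      with le1[OF phi x] le1[OF psi x] x
      show "norm ((\<phi> \<oplus>\<^bsub>dual_space E\<^esub> \<psi>) x) \<le> nrm (dual_space E) \<phi> + nrm (dual_space E) \<psi>"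
        by simp
    qed
  qed
qed

lemma canonical_embedding_lin: "lin E (dual_space (dual_space E)) (canonical_embedding E)"
proof -
  interpret D: normed_module "dual_space E" by (rule dual_normed_module)
  show ?thesis
  proof (rule linI)
    fix x assume x: "x \<in> carrier E"
    have "norm (canonical_embedding E x \<phi>) \<le> nrm E x * nrm (dual_space E) \<phi>"
      if "\<phi> \<in> carrier (dual_space E)" for \<phi>
      using norm_le_nrm_dual[OF that x] that by (simp add: canonical_embedding_def mult.commute)
    moreover have "canonical_embedding E x \<in> extensional (carrier (dual_space E))"
      by (simp add: canonical_embedding_def)
    ultimately show "canonical_embedding E x \<in> carrier (dual_space (dual_space E))"
      using x D.add_closed D.smult_closed' unfolding D.mem_dual_space_iff
      by (auto simp: canonical_embedding_def)
  qed (auto simp: canonical_embedding_def fun_eq_iff mem_dual_space_iff)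
qed

lemma nrm_canonical_embedding:
  assumes x: "x \<in> carrier E"
  shows "nrm (dual_space (dual_space E)) (canonical_embedding E x) = nrm E x"
proof (rule antisym)
  interpret D: normed_module "dual_space E" by (rule dual_normed_module)
  show "nrm (dual_space (dual_space E)) (canonical_embedding E x) \<le> nrm E x"
  proof (rule D.nrm_dual_le)
    fix \<phi> assume phi: "\<phi> \<in> carrier (dual_space E)" "nrm (dual_space E) \<phi> \<le> 1"
    have "norm (\<phi> x) \<le> nrm (dual_space E) \<phi> * nrm E x" by (rule norm_le_nrm_dual[OF phi(1) x])
    also have "\<dots> \<le> 1 * nrm E x" using phi x by (intro mult_right_mono) auto
    finally show "norm (canonical_embedding E x \<phi>) \<le> nrm E x"
      using phi by (simp add: canonical_embedding_def)
  qed
  obtain \<psi> where psi: "\<And>x z. x \<in> carrier E \<Longrightarrow> z \<in> carrier E \<Longrightarrow> \<psi> (x \<oplus> z) = \<psi> x + \<psi> z"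
    "\<And>c x. x \<in> carrier E \<Longrightarrow> \<psi> (c \<odot> x) = c * \<psi> x"
    "\<And>x. x \<in> carrier E \<Longrightarrow> norm (\<psi> x) \<le> nrm E x" "norm (\<psi> x) = nrm E x"
    using norming_functional[OF x] by blast
  \<comment> \<open>Restricted because members of the dual are \<open>undefined\<close> off the
    carrier, while the norming functional is arbitrary there.\<close>
  define \<phi> where "\<phi> = restrict \<psi> (carrier E)"
  have phi: "\<phi> \<in> carrier (dual_space E)"
    using psi unfolding mem_dual_space_iff by (auto simp: \<phi>_def intro!: exI[of _ 1])
  have "nrm (dual_space E) \<phi> \<le> 1"
    using psi(3) by (intro nrm_dual_le) (force simp: \<phi>_def)
  have "nrm E x = norm (canonical_embedding E x \<phi>)"
    using phi psi(4) x by (simp add: canonical_embedding_def \<phi>_def)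
  also have "\<dots> \<le> nrm (dual_space (dual_space E)) (canonical_embedding E x) * nrm (dual_space E) \<phi>"
    using linD(1)[OF canonical_embedding_lin x] phi by (rule D.norm_le_nrm_dual)
  also have "\<dots> \<le> nrm (dual_space (dual_space E)) (canonical_embedding E x) * 1"
    using \<open>nrm (dual_space E) \<phi> \<le> 1\<close> linD(1)[OF canonical_embedding_lin x]
      normed_module.nrm_nonneg[OF D.dual_normed_module]
    by (intro mult_left_mono) auto
  finally show "nrm E x \<le> nrm (dual_space (dual_space E)) (canonical_embedding E x)" by simp
qed

end

subsection \<open>Ultraproducts\<close>

text \<open>Compactness of the interval gives the image filter a cluster point. Along an ultrafilter
  a cluster point is a limit: a neighbourhood that does not eventually contain the values is
  eventually avoided by them.\<close>

lemma ultrafilter_bounded_limit: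
  fixes f :: "'i \<Rightarrow> real"
  assumes U: "ultrafilter U" and f: "\<And>i. \<bar>f i\<bar> \<le> K"
  obtains l where "(f \<longlongrightarrow> l) U"
proof -
  have "filtermap f U \<noteq> bot" using U by (simp add: ultrafilter_def filtermap_bot_iff)
  moreover have "eventually (\<lambda>x. x \<in> {- K..K}) (filtermap f U)"
    using f by (simp add: eventually_filtermap abs_le_iff minus_le_iff)
  ultimately obtain l where l: "inf (nhds l) (filtermap f U) \<noteq> bot"
    using compact_Icc[of "- K" K] unfolding compact_filter by blast
  have "(f \<longlongrightarrow> l) U"
    unfolding tendsto_def
  proof (intro allI impI)
    fix S assume S: "open S" "l \<in> S"
    show "eventually (\<lambda>i. f i \<in> S) U"
    proof (rule ccontr)
      assume "\<not> eventually (\<lambda>i. f i \<in> S) U"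
      then have "eventually (\<lambda>i. f i \<notin> S) U" using U unfolding ultrafilter_def by blast
      then have "eventually (\<lambda>x. x \<notin> S) (filtermap f U)" by (simp add: eventually_filtermap)
      moreover have "eventually (\<lambda>x. x \<in> S) (nhds l)" using S by (rule eventually_nhds_in_open)
      ultimately have "eventually (\<lambda>x. False) (inf (nhds l) (filtermap f U))"
        unfolding eventually_inf by blast
      with l show False by (simp add: trivial_limit_def)
    qed
  qed
  then show ?thesis by (rule that)
qed

text \<open>The ultraproduct is a quotient module whose norm has been exchanged; the module laws do
  not mention the norm.\<close>

lemma kmodule_nrm_update: "kmodule E \<Longrightarrow> kmodule (E\<lparr>nrm := f\<rparr>)"
proof -
  assume "kmodule E"
  then interpret kmodule E .
  show ?thesis
    by (rule kmoduleI) (auto simp: M.a_ac smult_add_left smult_add_right smult_mult)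
qed

lemma linfty_simps [simp]:
  "\<zero>\<^bsub>linfty_space E\<^esub> = (\<lambda>i. \<zero>\<^bsub>E i\<^esub>)"
  "x \<oplus>\<^bsub>linfty_space E\<^esub> y = (\<lambda>i. x i \<oplus>\<^bsub>E i\<^esub> y i)"
  "c \<odot>\<^bsub>linfty_space E\<^esub> x = (\<lambda>i. c \<odot>\<^bsub>E i\<^esub> x i)"
  by (simp_all add: linfty_space_def)

lemma mem_linfty_iff:
  "x \<in> carrier (linfty_space E) \<longleftrightarrow> (\<forall>i. x i \<in> carrier (E i)) \<and> (\<exists>K. \<forall>i. nrm (E i) (x i) \<le> K)"
  by (auto simp: linfty_space_def bdd_above_def)

locale ultraproduct_of_normed =
  fixes U :: "'i filter" and E :: "'i \<Rightarrow> ('k::real_or_complex, 'a) nspace"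
  assumes U: "ultrafilter U" and normed: "normed_module (E i)"
begin

lemma U_not_bot: "U \<noteq> bot"
  using U by (simp add: ultrafilter_def)

sublocale N: normed_module "E i" for i
  by (rule normed)

lemma linfty_kmodule: "kmodule (linfty_space E)"
proof (rule kmoduleI)
  fix x y assume xy: "x \<in> carrier (linfty_space E)" "y \<in> carrier (linfty_space E)"
  then obtain K L where KL: "\<And>i. nrm (E i) (x i) \<le> K" "\<And>i. nrm (E i) (y i) \<le> L"
    by (auto simp: mem_linfty_iff)
  have "nrm (E i) (x i \<oplus>\<^bsub>E i\<^esub> y i) \<le> K + L" for i
    using N.nrm_triangle[of "x i" i "y i"] xy KL[of i] by (auto simp: mem_linfty_iff)
  with xy show "x \<oplus>\<^bsub>linfty_space E\<^esub> y \<in> carrier (linfty_space E)"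
    unfolding mem_linfty_iff linfty_simps by blast
next
  fix c x assume x: "x \<in> carrier (linfty_space E)"
  then obtain K where "\<And>i. nrm (E i) (x i) \<le> K" by (auto simp: mem_linfty_iff)
  then have "nrm (E i) (c \<odot>\<^bsub>E i\<^esub> x i) \<le> norm c * K" for i
    using x by (simp add: mem_linfty_iff N.nrm_smult mult_left_mono)
  with x show "c \<odot>\<^bsub>linfty_space E\<^esub> x \<in> carrier (linfty_space E)"
    unfolding mem_linfty_iff linfty_simps by blast
next
  show "\<zero>\<^bsub>linfty_space E\<^esub> \<in> carrier (linfty_space E)"
    by (auto simp: mem_linfty_iff)
qed (auto simp: mem_linfty_iff fun_eq_iff N.M.a_assoc N.smult_add_left N.smult_add_right
    N.smult_mult intro: N.M.a_comm)

sublocale I: kmodule "linfty_space E"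
  by (rule linfty_kmodule)

lemma linfty_component: "x \<in> carrier (linfty_space E) \<Longrightarrow> x i \<in> carrier (E i)"
  by (simp add: mem_linfty_iff)

lemma lin_component: "lin (linfty_space E) (E i) (\<lambda>x. x i)"
  by (rule linI) (auto simp: mem_linfty_iff)

lemma minus_linfty:
  assumes "x \<in> carrier (linfty_space E)" "y \<in> carrier (linfty_space E)"
  shows "(x \<ominus>\<^bsub>linfty_space E\<^esub> y) i = x i \<ominus>\<^bsub>E i\<^esub> y i"
  using lin_minus[OF linfty_kmodule N.kmodule_axioms lin_component assms] .

lemma null_families_submodule: "submodule (null_families U E) ring_of_type_algebra (linfty_space E)"
proof (rule I.submoduleI)
  note carrier = I.add_closed I.smult_closed' I.zero_in_carrier
  show "null_families U E \<subseteq> carrier (linfty_space E)" by (auto simp: null_families_def)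
  show "\<zero>\<^bsub>linfty_space E\<^esub> \<in> null_families U E"
    using carrier by (simp add: null_families_def)
  show smult: "c \<odot>\<^bsub>linfty_space E\<^esub> x \<in> null_families U E" if "x \<in> null_families U E" for c x
    using that carrier(2)[of x c] tendsto_mult_right_zero[of "\<lambda>i. nrm (E i) (x i)" U "norm c"]
    by (auto simp: null_families_def mem_linfty_iff N.nrm_smult)
  show "\<ominus>\<^bsub>linfty_space E\<^esub> x \<in> null_families U E" if "x \<in> null_families U E" for x
  proof -
    have "x \<in> carrier (linfty_space E)" using that by (simp add: null_families_def)
    from I.smult_minus_1[OF this] show ?thesis using smult[OF that, of "- 1"] by (simp del: linfty_simps)
  qed
  show "x \<oplus>\<^bsub>linfty_space E\<^esub> y \<in> null_families U E"
    if "x \<in> null_families U E" "y \<in> null_families U E" for x y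
  proof -
    have xy: "x \<in> carrier (linfty_space E)" "y \<in> carrier (linfty_space E)"
      using that by (auto simp: null_families_def)
    have "((\<lambda>i. nrm (E i) (x i) + nrm (E i) (y i)) \<longlongrightarrow> 0) U"
      using that tendsto_add[of _ 0 U _ 0] by (force simp: null_families_def)
    moreover have "0 \<le> nrm (E i) (x i \<oplus>\<^bsub>E i\<^esub> y i)"
        "nrm (E i) (x i \<oplus>\<^bsub>E i\<^esub> y i) \<le> nrm (E i) (x i) + nrm (E i) (y i)" for i
      using xy by (simp_all add: mem_linfty_iff N.nrm_triangle)
    ultimately have "((\<lambda>i. nrm (E i) (x i \<oplus>\<^bsub>E i\<^esub> y i)) \<longlongrightarrow> 0) U"
      by (intro tendsto_sandwich[of "\<lambda>_. 0" "\<lambda>i. nrm (E i) (x i \<oplus>\<^bsub>E i\<^esub> y i)" U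
            "\<lambda>i. nrm (E i) (x i) + nrm (E i) (y i)"]) auto
    then show ?thesis using carrier(1)[OF xy] by (simp add: null_families_def)
  qed
qed

sublocale Q: quotient_of_module "linfty_space E" "null_families U E"
  by (intro quotient_of_module.intro quotient_of_module_axioms.intro linfty_kmodule
    null_families_submodule)

lemma carrier_ultraproduct:
  "carrier (ultraproduct U E) = ultraclass U E ` carrier (linfty_space E)"
  using Q.carrier_quotient by (simp add: ultraproduct_def ultraclass_def[abs_def])

lemma ultraproduct_kmodule: "kmodule (ultraproduct U E)"
  unfolding ultraproduct_def by (rule kmodule_nrm_update[OF Q.quotient_kmodule])

sublocale P: kmodule "ultraproduct U E"
  by (rule ultraproduct_kmodule)

lemma lin_ultraclass: "lin (linfty_space E) (ultraproduct U E) (ultraclass U E)"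
  using Q.lin_quotient_map by (simp add: ultraproduct_def ultraclass_def[abs_def] lin_def)

lemma ultraclass_eq_iff:
  assumes "x \<in> carrier (linfty_space E)" "y \<in> carrier (linfty_space E)"
  shows "ultraclass U E x = ultraclass U E y \<longleftrightarrow> ((\<lambda>i. nrm (E i) (x i \<ominus>\<^bsub>E i\<^esub> y i)) \<longlongrightarrow> 0) U"
  unfolding ultraclass_def Q.quotient_map_eq_iff[OF assms]
  by (simp only: null_families_def mem_Collect_eq I.minus_closed'[OF assms] minus_linfty[OF assms]
      simp_thms)

lemma representative_ultraclass:
  assumes "A \<in> carrier (ultraproduct U E)"
  shows "representative A \<in> carrier (linfty_space E)" "ultraclass U E (representative A) = A"
proof -
  obtain x where x: "x \<in> carrier (linfty_space E)" "A = ultraclass U E x"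
    using assms carrier_ultraproduct by auto
  then have "x \<in> A" using Q.mem_quotient_map[OF x(1)] Q.L_zero by (simp add: ultraclass_def)
  then have "representative A \<in> A" unfolding representative_def by (rule someI[of "\<lambda>x. x \<in> A"])
  then have r: "representative A \<in> carrier (linfty_space E)"
    "representative A \<ominus>\<^bsub>linfty_space E\<^esub> x \<in> null_families U E"
    using Q.mem_quotient_map[OF x(1)] x(2) by (auto simp: ultraclass_def)
  then show "representative A \<in> carrier (linfty_space E)" by simp
  show "ultraclass U E (representative A) = A"
    using Q.quotient_map_eq_iff[OF r(1) x(1)] r(2) x(2) by (simp add: ultraclass_def)
qed

text \<open>The norm of a class is a \<open>Lim\<close> along its chosen representative. That limit
  exists because the representative is bounded and \<open>U\<close> is an ultrafilter; any other
  representative differs from it by a null family, so its norms have the same limit. Every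
  computation of norms in the ultraproduct rests on this.\<close>

lemma tendsto_nrm_ultraclass:
  assumes x: "x \<in> carrier (linfty_space E)"
  shows "((\<lambda>i. nrm (E i) (x i)) \<longlongrightarrow> nrm (ultraproduct U E) (ultraclass U E x)) U"
proof -
  define r where "r = representative (ultraclass U E x)"
  have "ultraclass U E x \<in> carrier (ultraproduct U E)" using x carrier_ultraproduct by auto
  then have r: "r \<in> carrier (linfty_space E)" "ultraclass U E r = ultraclass U E x"
    unfolding r_def by (rule representative_ultraclass)+
  obtain K where "\<And>i. nrm (E i) (r i) \<le> K" using r(1) by (auto simp: mem_linfty_iff)
  then have "\<bar>nrm (E i) (r i)\<bar> \<le> K" for i using linfty_component[OF r(1)] by (simp add: abs_of_nonneg)
  then obtain l where l: "((\<lambda>i. nrm (E i) (r i)) \<longlongrightarrow> l) U"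
    using ultrafilter_bounded_limit[OF U, of "\<lambda>i. nrm (E i) (r i)" K] by blast
  then have "nrm (ultraproduct U E) (ultraclass U E x) = l"
    using tendsto_Lim[OF U_not_bot l] by (simp add: ultraproduct_def r_def)
  moreover have "((\<lambda>i. nrm (E i) (r i) - nrm (E i) (x i)) \<longlongrightarrow> 0) U"
  proof (rule Lim_null_comparison)
    show "((\<lambda>i. nrm (E i) (r i \<ominus>\<^bsub>E i\<^esub> x i)) \<longlongrightarrow> 0) U"
      using r(2) ultraclass_eq_iff[OF r(1) x] by simp
    show "\<forall>\<^sub>F i in U. norm (nrm (E i) (r i) - nrm (E i) (x i)) \<le> nrm (E i) (r i \<ominus>\<^bsub>E i\<^esub> x i)"
      using linfty_component[OF r(1)] linfty_component[OF x]
      by (intro always_eventually allI) (simp add: N.nrm_diff_le)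
  qed
  then have "((\<lambda>i. nrm (E i) (x i)) \<longlongrightarrow> l) U"
    using tendsto_diff[OF l] by fastforce
  ultimately show ?thesis by simp
qed

text \<open>Homogeneity and the triangle inequality pass to the limit; definiteness holds because
  the families of limit norm 0 are exactly those divided out.\<close>

lemma ultraproduct_normed_module: "normed_module (ultraproduct U E)"
proof unfold_locales
  note lim = tendsto_nrm_ultraclass
  fix A assume "A \<in> carrier (ultraproduct U E)"
  then obtain x where x: "x \<in> carrier (linfty_space E)" "A = ultraclass U E x"
    using carrier_ultraproduct by auto
  show "0 \<le> nrm (ultraproduct U E) A"
    using linfty_component[OF x(1)] unfolding x(2)
    by (intro tendsto_lowerbound[OF lim[OF x(1)] _ U_not_bot]) auto
  have zero: "\<zero>\<^bsub>ultraproduct U E\<^esub> = ultraclass U E \<zero>\<^bsub>linfty_space E\<^esub>"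
    using lin_zero[OF linfty_kmodule ultraproduct_kmodule lin_ultraclass] by simp
  have "A = \<zero>\<^bsub>ultraproduct U E\<^esub> \<longleftrightarrow> ((\<lambda>i. nrm (E i) (x i)) \<longlongrightarrow> 0) U"
    unfolding x(2) zero ultraclass_eq_iff[OF x(1) I.zero_in_carrier]
    using linfty_component[OF x(1)] by (simp add: N.minus_eq_smult)
  also have "\<dots> \<longleftrightarrow> nrm (ultraproduct U E) A = 0"
    using lim[OF x(1)] x(2) tendsto_unique[OF U_not_bot] by fastforce
  finally show "nrm (ultraproduct U E) A = 0 \<longleftrightarrow> A = \<zero>\<^bsub>ultraproduct U E\<^esub>" by simp
  fix c :: 'k
  have "((\<lambda>i. norm c * nrm (E i) (x i)) \<longlongrightarrow> norm c * nrm (ultraproduct U E) A) U"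
    unfolding x(2) by (intro tendsto_mult_left lim x)
  moreover have "((\<lambda>i. norm c * nrm (E i) (x i)) \<longlongrightarrow> nrm (ultraproduct U E) (c \<odot>\<^bsub>ultraproduct U E\<^esub> A)) U"
    using lim[OF I.smult_closed'[OF x(1), of c]] linD(3)[OF lin_ultraclass x(1), of c]
      linfty_component[OF x(1)] by (simp add: x(2) N.nrm_smult)
  ultimately show "nrm (ultraproduct U E) (c \<odot>\<^bsub>ultraproduct U E\<^esub> A) = norm c * nrm (ultraproduct U E) A"
    by (rule tendsto_unique[OF U_not_bot, rotated])
  fix B assume "B \<in> carrier (ultraproduct U E)"
  then obtain y where y: "y \<in> carrier (linfty_space E)" "B = ultraclass U E y"
    using carrier_ultraproduct by auto
  have sum: "((\<lambda>i. nrm (E i) (x i \<oplus>\<^bsub>E i\<^esub> y i)) \<longlongrightarrow> nrm (ultraproduct U E) (A \<oplus>\<^bsub>ultraproduct U E\<^esub> B)) U"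
    using lim[OF I.add_closed[OF x(1) y(1)]] linD(2)[OF lin_ultraclass x(1) y(1)] x y by simp
  show "nrm (ultraproduct U E) (A \<oplus>\<^bsub>ultraproduct U E\<^esub> B)
      \<le> nrm (ultraproduct U E) A + nrm (ultraproduct U E) B"
    unfolding x(2) y(2)
  proof (rule tendsto_le[OF U_not_bot tendsto_add[OF lim[OF x(1)] lim[OF y(1)]] sum[unfolded x(2) y(2)]])
    show "\<forall>\<^sub>F i in U. nrm (E i) (x i \<oplus>\<^bsub>E i\<^esub> y i) \<le> nrm (E i) (x i) + nrm (E i) (y i)"
      using linfty_component[OF x(1)] linfty_component[OF y(1)]
      by (intro always_eventually allI N.nrm_triangle)
  qed
qed

end

subsection \<open>Sequence norms\<close>

definition snorm :: "(nat \<Rightarrow> ((nat \<Rightarrow> real) \<Rightarrow> real) \<Rightarrow> real) \<Rightarrow> ('k::real_or_complex, 'a) nspace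
    \<Rightarrow> nat \<Rightarrow> (nat \<Rightarrow> 'a) \<Rightarrow> real" where
  "snorm \<Phi> E k x = \<Phi> k (\<lambda>s. nrm E (lincomb E k s x))"

text \<open>
  The Rademacher norm and the \<open>p\<close>-norm of \<open>x\<^sub>1, \<dots>, x\<^sub>k\<close> depend, monotonically and
  continuously, on the norms of finitely many real linear combinations of the vectors: those with
  signs as coefficients, and the vectors themselves. The set \<open>S k\<close> holds the coefficients.
\<close>

locale seq_functional =
  fixes \<Phi> :: "nat \<Rightarrow> ((nat \<Rightarrow> real) \<Rightarrow> real) \<Rightarrow> real" and S :: "nat \<Rightarrow> (nat \<Rightarrow> real) set"
  assumes finite_S: "finite (S k)"
    and functional_nonneg: "(\<And>s. s \<in> S k \<Longrightarrow> 0 \<le> v s) \<Longrightarrow> 0 \<le> \<Phi> k v"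
    and functional_mono: "(\<And>s. s \<in> S k \<Longrightarrow> 0 \<le> v s) \<Longrightarrow> (\<And>s. s \<in> S k \<Longrightarrow> v s \<le> w s) \<Longrightarrow> \<Phi> k v \<le> \<Phi> k w"
    and functional_continuous: "\<And>F :: ((nat \<Rightarrow> real) \<Rightarrow> real) filter.
      (\<And>s. s \<in> S k \<Longrightarrow> ((\<lambda>v. v s) \<longlongrightarrow> w s) F) \<Longrightarrow>
      eventually (\<lambda>v. \<forall>s\<in>S k. 0 \<le> v s) F \<Longrightarrow> (\<Phi> k \<longlongrightarrow> \<Phi> k w) F"
    and functional_one: "0 \<le> a \<Longrightarrow> \<Phi> 1 (\<lambda>s. \<bar>s 1\<bar> * a) = a"
begin

lemma snorm_nonneg:
  assumes "normed_module E" "\<forall>j\<in>{1..k}. x j \<in> carrier E"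
  shows "0 \<le> snorm \<Phi> E k x"
proof -
  interpret E: normed_module E by fact
  show ?thesis
    unfolding snorm_def
    using lincomb_closed[OF E.kmodule_axioms assms(2)] by (intro functional_nonneg E.nrm_nonneg)
qed

lemma snorm_one:
  assumes "normed_module E" "x 1 \<in> carrier E"
  shows "snorm \<Phi> E 1 x = nrm E (x 1)"
proof -
  interpret E: normed_module E by fact
  have "lincomb E 1 s x = of_real (s 1) \<odot>\<^bsub>E\<^esub> x 1" for s
    using assms(2) by (intro lincomb_single E.kmodule_axioms) auto
  then have "snorm \<Phi> E 1 x = \<Phi> 1 (\<lambda>s. \<bar>s 1\<bar> * nrm E (x 1))"
    using assms(2) by (simp add: snorm_def E.nrm_smult)
  also have "\<dots> = nrm E (x 1)" using assms(2) by (intro functional_one) auto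
  finally show ?thesis .
qed

lemma snorm_lin_le:
  assumes "kmodule E" "kmodule F" "lin E F h" "\<forall>j\<in>{1..k}. x j \<in> carrier E"
    and "\<And>z. z \<in> carrier E \<Longrightarrow> 0 \<le> nrm F (h z)" "\<And>z. z \<in> carrier E \<Longrightarrow> nrm F (h z) \<le> nrm E z"
  shows "snorm \<Phi> F k (\<lambda>j. h (x j)) \<le> snorm \<Phi> E k x"
  unfolding snorm_def lin_lincomb[OF assms(1-4), symmetric]
  using lincomb_closed[OF assms(1,4)] assms(5,6) by (intro functional_mono) auto

text \<open>In contrast to \<open>snorm_lin_le\<close>, the comparison of norms is asked only at the
  combinations with coefficients in the finite set \<open>S k\<close>. This weaker demand can be met
  by a quotient map, which does not preserve all norms.\<close>

lemma snorm_lin_ge: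
  assumes "kmodule E" "kmodule F" "lin E F h" "\<forall>j\<in>{1..k}. x j \<in> carrier E"
    and "\<And>s. s \<in> S k \<Longrightarrow> 0 \<le> nrm E (lincomb E k s x)"
    and "\<And>s. s \<in> S k \<Longrightarrow> nrm E (lincomb E k s x) \<le> nrm F (h (lincomb E k s x))"
  shows "snorm \<Phi> E k x \<le> snorm \<Phi> F k (\<lambda>j. h (x j))"
  unfolding snorm_def lin_lincomb[OF assms(1-4), symmetric]
  using assms(5,6) by (intro functional_mono) auto

end

lemma snorm_isometry:
  assumes "kmodule E" "kmodule F" "lin E F h" "\<forall>j\<in>{1..k}. x j \<in> carrier E"
    and "\<And>z. z \<in> carrier E \<Longrightarrow> nrm F (h z) = nrm E z"
  shows "snorm \<Phi> F k (\<lambda>j. h (x j)) = snorm \<Phi> E k x"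
  unfolding snorm_def lin_lincomb[OF assms(1-4), symmetric]
  by (simp add: assms(5) lincomb_closed[OF assms(1,4)])

lemma snorm_cong:
  assumes "kmodule E" "\<forall>j\<in>{1..k}. x j \<in> carrier E" "\<And>j. j \<in> {1..k} \<Longrightarrow> x j = y j"
  shows "snorm \<Phi> E k x = snorm \<Phi> E k y"
  unfolding snorm_def using lincomb_cong[OF assms(1,2) refl assms(3)] by simp

text \<open>The norm of each combination converges by \<open>tendsto_nrm_ultraclass\<close>, since
  evaluation at an index and passage to the class are both linear; continuity of
  \<open>\<Phi> k\<close> carries these limits over.\<close>

lemma (in ultraproduct_of_normed) tendsto_snorm_ultraclass:
  assumes "seq_functional \<Phi> S" and x: "\<forall>j\<in>{1..k}. x j \<in> carrier (linfty_space E)"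
  shows "((\<lambda>i. snorm \<Phi> (E i) k (\<lambda>j. x j i)) \<longlongrightarrow>
    snorm \<Phi> (ultraproduct U E) k (\<lambda>j. ultraclass U E (x j))) U"
proof -
  interpret seq_functional \<Phi> S by fact
  define v where "v i = (\<lambda>s. nrm (E i) (lincomb (E i) k s (\<lambda>j. x j i)))" for i
  define w where "w = (\<lambda>s. nrm (ultraproduct U E) (ultraclass U E (lincomb (linfty_space E) k s x)))"
  have "((\<lambda>i. v i s) \<longlongrightarrow> w s) U" for s
    using tendsto_nrm_ultraclass[OF lincomb_closed[OF linfty_kmodule x]]
    unfolding v_def w_def lin_lincomb[OF linfty_kmodule N.kmodule_axioms lin_component x] .
  \<comment> \<open>Continuity of \<open>\<Phi> k\<close> is stated for filters on coefficient
    functions, so convergence along \<open>U\<close> is moved to the image filter.\<close>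
  then have 1: "((\<lambda>v. v s) \<longlongrightarrow> w s) (filtermap v U)" for s
    unfolding tendsto_def eventually_filtermap by simp
  have "0 \<le> v i s" for i s
    unfolding v_def lin_lincomb[OF linfty_kmodule N.kmodule_axioms lin_component x, symmetric]
    using lincomb_closed[OF linfty_kmodule x] by (intro N.nrm_nonneg linfty_component)
  then have 2: "eventually (\<lambda>v. \<forall>s\<in>S k. 0 \<le> v s) (filtermap v U)"
    by (simp add: eventually_filtermap)
  have "(\<Phi> k \<longlongrightarrow> \<Phi> k w) (filtermap v U)"
    using functional_continuous[OF 1 2] .
  then have "((\<lambda>i. \<Phi> k (v i)) \<longlongrightarrow> \<Phi> k w) U"
    unfolding tendsto_def eventually_filtermap .
  then show ?thesis
    unfolding v_def w_def snorm_def
      lin_lincomb[OF linfty_kmodule ultraproduct_kmodule lin_ultraclass x] .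
qed

section \<open>The p-norm and the Rademacher norm as sequence functionals\<close>

definition unit_coeff :: "nat \<Rightarrow> nat \<Rightarrow> real" where
  "unit_coeff j i = (if i = j then 1 else 0)"

definition lp_functional :: "real \<Rightarrow> nat \<Rightarrow> ((nat \<Rightarrow> real) \<Rightarrow> real) \<Rightarrow> real" where
  "lp_functional p k v = (\<Sum>j=1..k. v (unit_coeff j) powr p) powr (1 / p)"

lemma lp_norm_eq_snorm:
  assumes "kmodule E" "\<forall>j\<in>{1..k}. x j \<in> carrier E"
  shows "lp_norm p E k x = snorm (lp_functional p) E k x"
proof -
  interpret E: kmodule E by fact
  have "lincomb E k (unit_coeff j) x = x j" if "j \<in> {1..k}" for j
    using lincomb_single[OF assms that, of "unit_coeff j"] that assms(2) by (simp add: unit_coeff_def)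
  then show ?thesis by (simp add: lp_norm_def snorm_def lp_functional_def)
qed

lemma seq_functional_lp:
  assumes "0 < p"
  shows "seq_functional (lp_functional p) (\<lambda>k. unit_coeff ` {1..k})"
proof
  fix k and v w :: "(nat \<Rightarrow> real) \<Rightarrow> real"
  show "0 \<le> lp_functional p k v" by (simp add: lp_functional_def)
  assume "\<And>s. s \<in> unit_coeff ` {1..k} \<Longrightarrow> 0 \<le> v s" "\<And>s. s \<in> unit_coeff ` {1..k} \<Longrightarrow> v s \<le> w s"
  then show "lp_functional p k v \<le> lp_functional p k w"
    unfolding lp_functional_def using assms by (intro powr_mono2 sum_mono sum_nonneg) auto
next
  fix k w and F :: "((nat \<Rightarrow> real) \<Rightarrow> real) filter"
  assume lim: "\<And>s. s \<in> unit_coeff ` {1..k} \<Longrightarrow> ((\<lambda>v. v s) \<longlongrightarrow> w s) F"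
    and nonneg: "\<forall>\<^sub>F v in F. \<forall>s\<in>unit_coeff ` {1..k}. 0 \<le> v s"
  \<comment> \<open>The limit of a base may be 0; there \<open>tendsto_powr'\<close> asks for a
    positive exponent and eventually nonnegative bases.\<close>
  have "\<forall>\<^sub>F v in F. 0 \<le> v (unit_coeff j)" if "j \<in> {1..k}" for j
    using nonneg by eventually_elim (use that in auto)
  then have "((\<lambda>v. (\<Sum>j=1..k. v (unit_coeff j) powr p)) \<longlongrightarrow> (\<Sum>j=1..k. w (unit_coeff j) powr p)) F"
    using assms lim by (intro tendsto_sum tendsto_powr' tendsto_const) auto
  then show "(lp_functional p k \<longlongrightarrow> lp_functional p k w) F"
    unfolding lp_functional_def using assms
    by (intro tendsto_powr' tendsto_const) (auto intro!: always_eventually sum_nonneg)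
next
  fix a :: real assume "0 \<le> a"
  then show "lp_functional p 1 (\<lambda>s. \<bar>s 1\<bar> * a) = a"
    using assms by (simp add: lp_functional_def unit_coeff_def powr_powr)
qed auto

text \<open>The value 0 is included because \<open>rademacher j\<close> vanishes at the zeros of its
  sine; extensionality makes the set finite.\<close>

definition sign_patterns :: "nat \<Rightarrow> (nat \<Rightarrow> real) set" where
  "sign_patterns k = (\<Pi>\<^sub>E j\<in>{1..k}. {-1, 0, 1})"

text \<open>The joint law of the first \<open>k\<close> Rademacher functions on the unit
  interval.\<close>

definition sign_weight :: "nat \<Rightarrow> (nat \<Rightarrow> real) \<Rightarrow> real" where
  "sign_weight k s = measure lborel {t \<in> {0..1}. \<forall>j\<in>{1..k}. rademacher j t = s j}"

definition rad_functional :: "nat \<Rightarrow> ((nat \<Rightarrow> real) \<Rightarrow> real) \<Rightarrow> real" where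
  "rad_functional k v = sqrt (\<Sum>s\<in>sign_patterns k. sign_weight k s * (v s)\<^sup>2)"

lemma rademacher_measurable [measurable]: "rademacher j \<in> borel_measurable borel"
  unfolding rademacher_def sgn_if by measurable

text \<open>The sets \<open>A s\<close> with \<open>s\<close> a sign pattern partition the unit
  interval, and the integrand is constant on each of them; thus it is a step function whatever
  \<open>g\<close> is.\<close>

lemma rademacher_integral:
  fixes g :: "(nat \<Rightarrow> real) \<Rightarrow> real"
  shows "set_lebesgue_integral lborel {0..1} (\<lambda>t. g (\<lambda>j\<in>{1..k}. rademacher j t))
    = (\<Sum>s\<in>sign_patterns k. sign_weight k s * g s)"
proof -
  define A where "A s = {t \<in> {0..1}. \<forall>j\<in>{1..k}. rademacher j t = s j}" for s
  have fin: "finite (sign_patterns k)" by (auto simp: sign_patterns_def intro!: finite_PiE)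
  have A_meas: "A s \<in> sets lborel" for s
  proof -
    have "A s = {t \<in> space borel. t \<in> {0..1} \<and> (\<forall>j\<in>{1..k}. rademacher j t = s j)}"
      by (auto simp: A_def)
    also have "\<dots> \<in> sets borel" by measurable
    finally show ?thesis by simp
  qed
  have A_fin: "emeasure lborel (A s) < \<infinity>" for s
  proof -
    have "emeasure lborel (A s) \<le> emeasure lborel {0..1::real}"
      by (intro emeasure_mono) (auto simp: A_def)
    then show ?thesis by (simp add: order.strict_trans1)
  qed
  have "indicator {0..1} t *\<^sub>R g (\<lambda>j\<in>{1..k}. rademacher j t)
      = (\<Sum>s\<in>sign_patterns k. indicator (A s) t *\<^sub>R g s)" for t :: real
  proof (cases "t \<in> {0..1}")
    case True
    let ?r = "\<lambda>j\<in>{1..k}. rademacher j t"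
    have r: "?r \<in> sign_patterns k"
      by (auto simp: sign_patterns_def rademacher_def sgn_if)
    have "t \<in> A s \<longleftrightarrow> s = ?r" if "s \<in> sign_patterns k" for s
      using that True by (auto simp: A_def sign_patterns_def fun_eq_iff PiE_def extensional_def)
    then have "(\<Sum>s\<in>sign_patterns k. indicator (A s) t *\<^sub>R g s)
        = (\<Sum>s\<in>sign_patterns k. if s = ?r then g s else 0)"
      by (intro sum.cong) (auto simp: indicator_def)
    with r fin True show ?thesis by simp
  next
    case False
    then have "t \<notin> A s" for s by (auto simp: A_def)
    with False show ?thesis by simp
  qed
  then have "set_lebesgue_integral lborel {0..1} (\<lambda>t. g (\<lambda>j\<in>{1..k}. rademacher j t))
      = (\<integral>t. (\<Sum>s\<in>sign_patterns k. indicator (A s) t *\<^sub>R g s) \<partial>lborel)"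
    unfolding set_lebesgue_integral_def by simp
  also have "\<dots> = (\<Sum>s\<in>sign_patterns k. \<integral>t. indicator (A s) t *\<^sub>R g s \<partial>lborel)"
    using A_meas A_fin by (intro Bochner_Integration.integral_sum integrable_scaleR_left)
      (auto simp: integrable_indicator_iff)
  also have "\<dots> = (\<Sum>s\<in>sign_patterns k. sign_weight k s * g s)"
    using A_meas A_fin by (simp add: sign_weight_def A_def)
  finally show ?thesis .
qed

lemma rad_norm_eq_snorm:
  assumes "kmodule E" "\<forall>j\<in>{1..k}. x j \<in> carrier E"
  shows "rad_norm E k x = snorm rad_functional E k x"
proof -
  let ?g = "\<lambda>s. (nrm E (lincomb E k s x))\<^sup>2"
  \<comment> \<open>Restricting the signs to \<open>{1..k}\<close> does not change the combination
    and turns them into a member of \<open>sign_patterns k\<close>.\<close>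
  have "(nrm E (\<Oplus>\<^bsub>E\<^esub>j\<in>{1..k}. of_real (rademacher j t) \<odot>\<^bsub>E\<^esub> x j))\<^sup>2
      = ?g (\<lambda>j\<in>{1..k}. rademacher j t)" for t
    using lincomb_cong[OF assms, of "\<lambda>j. rademacher j t" "\<lambda>j\<in>{1..k}. rademacher j t" x]
    by (simp add: lincomb_def)
  then show ?thesis
    using rademacher_integral[of ?g k] by (simp add: rad_norm_def snorm_def rad_functional_def)
qed

text \<open>The sine of \<open>2 * pi * t\<close> vanishes only at integer multiples of 1/2, which
  form a countable and hence null set. This normalises the Rademacher norm of a single
  vector.\<close>

lemma rademacher_square_AE: "AE t in lborel. (rademacher 1 t)\<^sup>2 = 1"
proof -
  have "countable (range (\<lambda>i::int. of_int i / 2 :: real))" by simp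
  then have "AE t in lborel. t \<notin> range (\<lambda>i::int. of_int i / 2 :: real)"
    by (intro AE_not_in countable_imp_null_set_lborel)
  then show ?thesis
  proof eventually_elim
    case (elim t)
    have "sin (2 * pi * t) \<noteq> 0"
    proof
      assume "sin (2 * pi * t) = 0"
      then obtain i :: int where "2 * pi * t = of_int i * pi"
        unfolding sin_zero_iff_int2 by blast
      then have "t = of_int i / 2" by (simp add: field_simps)
      with elim show False by blast
    qed
    then show ?case by (simp add: rademacher_def sgn_if)
  qed
qed

lemma seq_functional_rad: "seq_functional rad_functional sign_patterns"
proof
  fix k and v w :: "(nat \<Rightarrow> real) \<Rightarrow> real"
  show "finite (sign_patterns k)" by (auto simp: sign_patterns_def intro!: finite_PiE)
  show "0 \<le> rad_functional k v"
    by (auto simp: rad_functional_def sign_weight_def intro!: sum_nonneg)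
  assume "\<And>s. s \<in> sign_patterns k \<Longrightarrow> 0 \<le> v s" "\<And>s. s \<in> sign_patterns k \<Longrightarrow> v s \<le> w s"
  then show "rad_functional k v \<le> rad_functional k w"
    unfolding rad_functional_def
    by (intro real_sqrt_le_mono sum_mono mult_left_mono power_mono) (auto simp: sign_weight_def)
next
  fix k w and F :: "((nat \<Rightarrow> real) \<Rightarrow> real) filter"
  assume "\<And>s. s \<in> sign_patterns k \<Longrightarrow> ((\<lambda>v. v s) \<longlongrightarrow> w s) F"
  then show "(rad_functional k \<longlongrightarrow> rad_functional k w) F"
    unfolding rad_functional_def by (intro tendsto_intros) auto
next
  fix a :: real assume a: "0 \<le> a"
  \<comment> \<open>Instead of evaluating the weights, the sum is read back as an integral of a
    function equal to the constant \<open>a\<^sup>2\<close> almost everywhere on an interval of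
    length 1.\<close>
  have "(\<Sum>s\<in>sign_patterns 1. sign_weight 1 s * (\<bar>s 1\<bar> * a)\<^sup>2)
      = set_lebesgue_integral lborel {0..1} (\<lambda>t. (rademacher 1 t)\<^sup>2 * a\<^sup>2)"
    using rademacher_integral[of "\<lambda>s. (\<bar>s 1\<bar> * a)\<^sup>2" 1] by (simp add: power_mult_distrib)
  also have "\<dots> = set_lebesgue_integral lborel {0..1} (\<lambda>t::real. a\<^sup>2)"
    unfolding set_lebesgue_integral_def
    by (intro integral_cong_AE) (use rademacher_square_AE in \<open>auto elim!: AE_mp\<close>)
  also have "\<dots> = a\<^sup>2"
    by (simp add: set_lebesgue_integral_def)
  finally show "rad_functional 1 (\<lambda>s. \<bar>s 1\<bar> * a) = a"
    using a by (simp add: rad_functional_def)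
qed

subsection \<open>Finite-dimensional subspaces and quotients\<close>

definition fspan :: "('k::real_or_complex, 'a) nspace \<Rightarrow> 'a set \<Rightarrow> 'a set" where
  "fspan E B = {finsum E (\<lambda>b. c b \<odot>\<^bsub>E\<^esub> b) B | c. True}"

lemma fspanI: "finsum E (\<lambda>b. c b \<odot>\<^bsub>E\<^esub> b) B \<in> fspan E B"
  by (auto simp: fspan_def)

lemma finite_dimensional_iff:
  "finite_dimensional E \<longleftrightarrow> (\<exists>B. finite B \<and> B \<subseteq> carrier E \<and> carrier E = fspan E B)"
  by (simp add: finite_dimensional_def fspan_def)

context kmodule
begin

lemma submodule_finsum:
  assumes "submodule N ring_of_type_algebra E" "finite A" "f \<in> A \<rightarrow> N"
  shows "finsum E f A \<in> N"
  using assms(2,3)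
proof (induction A)
  case empty
  then show ?case
    using submoduleE(2,4)[OF assms(1)] submoduleE(1)[OF assms(1)] smult_0
    by (metis M.finsum_empty UNIV_I ex_in_conv ring_of_type_algebra_simps(1) subsetD)
next
  case (insert a A)
  then have "f \<in> A \<rightarrow> carrier E" "f a \<in> carrier E" using submoduleE(1)[OF assms(1)] by auto
  with insert show ?case using submoduleE(5)[OF assms(1)] by (simp add: M.finsum_insert)
qed

lemma fspan_submodule:
  assumes "finite B" "B \<subseteq> carrier E"
  shows "submodule (fspan E B) ring_of_type_algebra E"
proof (rule submoduleI)
  have closed: "(\<lambda>b. c b \<odot> b) \<in> B \<rightarrow> carrier E" for c using assms(2) by auto
  show sub: "fspan E B \<subseteq> carrier E" using closed by (auto simp: fspan_def)
  show "\<zero> \<in> fspan E B"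
  proof -
    have "finsum E (\<lambda>b. 0 \<odot> b) B = finsum E (\<lambda>b. \<zero>) B"
      using assms(2) by (intro M.finsum_cong') auto
    also have "\<dots> = \<zero>" by (rule M.finsum_zero)
    finally show ?thesis using fspanI[of E "\<lambda>_. 0" B] by simp
  qed
  show "x \<oplus> y \<in> fspan E B" if xy: "x \<in> fspan E B" "y \<in> fspan E B" for x y
  proof -
    obtain c d where "x = finsum E (\<lambda>b. c b \<odot> b) B" "y = finsum E (\<lambda>b. d b \<odot> b) B"
      using xy unfolding fspan_def by blast
    then have "x \<oplus> y = finsum E (\<lambda>b. c b \<odot> b \<oplus> d b \<odot> b) B"
      using closed by (simp add: M.finsum_addf)
    also have "\<dots> = finsum E (\<lambda>b. (c b + d b) \<odot> b) B"
      using assms(2) by (intro M.finsum_cong') (auto simp: smult_add_left)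
    finally show ?thesis by (simp only: fspanI)
  qed
  show smult: "a \<odot> x \<in> fspan E B" if x: "x \<in> fspan E B" for a x
  proof -
    obtain c where "x = finsum E (\<lambda>b. c b \<odot> b) B" using x unfolding fspan_def by blast
    then have "a \<odot> x = finsum E (\<lambda>b. a \<odot> (c b \<odot> b)) B"
      using finsum_smult_ldistr[OF assms(1) _ closed] by simp
    also have "\<dots> = finsum E (\<lambda>b. (a * c b) \<odot> b) B"
      using assms(2) by (intro M.finsum_cong') (auto simp: smult_mult)
    finally show ?thesis by (simp only: fspanI)
  qed
  show "\<ominus> x \<in> fspan E B" if "x \<in> fspan E B" for x
    using smult[OF that, of "- 1"] smult_minus_1[of x] that sub by auto
qed

lemma subset_fspan:
  assumes "finite B" "B \<subseteq> carrier E"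
  shows "B \<subseteq> fspan E B"
proof
  fix x assume x: "x \<in> B"
  have "finsum E (\<lambda>b. (if x = b then 1 else 0) \<odot> b) B = finsum E (\<lambda>b. if x = b then b else \<zero>) B"
    using assms(2) by (intro M.finsum_cong') auto
  also have "\<dots> = x" using M.finsum_singleton[OF x assms(1), of "\<lambda>b. b"] assms(2) by auto
  finally show "x \<in> fspan E B" using fspanI[of E "\<lambda>b. if x = b then 1 else 0" B] by simp
qed

lemma fspan_least:
  assumes "submodule N ring_of_type_algebra E" "finite B" "B \<subseteq> N"
  shows "fspan E B \<subseteq> N"
  using submoduleE(4)[OF assms(1)] assms(3)
  by (auto simp: fspan_def intro!: submodule_finsum[OF assms(1,2)])

end

lemma subspace_of_simps [simp]:
  "carrier (subspace_of E D) = D"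
  "x \<oplus>\<^bsub>subspace_of E D\<^esub> y = x \<oplus>\<^bsub>E\<^esub> y"
  "\<zero>\<^bsub>subspace_of E D\<^esub> = \<zero>\<^bsub>E\<^esub>"
  "c \<odot>\<^bsub>subspace_of E D\<^esub> x = c \<odot>\<^bsub>E\<^esub> x"
  "nrm (subspace_of E D) = nrm E"
  by (simp_all add: subspace_of_def)

lemma subspace_kmodule:
  assumes "kmodule E" "submodule D (ring_of_type_algebra :: 'k ring) (E :: ('k::real_or_complex, 'a) nspace)"
  shows "kmodule (subspace_of E D)"
  using submodule.submodule_is_module[OF assms(2)] assms(1) by (simp add: kmodule_def subspace_of_def)

lemma lin_subspace:
  assumes "kmodule E" "submodule D (ring_of_type_algebra :: 'k ring) (E :: ('k::real_or_complex, 'a) nspace)"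
  shows "lin (subspace_of E D) E (\<lambda>x. x)"
proof -
  interpret kmodule E by fact
  show ?thesis using submoduleE(1)[OF assms(2)] by (intro linI) auto
qed

lemma FIN_superset:
  assumes "kmodule E" "finite B" "B \<subseteq> carrier E"
  obtains D where "D \<in> FIN E" "B \<subseteq> D"
proof
  interpret kmodule E by fact
  note sub = fspan_submodule[OF assms(2,3)]
  let ?D = "subspace_of E (fspan E B)"
  show B: "B \<subseteq> fspan E B" by (rule subset_fspan[OF assms(2,3)])
  \<comment> \<open>\<open>finsum\<close> depends on the carrier, so sums formed in the subspace and
    in \<open>E\<close> are compared through the linear inclusion.\<close>
  have "finsum ?D (\<lambda>b. c b \<odot>\<^bsub>?D\<^esub> b) B = finsum E (\<lambda>b. c b \<odot>\<^bsub>E\<^esub> b) B" for c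
    using lin_finsum[OF subspace_kmodule[OF assms(1) sub] assms(1) lin_subspace[OF assms(1) sub] assms(2),
        of "\<lambda>b. c b \<odot>\<^bsub>E\<^esub> b"] B submoduleE(4)[OF sub] by (auto simp: Pi_iff)
  then have "fspan ?D B = fspan E B" by (simp add: fspan_def)
  then have "finite_dimensional ?D"
    unfolding finite_dimensional_iff using assms(2) B by (intro exI[of _ B]) simp
  then show "fspan E B \<in> FIN E" using sub by (simp add: FIN_def)
qed

context quotient_of_module
begin

lemma quotient_finite_dimensional:
  assumes "finite B" "B \<subseteq> carrier F" "\<And>x. x \<in> carrier F \<Longrightarrow> \<exists>y\<in>fspan F B. x \<ominus>\<^bsub>F\<^esub> y \<in> L"
  shows "finite_dimensional (quotient_space F L)"
proof -
  let ?Q = "quotient_map F L"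
  interpret Q: kmodule "quotient_space F L" by (rule quotient_kmodule)
  have B: "finite (?Q ` B)" "?Q ` B \<subseteq> carrier (quotient_space F L)"
    using assms(1,2) by (auto simp: carrier_quotient)
  note sub = Q.fspan_submodule[OF B]
  have "?Q x \<in> fspan (quotient_space F L) (?Q ` B)" if x: "x \<in> carrier F" for x
  proof -
    obtain y where y: "y \<in> fspan F B" "x \<ominus>\<^bsub>F\<^esub> y \<in> L" using assms(3)[OF x] by blast
    then obtain c where c: "y = finsum F (\<lambda>b. c b \<odot>\<^bsub>F\<^esub> b) B" unfolding fspan_def by blast
    have "y \<in> carrier F" using y(1) F.submoduleE(1)[OF F.fspan_submodule[OF assms(1,2)]] by auto
    then have "?Q x = ?Q y" using quotient_map_eq_iff x y(2) by simp
    also have "\<dots> = finsum (quotient_space F L) (\<lambda>b. ?Q (c b \<odot>\<^bsub>F\<^esub> b)) B"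
      unfolding c by (rule lin_finsum[OF F.kmodule_axioms quotient_kmodule lin_quotient_map assms(1)])
        (use assms(2) in auto)
    \<comment> \<open>The quotient map may identify elements of \<open>B\<close>, so the sum over
      \<open>B\<close> is not reindexed over the image; each term lies in the span, which is closed
      under finite sums.\<close>
    also have "\<dots> \<in> fspan (quotient_space F L) (?Q ` B)"
    proof (rule Q.submodule_finsum[OF sub assms(1)], rule Pi_I)
      fix b assume b: "b \<in> B"
      then have "?Q b \<in> fspan (quotient_space F L) (?Q ` B)" using Q.subset_fspan[OF B] by auto
      then have "c b \<odot>\<^bsub>quotient_space F L\<^esub> ?Q b \<in> fspan (quotient_space F L) (?Q ` B)"
        using Q.submoduleE(4)[OF sub] by simp
      then show "?Q (c b \<odot>\<^bsub>F\<^esub> b) \<in> fspan (quotient_space F L) (?Q ` B)"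
        using b assms(2) by (subst (asm) smult_quotient) auto
    qed
    finally show ?thesis .
  qed
  then have "carrier (quotient_space F L) = fspan (quotient_space F L) (?Q ` B)"
    using Q.submoduleE(1)[OF sub] by (auto simp: carrier_quotient)
  then show ?thesis unfolding finite_dimensional_iff using B by blast
qed

text \<open>These are the two hypotheses that \<open>snorm_lin_le\<close> puts on a linear
  map.\<close>

lemma nrm_quotient_map:
  assumes "normed_module F" "z \<in> carrier F"
  shows "0 \<le> nrm (quotient_space F L) (quotient_map F L z)"
    and "nrm (quotient_space F L) (quotient_map F L z) \<le> nrm F z"
proof -
  interpret F: normed_module F by fact
  have z: "z \<in> quotient_map F L z" using mem_quotient_map[OF assms(2)] L_zero assms(2) by simp
  have nonneg: "0 \<le> nrm F x" if "x \<in> quotient_map F L z" for x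
    using that mem_quotient_map[OF assms(2)] by simp
  show "0 \<le> nrm (quotient_space F L) (quotient_map F L z)"
    unfolding quotient_space_def using z nonneg by (auto intro!: cINF_greatest)
  show "nrm (quotient_space F L) (quotient_map F L z) \<le> nrm F z"
    unfolding quotient_space_def using z nonneg
    by (auto intro!: cINF_lower bdd_belowI2[of _ 0])
qed

end

section \<open>Common kernels of finitely many functionals\<close>

context normed_module
begin

text \<open>Functionals of norm at most 1. Unlike for members of \<open>dual_space\<close>, the
  values off the carrier are left free.\<close>

definition functional :: "('a \<Rightarrow> 'k) \<Rightarrow> bool" where
  "functional \<phi> \<longleftrightarrow> (\<forall>x\<in>carrier E. \<forall>y\<in>carrier E. \<phi> (x \<oplus> y) = \<phi> x + \<phi> y) \<and>
     (\<forall>c. \<forall>x\<in>carrier E. \<phi> (c \<odot> x) = c * \<phi> x) \<and> (\<forall>x\<in>carrier E. norm (\<phi> x) \<le> nrm E x)"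

definition annihilated :: "('a \<Rightarrow> 'k) set \<Rightarrow> 'a set" where
  "annihilated \<Phi> = {x \<in> carrier E. \<forall>\<phi>\<in>\<Phi>. \<phi> x = 0}"

lemma functionalD:
  assumes "functional \<phi>" "x \<in> carrier E"
  shows "y \<in> carrier E \<Longrightarrow> \<phi> (x \<oplus> y) = \<phi> x + \<phi> y" "\<phi> (c \<odot> x) = c * \<phi> x" "norm (\<phi> x) \<le> nrm E x"
    "y \<in> carrier E \<Longrightarrow> \<phi> (x \<ominus> y) = \<phi> x - \<phi> y"
  using assms by (auto simp: functional_def minus_eq_smult)

lemma annihilated_submodule:
  assumes "\<And>\<phi>. \<phi> \<in> \<Phi> \<Longrightarrow> functional \<phi>"
  shows "submodule (annihilated \<Phi>) ring_of_type_algebra E"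
proof (rule submoduleI)
  have zero: "\<phi> \<zero> = 0" if "functional \<phi>" for \<phi>
    using functionalD(2)[OF that, of \<zero> 0] by simp
  show "\<zero> \<in> annihilated \<Phi>" using assms zero by (auto simp: annihilated_def)
  show "x \<oplus> y \<in> annihilated \<Phi>" if "x \<in> annihilated \<Phi>" "y \<in> annihilated \<Phi>" for x y
    using that assms functionalD(1) by (fastforce simp: annihilated_def)
  show smult: "c \<odot> x \<in> annihilated \<Phi>" if "x \<in> annihilated \<Phi>" for c x
    using that assms functionalD(2) by (fastforce simp: annihilated_def)
  show "\<ominus> x \<in> annihilated \<Phi>" if "x \<in> annihilated \<Phi>" for x
    using smult[OF that, of "- 1"] smult_minus_1[of x] that by (simp add: annihilated_def)
qed (auto simp: annihilated_def)

lemma closedin_annihilated: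
  assumes "finite \<Phi>" "\<And>\<phi>. \<phi> \<in> \<Phi> \<Longrightarrow> functional \<phi>"
  shows "closedin (ntopology E) (annihilated \<Phi>)"
  using assms
proof (induction \<Phi>)
  case empty
  have "annihilated {} = topspace (ntopology E)" by (simp add: annihilated_def)
  then show ?case by (simp only: closedin_topspace)
next
  case (insert \<phi> \<Phi>)
  have "continuous_map (ntopology E) euclidean \<phi>"
    using insert.prems functionalD(1,3)[of \<phi>] by (intro continuous_functionalI[of \<phi> 1]) auto
  then have "closedin (ntopology E) {x \<in> topspace (ntopology E). \<phi> x \<in> {0}}"
    by (rule closedin_continuous_map_preimage) simp
  moreover have "annihilated (insert \<phi> \<Phi>) = annihilated \<Phi> \<inter> {x \<in> topspace (ntopology E). \<phi> x \<in> {0}}"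
    by (auto simp: annihilated_def)
  ultimately show ?case using insert by auto
qed

text \<open>Induction over the functionals. A new \<open>\<phi>\<close> either vanishes on the
  common kernel of the earlier ones, and \<open>B\<close> is kept, or that kernel contains some
  \<open>u\<close> with \<open>\<phi> u = 1\<close>. Then \<open>u\<close> joins \<open>B\<close>:
  subtracting the multiple \<open>\<phi> (x \<ominus> y)\<close> of \<open>u\<close> from the
  remainder \<open>x \<ominus> y\<close> makes \<open>\<phi>\<close> vanish and leaves the earlier
  functionals at 0.\<close>

lemma annihilated_finite_codim:
  assumes "finite \<Phi>" "\<And>\<phi>. \<phi> \<in> \<Phi> \<Longrightarrow> functional \<phi>"
  shows "\<exists>B. finite B \<and> B \<subseteq> carrier E \<and> (\<forall>x\<in>carrier E. \<exists>y\<in>fspan E B. x \<ominus> y \<in> annihilated \<Phi>)"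
  using assms
proof (induction \<Phi>)
  case empty
  have "\<zero> \<in> fspan E {}" by (auto simp: fspan_def)
  moreover have "x \<ominus> \<zero> \<in> annihilated {}" if "x \<in> carrier E" for x
    using that by (simp add: annihilated_def)
  ultimately show ?case by (intro exI[of _ "{}"]) blast
next
  case (insert \<phi> \<Phi>)
  then obtain B where B: "finite B" "B \<subseteq> carrier E"
      "\<And>x. x \<in> carrier E \<Longrightarrow> \<exists>y\<in>fspan E B. x \<ominus> y \<in> annihilated \<Phi>"
    by auto
  have phi: "functional \<phi>" and sub: "submodule (annihilated \<Phi>) ring_of_type_algebra E"
    using insert.prems by (auto intro: annihilated_submodule)
  have ann: "x \<in> annihilated (insert \<phi> \<Phi>) \<longleftrightarrow> x \<in> annihilated \<Phi> \<and> \<phi> x = 0" for x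
    by (auto simp: annihilated_def)
  show ?case
  proof (cases "\<forall>x\<in>annihilated \<Phi>. \<phi> x = 0")
    case True
    have "\<exists>y\<in>fspan E B. x \<ominus> y \<in> annihilated (insert \<phi> \<Phi>)" if "x \<in> carrier E" for x
      using B(3)[OF that] True unfolding ann by blast
    then show ?thesis using B(1,2) by blast
  next
    case False
    then obtain u0 where u0: "u0 \<in> annihilated \<Phi>" "\<phi> u0 \<noteq> 0" by blast
    define u where "u = (1 / \<phi> u0) \<odot> u0"
    have u0_carrier: "u0 \<in> carrier E" using u0 by (simp add: annihilated_def)
    have u: "u \<in> annihilated \<Phi>" "\<phi> u = 1" "u \<in> carrier E"
      using u0 u0_carrier functionalD(2)[OF phi u0_carrier] submoduleE(4)[OF sub, of _ u0]
      by (auto simp: u_def)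
    have B': "finite (insert u B)" "insert u B \<subseteq> carrier E" using B u by auto
    note span = fspan_submodule[OF B'] subset_fspan[OF B']
    have "\<exists>y\<in>fspan E (insert u B). x \<ominus> y \<in> annihilated (insert \<phi> \<Phi>)" if x: "x \<in> carrier E" for x
    proof -
      obtain y where y: "y \<in> fspan E B" "x \<ominus> y \<in> annihilated \<Phi>" using B(3)[OF x] by blast
      define a where "a = \<phi> (x \<ominus> y)"
      have "fspan E B \<subseteq> fspan E (insert u B)"
        using span B by (intro fspan_least) auto
      with y have y': "y \<in> fspan E (insert u B)" "y \<in> carrier E"
        using submoduleE(1)[OF span(1)] by auto
      have "a \<odot> u \<in> fspan E (insert u B)" using span submoduleE(4)[OF span(1), of a u] by auto
      with y' have mem: "y \<oplus> a \<odot> u \<in> fspan E (insert u B)" using submoduleE(5)[OF span(1)] by blast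
      have eq: "x \<ominus> (y \<oplus> a \<odot> u) = (x \<ominus> y) \<oplus> (- a) \<odot> u"
        using x y' u by (simp add: minus_eq_smult smult_add_right M.a_assoc flip: smult_mult)
      have "(- a) \<odot> u \<in> annihilated \<Phi>" using submoduleE(4)[OF sub, of "- a" u] u by simp
      then have "x \<ominus> (y \<oplus> a \<odot> u) \<in> annihilated \<Phi>"
        unfolding eq using y(2) submoduleE(5)[OF sub] by blast
      moreover have "\<phi> (x \<ominus> (y \<oplus> a \<odot> u)) = 0"
        unfolding eq using x y' u functionalD(1)[OF phi, of "x \<ominus> y" "(- a) \<odot> u"]
          functionalD(2)[OF phi u(3), of "- a"] by (simp add: a_def)
      ultimately show ?thesis using mem unfolding ann by blast
    qed
    then show ?thesis by (intro exI[of _ "insert u B"] conjI B' ballI)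
  qed
qed

lemma annihilated_COFIN:
  assumes "finite \<Phi>" "\<And>\<phi>. \<phi> \<in> \<Phi> \<Longrightarrow> functional \<phi>"
  shows "annihilated \<Phi> \<in> COFIN E"
proof -
  note sub = annihilated_submodule[OF assms(2)]
  interpret quotient_of_module E "annihilated \<Phi>"
    by (intro quotient_of_module.intro quotient_of_module_axioms.intro kmodule_axioms sub)
  obtain B where "finite B" "B \<subseteq> carrier E" "\<forall>x\<in>carrier E. \<exists>y\<in>fspan E B. x \<ominus> y \<in> annihilated \<Phi>"
    using annihilated_finite_codim[OF assms] by blast
  then have "finite_dimensional (quotient_space E (annihilated \<Phi>))"
    by (intro quotient_finite_dimensional) auto
  then show ?thesis using sub closedin_annihilated[OF assms] by (simp add: COFIN_def)
qed

text \<open>A functional norming \<open>z\<close> is constant on the coset \<open>z + L\<close>,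
  because \<open>L\<close> lies in its kernel; having norm at most 1, it bounds the norm of every
  element of the coset below by \<open>nrm E z\<close>. The common kernel serves all
  \<open>z\<close> in \<open>Z\<close> at once.\<close>

lemma norming_COFIN:
  assumes "finite Z" "Z \<subseteq> carrier E"
  obtains L where "L \<in> COFIN E" "\<And>z. z \<in> Z \<Longrightarrow> nrm E z \<le> nrm (quotient_space E L) (quotient_map E L z)"
proof -
  have "\<exists>\<phi>. functional \<phi> \<and> norm (\<phi> z) = nrm E z" if "z \<in> Z" for z
  proof -
    have "z \<in> carrier E" using that assms(2) by auto
    then show ?thesis unfolding functional_def by (rule norming_functional) blast
  qed
  then obtain f where f: "\<And>z. z \<in> Z \<Longrightarrow> functional (f z)" "\<And>z. z \<in> Z \<Longrightarrow> norm (f z z) = nrm E z"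
    by metis
  define L where "L = annihilated (f ` Z)"
  have "submodule L ring_of_type_algebra E"
    unfolding L_def using f(1) by (intro annihilated_submodule) auto
  then interpret quotient_of_module E L
    by (intro quotient_of_module.intro quotient_of_module_axioms.intro kmodule_axioms)
  have "nrm E z \<le> nrm (quotient_space E L) (quotient_map E L z)" if z: "z \<in> Z" for z
  proof -
    have zc: "z \<in> carrier E" using z assms(2) by auto
    have "nrm E z \<le> nrm E x" if "x \<in> quotient_map E L z" for x
    proof -
      have x: "x \<in> carrier E" "x \<ominus> z \<in> L" using that mem_quotient_map[OF zc] by auto
      then have "f z (x \<ominus> z) = 0" using z unfolding L_def annihilated_def by blast
      then have "f z x = f z z" unfolding functionalD(4)[OF f(1)[OF z] x(1) zc] by simp
      then show ?thesis using f(2)[OF z] functionalD(3)[OF f(1)[OF z] x(1)] by simp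
    qed
    moreover have "z \<in> quotient_map E L z" using mem_quotient_map[OF zc] L_zero zc by simp
    ultimately show ?thesis unfolding quotient_space_def by (auto intro!: cINF_greatest)
  qed
  moreover have "L \<in> COFIN E"
    unfolding L_def using f(1) assms(1) by (intro annihilated_COFIN) auto
  ultimately show ?thesis using that by blast
qed

end

subsection \<open>Bounded multilinear operators\<close>

text \<open>The algebraic half of \<open>multilinear_ops\<close>, kept apart because for the
  ultraproduct operator continuity is deduced later from a bound.\<close>

definition multilin :: "nat \<Rightarrow> (nat \<Rightarrow> ('k::real_or_complex, 'a) nspace) \<Rightarrow> ('k, 'b) nspace \<Rightarrow> ((nat \<Rightarrow> 'a) \<Rightarrow> 'b) \<Rightarrow> bool" where
  "multilin n E F T \<longleftrightarrow>
     T \<in> (\<Pi>\<^sub>E m\<in>{1..n}. carrier (E m)) \<rightarrow> carrier F \<and>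
     (\<forall>x\<in>(\<Pi>\<^sub>E m\<in>{1..n}. carrier (E m)). \<forall>m\<in>{1..n}.
        (\<forall>u\<in>carrier (E m). \<forall>v\<in>carrier (E m).
           T (x(m := u \<oplus>\<^bsub>E m\<^esub> v)) = T (x(m := u)) \<oplus>\<^bsub>F\<^esub> T (x(m := v))) \<and>
        (\<forall>c. \<forall>u\<in>carrier (E m). T (x(m := c \<odot>\<^bsub>E m\<^esub> u)) = c \<odot>\<^bsub>F\<^esub> T (x(m := u))))"

lemma multilinear_ops_iff:
  "T \<in> multilinear_ops n E F \<longleftrightarrow> multilin n E F T \<and>
     continuous_map (product_topology (\<lambda>m. ntopology (E m)) {1..n}) (ntopology F) T"
  by (auto simp: multilinear_ops_def multilin_def)

lemma multilinD:
  assumes "multilin n E F T" "x \<in> (\<Pi>\<^sub>E m\<in>{1..n}. carrier (E m))"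
  shows "T x \<in> carrier F"
    and "m \<in> {1..n} \<Longrightarrow> u \<in> carrier (E m) \<Longrightarrow> v \<in> carrier (E m) \<Longrightarrow>
      T (x(m := u \<oplus>\<^bsub>E m\<^esub> v)) = T (x(m := u)) \<oplus>\<^bsub>F\<^esub> T (x(m := v))"
    and "m \<in> {1..n} \<Longrightarrow> u \<in> carrier (E m) \<Longrightarrow> T (x(m := c \<odot>\<^bsub>E m\<^esub> u)) = c \<odot>\<^bsub>F\<^esub> T (x(m := u))"
  using assms unfolding multilin_def by blast+

definition op_bound :: "nat \<Rightarrow> (nat \<Rightarrow> ('k::real_or_complex, 'a) nspace) \<Rightarrow> ('k, 'b) nspace \<Rightarrow> ((nat \<Rightarrow> 'a) \<Rightarrow> 'b) \<Rightarrow> real \<Rightarrow> bool" where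
  "op_bound n E F T C \<longleftrightarrow>
     (\<forall>x\<in>(\<Pi>\<^sub>E m\<in>{1..n}. carrier (E m)). nrm F (T x) \<le> C * (\<Prod>m=1..n. nrm (E m) (x m)))"

text \<open>Passing from \<open>x\<close> to \<open>y\<close> one coordinate at a time.\<close>

lemma multilin_lipschitz:
  assumes E: "\<And>m. m \<in> {1..n} \<Longrightarrow> normed_module (E m)" and F: "normed_module F"
    and T: "multilin n E F T" and C: "op_bound n E F T C" "0 \<le> C"
    and x: "x \<in> (\<Pi>\<^sub>E m\<in>{1..n}. carrier (E m))" and y: "y \<in> (\<Pi>\<^sub>E m\<in>{1..n}. carrier (E m))"
    and K: "\<And>m. m \<in> {1..n} \<Longrightarrow> nrm (E m) (x m) \<le> K" "\<And>m. m \<in> {1..n} \<Longrightarrow> nrm (E m) (y m) \<le> K"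
    and d: "\<And>m. m \<in> {1..n} \<Longrightarrow> nrm (E m) (y m \<ominus>\<^bsub>E m\<^esub> x m) \<le> d"
  shows "nrm F (T y \<ominus>\<^bsub>F\<^esub> T x) \<le> real n * (C * (d * K ^ (n - 1)))"
proof -
  interpret F: normed_module F by (rule F)
  define w where "w i = (\<lambda>m\<in>{1..n}. if m \<le> i then y m else x m)" for i
  have w: "w i \<in> (\<Pi>\<^sub>E m\<in>{1..n}. carrier (E m))" for i
    using x y by (auto simp: w_def PiE_iff)
  have "i \<le> n \<Longrightarrow> nrm F (T (w i) \<ominus>\<^bsub>F\<^esub> T x) \<le> real i * (C * (d * K ^ (n - 1)))" for i
  proof (induction i)
    case 0
    have "w 0 = x" using x by (auto simp: w_def fun_eq_iff PiE_def extensional_def)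
    then show ?case using multilinD(1)[OF T x] by simp
  next
    case (Suc i)
    define m where "m = Suc i"
    have m: "m \<in> {1..n}" using Suc.prems by (simp add: m_def)
    interpret Em: normed_module "E m" using E m by blast
    have xm: "x m \<in> carrier (E m)" and ym: "y m \<in> carrier (E m)" using x y m by auto
    \<comment> \<open>Consecutive hybrids differ in slot \<open>m\<close> only. Writing
      \<open>y m\<close> as \<open>(y m \<ominus> x m) \<oplus> x m\<close> and using additivity
      there splits off \<open>T z\<close>; in the bound of \<open>T z\<close>, slot \<open>m\<close>
      contributes at most \<open>d\<close> and each other slot at most \<open>K\<close>.\<close>
    define z where "z = (w i)(m := y m \<ominus>\<^bsub>E m\<^esub> x m)"
    have z: "z \<in> (\<Pi>\<^sub>E m\<in>{1..n}. carrier (E m))"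
      using w[of i] m xm ym unfolding z_def by (auto simp: PiE_iff extensional_def)
    have w1: "w (Suc i) = (w i)(m := (y m \<ominus>\<^bsub>E m\<^esub> x m) \<oplus>\<^bsub>E m\<^esub> x m)"
      unfolding Em.minus_add_cancel[OF ym xm] using m by (auto simp: w_def m_def fun_eq_iff)
    have w0: "(w i)(m := x m) = w i" using m by (auto simp: w_def m_def fun_eq_iff)
    have step: "T (w (Suc i)) = T z \<oplus>\<^bsub>F\<^esub> T (w i)"
      unfolding w1 using multilinD(2)[OF T w[of i] m, of "y m \<ominus>\<^bsub>E m\<^esub> x m" "x m"] xm ym
      by (simp add: z_def w0)
    have Tz: "T z \<in> carrier F" and Tw: "T (w i) \<in> carrier F" and Tx: "T x \<in> carrier F"
      using multilinD(1)[OF T] z w x by auto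
    have "nrm F (T (w (Suc i)) \<ominus>\<^bsub>F\<^esub> T x) = nrm F (T z \<oplus>\<^bsub>F\<^esub> (T (w i) \<ominus>\<^bsub>F\<^esub> T x))"
      unfolding step using Tz Tw Tx by (simp add: F.minus_eq_smult F.M.a_assoc)
    also have "\<dots> \<le> nrm F (T z) + nrm F (T (w i) \<ominus>\<^bsub>F\<^esub> T x)"
      using Tz Tw Tx by (intro F.nrm_triangle) auto
    also have "nrm F (T z) \<le> C * (d * K ^ (n - 1))"
    proof -
      have "(\<Prod>j=1..n. nrm (E j) (z j)) = nrm (E m) (z m) * (\<Prod>j\<in>{1..n} - {m}. nrm (E j) (z j))"
        using m by (intro prod.remove) auto
      also have "\<dots> \<le> d * (\<Prod>j\<in>{1..n} - {m}. K)"
      proof (intro mult_mono prod_mono conjI)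
        show "nrm (E m) (z m) \<le> d" using d[OF m] by (simp add: z_def)
        show "0 \<le> d" by (rule order_trans[OF Em.nrm_nonneg[OF Em.minus_closed'[OF ym xm]] d[OF m]])
        show nonneg: "0 \<le> nrm (E j) (z j)" if "j \<in> {1..n} - {m}" for j
          using normed_module.nrm_nonneg[OF E[of j], of "z j"] z that by (auto simp: PiE_iff)
        show "nrm (E j) (z j) \<le> K" if "j \<in> {1..n} - {m}" for j
          using that K by (auto simp: z_def w_def)
        show "0 \<le> (\<Prod>j\<in>{1..n} - {m}. nrm (E j) (z j))" using nonneg by (intro prod_nonneg) auto
      qed
      also have "(\<Prod>j\<in>{1..n} - {m}. K) = K ^ (n - 1)" using m by simp
      finally have "(\<Prod>j=1..n. nrm (E j) (z j)) \<le> d * K ^ (n - 1)" .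
      then have "C * (\<Prod>j=1..n. nrm (E j) (z j)) \<le> C * (d * K ^ (n - 1))"
        using C(2) by (rule mult_left_mono)
      then show ?thesis using C(1) z unfolding op_bound_def by (meson order_trans)
    qed
    also have "nrm F (T (w i) \<ominus>\<^bsub>F\<^esub> T x) \<le> real i * (C * (d * K ^ (n - 1)))"
      using Suc by simp
    finally show ?case by (simp add: algebra_simps)
  qed
  moreover have "w n = y" using y by (auto simp: w_def fun_eq_iff PiE_def extensional_def)
  ultimately show ?thesis by force
qed

text \<open>The Lipschitz estimate is only valid under a common norm bound \<open>K\<close>, so it
  is used on a product of balls around \<open>x\<close> of radius at most 1.\<close>

lemma bounded_multilin_continuous:
  assumes E: "\<And>m. m \<in> {1..n} \<Longrightarrow> normed_module (E m)" and F: "normed_module F"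
    and T: "multilin n E F T" and C: "op_bound n E F T C" "0 \<le> C"
  shows "T \<in> multilinear_ops n E F"
  unfolding multilinear_ops_iff
proof
  show "multilin n E F T" by fact
  interpret F: normed_module F by (rule F)
  let ?X = "product_topology (\<lambda>m. ntopology (E m)) {1..n}"
  let ?P = "\<Pi>\<^sub>E m\<in>{1..n}. carrier (E m)"
  have top: "topspace ?X = ?P"
    unfolding topspace_product_topology using E by (intro PiE_cong) (auto simp: normed_module.topspace_ntopology)
  show "continuous_map ?X (ntopology F) T"
    unfolding continuous_map_def top F.topspace_ntopology
  proof (intro conjI allI impI)
    show "T \<in> ?P \<rightarrow> carrier F" using multilinD(1)[OF T] by auto
    fix V assume V: "openin (ntopology F) V"
    show "openin ?X {x \<in> ?P. T x \<in> V}"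
    proof (subst openin_subopen, intro ballI)
      fix x assume "x \<in> {x \<in> ?P. T x \<in> V}"
      then have x: "x \<in> ?P" and TxV: "T x \<in> V" by auto
      obtain r where r: "r > 0" "\<forall>y\<in>carrier F. nrm F (y \<ominus>\<^bsub>F\<^esub> T x) < r \<longrightarrow> y \<in> V"
        using V TxV unfolding F.openin_ntopology by blast
      have xc: "x m \<in> carrier (E m)" if "m \<in> {1..n}" for m using x that by auto
      have nn: "0 \<le> nrm (E m) (x m)" if "m \<in> {1..n}" for m
        using normed_module.nrm_nonneg[OF E[OF that] xc[OF that]] .
      \<comment> \<open>The summand 1 leaves room for points at distance at most 1 from
        \<open>x\<close> in each slot.\<close>
      define K where "K = (\<Sum>m=1..n. nrm (E m) (x m)) + 1"
      have xK: "nrm (E m) (x m) \<le> K - 1" if "m \<in> {1..n}" for m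
        unfolding K_def using member_le_sum[of m "{1..n}" "\<lambda>m. nrm (E m) (x m)"] that nn by auto
      have K1: "1 \<le> K" unfolding K_def using sum_nonneg[of "{1..n}" "\<lambda>m. nrm (E m) (x m)"] nn by auto
      define A where "A = real n * (C * K ^ (n - 1))"
      have A: "0 \<le> A" unfolding A_def using C(2) K1 by simp
      \<comment> \<open>The bound 1 keeps the ball within norm \<open>K\<close>; the other bound
        yields \<open>A * e < r\<close>, where \<open>A + 1\<close> avoids division by zero.\<close>
      define e where "e = min 1 (r / (A + 1))"
      have e: "0 < e" "e \<le> 1" using r(1) A by (auto simp: e_def)
      have Ae: "A * e < r"
      proof -
        have "A * e \<le> A * (r / (A + 1))" using A by (intro mult_left_mono) (auto simp: e_def)
        also have "\<dots> < r" using A r(1) by (simp add: divide_less_eq algebra_simps)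
        finally show ?thesis .
      qed
      define B where "B m = {y \<in> carrier (E m). nrm (E m) (y \<ominus>\<^bsub>E m\<^esub> x m) < e}" for m
      have "openin ?X (\<Pi>\<^sub>E m\<in>{1..n}. B m)"
        unfolding B_def using normed_module.openin_ball[OF E xc] by (simp add: openin_PiE)
      moreover have "x \<in> (\<Pi>\<^sub>E m\<in>{1..n}. B m)"
      proof -
        have "x m \<in> B m" if "m \<in> {1..n}" for m
        proof -
          interpret Em: normed_module "E m" by (rule E[OF that])
          show ?thesis using xc[OF that] e(1) by (simp add: B_def)
        qed
        then show ?thesis using x by (auto simp: PiE_iff)
      qed
      moreover have "(\<Pi>\<^sub>E m\<in>{1..n}. B m) \<subseteq> {x \<in> ?P. T x \<in> V}"
      proof
        fix y assume y: "y \<in> (\<Pi>\<^sub>E m\<in>{1..n}. B m)"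
        then have yP: "y \<in> ?P" and yB: "\<And>m. m \<in> {1..n} \<Longrightarrow> nrm (E m) (y m \<ominus>\<^bsub>E m\<^esub> x m) \<le> e"
          by (auto simp: B_def PiE_iff less_imp_le)
        have yK: "nrm (E m) (y m) \<le> K" if "m \<in> {1..n}" for m
        proof -
          interpret Em: normed_module "E m" by (rule E[OF that])
          have "\<bar>nrm (E m) (y m) - nrm (E m) (x m)\<bar> \<le> nrm (E m) (y m \<ominus>\<^bsub>E m\<^esub> x m)"
            using xc[OF that] yP that by (intro Em.nrm_diff_le) auto
          with xK[OF that] yB[OF that] e(2) show ?thesis by linarith
        qed
        have xK': "nrm (E m) (x m) \<le> K" if "m \<in> {1..n}" for m using xK[OF that] by simp
        have "nrm F (T y \<ominus>\<^bsub>F\<^esub> T x) \<le> real n * (C * (e * K ^ (n - 1)))"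
          by (rule multilin_lipschitz[OF E F T C x yP xK' yK yB])
        also have "\<dots> = A * e" by (simp add: A_def)
        finally have "T y \<in> V" using r(2) Ae multilinD(1)[OF T yP] by auto
        with yP show "y \<in> {x \<in> ?P. T x \<in> V}" by simp
      qed
      ultimately show "\<exists>W. openin ?X W \<and> x \<in> W \<and> W \<subseteq> {x \<in> ?P. T x \<in> V}" by blast
    qed
  qed
qed

text \<open>The common form of the type and cotype inequalities, with \<open>\<Phi>\<close>
  measuring the values and \<open>\<Psi> m\<close> the arguments in the \<open>m\<close>-th space;
  the two notions exchange the places of the Rademacher norm and the p-norms.\<close>

definition seq_bound :: "nat \<Rightarrow> (nat \<Rightarrow> ((nat \<Rightarrow> real) \<Rightarrow> real) \<Rightarrow> real) \<Rightarrow>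
    (nat \<Rightarrow> nat \<Rightarrow> ((nat \<Rightarrow> real) \<Rightarrow> real) \<Rightarrow> real) \<Rightarrow>
    (nat \<Rightarrow> ('k::real_or_complex, 'a) nspace) \<Rightarrow> ('k, 'b) nspace \<Rightarrow> ((nat \<Rightarrow> 'a) \<Rightarrow> 'b) \<Rightarrow> real \<Rightarrow> bool" where
  "seq_bound n \<Phi> \<Psi> E F T C \<longleftrightarrow>
     (\<forall>k x. (\<forall>j\<in>{1..k}. x j \<in> (\<Pi>\<^sub>E m\<in>{1..n}. carrier (E m))) \<longrightarrow>
        snorm \<Phi> F k (\<lambda>j. T (x j)) \<le> C * (\<Prod>m=1..n. snorm (\<Psi> m) (E m) k (\<lambda>j. x j m)))"

text \<open>Lets the individual constants of many operators be raised to a common one. The product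
  on the right must be nonnegative for this, hence the hypotheses on \<open>\<Psi>\<close> and
  \<open>E\<close>.\<close>

lemma seq_bound_mono:
  fixes E :: "nat \<Rightarrow> ('k::real_or_complex, 'a) nspace"
  assumes "\<And>m. m \<in> {1..n} \<Longrightarrow> seq_functional (\<Psi> m) (R m)" "\<And>m. m \<in> {1..n} \<Longrightarrow> normed_module (E m)"
    and "seq_bound n \<Phi> \<Psi> E F T C" "C \<le> C'"
  shows "seq_bound n \<Phi> \<Psi> E F T C'"
  unfolding seq_bound_def
proof (intro allI impI)
  fix k :: nat and x :: "nat \<Rightarrow> nat \<Rightarrow> 'a" assume x: "\<forall>j\<in>{1..k}. x j \<in> (\<Pi>\<^sub>E m\<in>{1..n}. carrier (E m))"
  have "0 \<le> snorm (\<Psi> m) (E m) k (\<lambda>j. x j m)" if "m \<in> {1..n}" for m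
    using x that by (intro seq_functional.snorm_nonneg[OF assms(1)] assms(2)) (auto simp: PiE_iff)
  then have "C * (\<Prod>m=1..n. snorm (\<Psi> m) (E m) k (\<lambda>j. x j m))
      \<le> C' * (\<Prod>m=1..n. snorm (\<Psi> m) (E m) k (\<lambda>j. x j m))"
    using assms(4) by (intro mult_right_mono prod_nonneg) auto
  then show "snorm \<Phi> F k (\<lambda>j. T (x j)) \<le> C' * (\<Prod>m=1..n. snorm (\<Psi> m) (E m) k (\<lambda>j. x j m))"
    using assms(3) x unfolding seq_bound_def by (meson order_trans)
qed

text \<open>The inequality for sequences of length 1, by \<open>snorm_one\<close>. Here a bound on
  type or cotype constants becomes the operator bound that the ultraproduct construction relies
  on.\<close>

lemma op_bound_if_seq_bound:
  assumes "seq_functional \<Phi> S" "\<And>m. m \<in> {1..n} \<Longrightarrow> seq_functional (\<Psi> m) (R m)"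
    and "\<And>m. m \<in> {1..n} \<Longrightarrow> normed_module (E m)" "normed_module F" "multilin n E F T"
    and "seq_bound n \<Phi> \<Psi> E F T C"
  shows "op_bound n E F T C"
  unfolding op_bound_def
proof
  fix x assume x: "x \<in> (\<Pi>\<^sub>E m\<in>{1..n}. carrier (E m))"
  have "snorm \<Phi> F 1 (\<lambda>j. T x) \<le> C * (\<Prod>m=1..n. snorm (\<Psi> m) (E m) 1 (\<lambda>j. x m))"
    using assms(6) x unfolding seq_bound_def by (elim allE[of _ 1] allE[of _ "\<lambda>j. x"]) simp
  moreover have "snorm \<Phi> F 1 (\<lambda>j. T x) = nrm F (T x)"
    using multilinD(1)[OF assms(5) x] by (rule seq_functional.snorm_one[OF assms(1,4)])
  moreover have "snorm (\<Psi> m) (E m) 1 (\<lambda>j. x m) = nrm (E m) (x m)" if "m \<in> {1..n}" for m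
    using x that by (intro seq_functional.snorm_one[OF assms(2)] assms(3)) auto
  ultimately show "nrm F (T x) \<le> C * (\<Prod>m=1..n. nrm (E m) (x m))" by simp
qed

section \<open>The ultraproduct of a uniformly bounded family of operators\<close>

locale ultraproduct_of_ops =
  fixes n :: nat and U :: "'i filter" and E :: "'i \<Rightarrow> nat \<Rightarrow> ('k::real_or_complex, 'a) nspace"
    and F :: "'i \<Rightarrow> ('k, 'b) nspace" and T :: "'i \<Rightarrow> (nat \<Rightarrow> 'a) \<Rightarrow> 'b" and C :: real
  assumes U: "ultrafilter U" and E: "\<And>i m. m \<in> {1..n} \<Longrightarrow> normed_module (E i m)"
    and F: "\<And>i. normed_module (F i)" and T: "\<And>i. multilin n (E i) (F i) (T i)"
    and C: "\<And>i. op_bound n (E i) (F i) (T i) C" "0 \<le> C"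
begin

abbreviation EU where "EU m \<equiv> ultraproduct U (\<lambda>i. E i m)"

abbreviation FU where "FU \<equiv> ultraproduct U F"

abbreviation TU where "TU \<equiv> ultraproduct_op n U F T"

abbreviation family where "family x i \<equiv> (\<lambda>m\<in>{1..n}. x m i)"

lemma UE: "m \<in> {1..n} \<Longrightarrow> ultraproduct_of_normed U (\<lambda>i. E i m)"
  using U E by (simp add: ultraproduct_of_normed_def)

sublocale F: ultraproduct_of_normed U F
  using U F by (simp add: ultraproduct_of_normed_def)

lemma family_mem:
  assumes "\<And>m. m \<in> {1..n} \<Longrightarrow> x m \<in> carrier (linfty_space (\<lambda>i. E i m))"
  shows "family x i \<in> (\<Pi>\<^sub>E m\<in>{1..n}. carrier (E i m))"
  using assms by (auto simp: mem_linfty_iff)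

lemma family_bound:
  assumes "\<And>m. m \<in> {1..n} \<Longrightarrow> x m \<in> carrier (linfty_space (\<lambda>i. E i m))"
  obtains K where "0 \<le> K" "\<And>i m. m \<in> {1..n} \<Longrightarrow> nrm (E i m) (x m i) \<le> K"
proof -
  obtain K where K: "\<And>m i. m \<in> {1..n} \<Longrightarrow> nrm (E i m) (x m i) \<le> K m"
    using assms unfolding mem_linfty_iff by metis
  have "nrm (E i m) (x m i) \<le> (\<Sum>m=1..n. \<bar>K m\<bar>)" if "m \<in> {1..n}" for i m
    using K[OF that, of i] member_le_sum[of m "{1..n}" "\<lambda>m. \<bar>K m\<bar>"] that by fastforce
  then show ?thesis by (intro that[of "\<Sum>m=1..n. \<bar>K m\<bar>"]) (auto intro: sum_nonneg)
qed

lemma op_family_mem: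
  assumes x: "\<And>m. m \<in> {1..n} \<Longrightarrow> x m \<in> carrier (linfty_space (\<lambda>i. E i m))"
  shows "(\<lambda>i. T i (family x i)) \<in> carrier (linfty_space F)"
proof -
  obtain K where K: "0 \<le> K" "\<And>i m. m \<in> {1..n} \<Longrightarrow> nrm (E i m) (x m i) \<le> K"
    using family_bound[OF x] by blast
  have "nrm (F i) (T i (family x i)) \<le> C * K ^ n" for i
  proof -
    have "nrm (F i) (T i (family x i)) \<le> C * (\<Prod>m=1..n. nrm (E i m) (x m i))"
      using C(1)[of i] family_mem[OF x, of i] unfolding op_bound_def by fastforce
    also have "(\<Prod>m=1..n. nrm (E i m) (x m i)) \<le> (\<Prod>m=1..n. K)"
      using K(2) family_mem[OF x, of i] normed_module.nrm_nonneg[OF E]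
      by (intro prod_mono conjI) (auto simp: PiE_iff)
    finally show ?thesis using C(2) by (simp add: mult_left_mono)
  qed
  then show ?thesis
    using multilinD(1)[OF T family_mem[OF x]] unfolding mem_linfty_iff by blast
qed

text \<open>Independence of representatives. The Lipschitz estimate has constants uniform in the
  index, so changing each argument by a null family changes the family of values by a null family.
  Afterwards any convenient lift of a tuple of classes may be used.\<close>

lemma op_ultraclass:
  assumes x: "\<And>m. m \<in> {1..n} \<Longrightarrow> x m \<in> carrier (linfty_space (\<lambda>i. E i m))"
    and A: "\<And>m. m \<in> {1..n} \<Longrightarrow> A m = ultraclass U (\<lambda>i. E i m) (x m)"
  shows "TU A = ultraclass U F (\<lambda>i. T i (family x i))"
proof -
  define r where "r m = representative (A m)" for m
  have r: "r m \<in> carrier (linfty_space (\<lambda>i. E i m))"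
      "ultraclass U (\<lambda>i. E i m) (r m) = ultraclass U (\<lambda>i. E i m) (x m)" if m: "m \<in> {1..n}" for m
  proof -
    interpret Em: ultraproduct_of_normed U "\<lambda>i. E i m" by (rule UE[OF m])
    have "A m \<in> carrier (EU m)" using A[OF m] x[OF m] Em.carrier_ultraproduct by simp
    then show "r m \<in> carrier (linfty_space (\<lambda>i. E i m))"
        "ultraclass U (\<lambda>i. E i m) (r m) = ultraclass U (\<lambda>i. E i m) (x m)"
      using Em.representative_ultraclass[of "A m"] A[OF m] by (simp_all add: r_def)
  qed
  obtain K1 where K1: "0 \<le> K1" "\<And>i m. m \<in> {1..n} \<Longrightarrow> nrm (E i m) (x m i) \<le> K1"
    using family_bound[OF x] by blast
  obtain K2 where K2: "0 \<le> K2" "\<And>i m. m \<in> {1..n} \<Longrightarrow> nrm (E i m) (r m i) \<le> K2"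
    using family_bound[OF r(1)] by blast
  \<comment> \<open>A sum dominates the difference in each slot and tends to 0 because its finitely
    many terms do.\<close>
  define d where "d i = (\<Sum>m=1..n. nrm (E i m) (r m i \<ominus>\<^bsub>E i m\<^esub> x m i))" for i
  have d0: "(d \<longlongrightarrow> 0) U"
    unfolding d_def
  proof (rule tendsto_null_sum)
    fix m assume m: "m \<in> {1..n}"
    interpret Em: ultraproduct_of_normed U "\<lambda>i. E i m" by (rule UE[OF m])
    show "((\<lambda>i. nrm (E i m) (r m i \<ominus>\<^bsub>E i m\<^esub> x m i)) \<longlongrightarrow> 0) U"
      using Em.ultraclass_eq_iff[OF r(1)[OF m] x[OF m]] r(2)[OF m] by simp
  qed
  have dm: "nrm (E i m) (r m i \<ominus>\<^bsub>E i m\<^esub> x m i) \<le> d i" if m: "m \<in> {1..n}" for i m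
    unfolding d_def
  proof (rule member_le_sum[OF m])
    fix j assume j: "j \<in> {1..n} - {m}"
    interpret Ej: normed_module "E i j" using E j by blast
    have "r j i \<in> carrier (E i j)" "x j i \<in> carrier (E i j)"
      using r(1)[of j] x[of j] j by (auto simp: mem_linfty_iff)
    then show "0 \<le> nrm (E i j) (r j i \<ominus>\<^bsub>E i j\<^esub> x j i)" by simp
  qed simp
  have le: "nrm (F i) (T i (family r i) \<ominus>\<^bsub>F i\<^esub> T i (family x i))
      \<le> real n * (C * (d i * max K1 K2 ^ (n - 1)))" for i
    using K1(2) K2(2) dm
    by (intro multilin_lipschitz[OF E F T C family_mem[OF x] family_mem[OF r(1)]])
      (auto simp: le_max_iff_disj)
  have nonneg: "0 \<le> nrm (F i) (T i (family r i) \<ominus>\<^bsub>F i\<^esub> T i (family x i))" for i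
    using multilinD(1)[OF T family_mem[OF x]] multilinD(1)[OF T family_mem[OF r(1)]] by auto
  have "((\<lambda>i. nrm (F i) (T i (family r i) \<ominus>\<^bsub>F i\<^esub> T i (family x i))) \<longlongrightarrow> 0) U"
  proof (rule Lim_null_comparison)
    show "\<forall>\<^sub>F i in U. norm (nrm (F i) (T i (family r i) \<ominus>\<^bsub>F i\<^esub> T i (family x i)))
        \<le> real n * (C * (d i * max K1 K2 ^ (n - 1)))"
      by (intro always_eventually allI) (simp only: real_norm_def abs_of_nonneg nonneg le)
    show "((\<lambda>i. real n * (C * (d i * max K1 K2 ^ (n - 1)))) \<longlongrightarrow> 0) U"
      by (intro tendsto_mult_right_zero tendsto_mult_left_zero d0)
  qed
  then have "ultraclass U F (\<lambda>i. T i (family r i)) = ultraclass U F (\<lambda>i. T i (family x i))"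
    using F.ultraclass_eq_iff[OF op_family_mem[OF r(1)] op_family_mem[OF x]] by simp
  then show ?thesis by (simp add: ultraproduct_op_def r_def)
qed

lemma ultraclass_PiE_obtain:
  assumes "A \<in> (\<Pi>\<^sub>E m\<in>{1..n}. carrier (EU m))"
  obtains x where "\<And>m. m \<in> {1..n} \<Longrightarrow> x m \<in> carrier (linfty_space (\<lambda>i. E i m))"
    "\<And>m. m \<in> {1..n} \<Longrightarrow> A m = ultraclass U (\<lambda>i. E i m) (x m)"
proof (rule that[of "\<lambda>m. representative (A m)"])
  fix m assume m: "m \<in> {1..n}"
  interpret Em: ultraproduct_of_normed U "\<lambda>i. E i m" by (rule UE[OF m])
  have "A m \<in> carrier (EU m)" using assms m by auto
  then show "representative (A m) \<in> carrier (linfty_space (\<lambda>i. E i m))"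
    "A m = ultraclass U (\<lambda>i. E i m) (representative (A m))"
    using Em.representative_ultraclass[of "A m"] by simp_all
qed

lemma multilin_ultraproduct_op: "multilin n EU FU TU"
  unfolding multilin_def
proof (intro conjI ballI allI)
  show "TU \<in> (\<Pi>\<^sub>E m\<in>{1..n}. carrier (EU m)) \<rightarrow> carrier FU"
  proof
    fix A assume "A \<in> (\<Pi>\<^sub>E m\<in>{1..n}. carrier (EU m))"
    then obtain x where "\<And>m. m \<in> {1..n} \<Longrightarrow> x m \<in> carrier (linfty_space (\<lambda>i. E i m))"
        "\<And>m. m \<in> {1..n} \<Longrightarrow> A m = ultraclass U (\<lambda>i. E i m) (x m)"
      using ultraclass_PiE_obtain by blast
    then show "TU A \<in> carrier FU"
      using op_ultraclass[of x A] op_family_mem[of x] F.carrier_ultraproduct by simp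
  qed
next
  fix A m assume A: "A \<in> (\<Pi>\<^sub>E m\<in>{1..n}. carrier (EU m))" and m: "m \<in> {1..n}"
  obtain x where x: "\<And>m. m \<in> {1..n} \<Longrightarrow> x m \<in> carrier (linfty_space (\<lambda>i. E i m))"
      "\<And>m. m \<in> {1..n} \<Longrightarrow> A m = ultraclass U (\<lambda>i. E i m) (x m)"
    using ultraclass_PiE_obtain[OF A] by blast
  interpret Em: ultraproduct_of_normed U "\<lambda>i. E i m" by (rule UE[OF m])
  have upd_mem: "\<And>l. l \<in> {1..n} \<Longrightarrow> (x(m := u)) l \<in> carrier (linfty_space (\<lambda>i. E i l))"
    if "u \<in> carrier (linfty_space (\<lambda>i. E i m))" for u
    using x(1) that by simp
  \<comment> \<open>The updated tuple is lifted by updating the lift of \<open>A\<close>, rather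
    than by its own chosen representatives; this makes the multilinearity of each \<open>T i\<close>
    applicable index by index.\<close>
  have upd: "TU (A(m := ultraclass U (\<lambda>i. E i m) u)) = ultraclass U F (\<lambda>i. T i ((family x i)(m := u i)))"
    if "u \<in> carrier (linfty_space (\<lambda>i. E i m))" for u
  proof -
    have "TU (A(m := ultraclass U (\<lambda>i. E i m) u)) = ultraclass U F (\<lambda>i. T i (family (x(m := u)) i))"
      by (rule op_ultraclass[OF upd_mem[OF that]]) (use x(2) in auto)
    moreover have "family (x(m := u)) i = (family x i)(m := u i)" for i
      using m by (auto simp: fun_eq_iff)
    ultimately show ?thesis by simp
  qed
  have upd_op_mem: "(\<lambda>i. T i ((family x i)(m := u i))) \<in> carrier (linfty_space F)"
    if "u \<in> carrier (linfty_space (\<lambda>i. E i m))" for u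
  proof -
    have "family (x(m := u)) i = (family x i)(m := u i)" for i
      using m by (auto simp: fun_eq_iff)
    then show ?thesis using op_family_mem[OF upd_mem[OF that]] by simp
  qed
  have comp: "u i \<in> carrier (E i m)" if "u \<in> carrier (linfty_space (\<lambda>i. E i m))" for u i
    using that by (simp add: mem_linfty_iff)
  { fix B D assume "B \<in> carrier (EU m)" "D \<in> carrier (EU m)"
    then obtain u v where u: "u \<in> carrier (linfty_space (\<lambda>i. E i m))" "B = ultraclass U (\<lambda>i. E i m) u"
      and v: "v \<in> carrier (linfty_space (\<lambda>i. E i m))" "D = ultraclass U (\<lambda>i. E i m) v"
      using Em.carrier_ultraproduct by auto
    have "B \<oplus>\<^bsub>EU m\<^esub> D = ultraclass U (\<lambda>i. E i m) (\<lambda>i. u i \<oplus>\<^bsub>E i m\<^esub> v i)"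
      using linD(2)[OF Em.lin_ultraclass u(1) v(1)] u(2) v(2) by simp
    moreover have "(\<lambda>i. u i \<oplus>\<^bsub>E i m\<^esub> v i) \<in> carrier (linfty_space (\<lambda>i. E i m))"
      using Em.I.add_closed[OF u(1) v(1)] by simp
    ultimately have "TU (A(m := B \<oplus>\<^bsub>EU m\<^esub> D))
        = ultraclass U F (\<lambda>i. T i ((family x i)(m := u i \<oplus>\<^bsub>E i m\<^esub> v i)))"
      using upd by simp
    also have "(\<lambda>i. T i ((family x i)(m := u i \<oplus>\<^bsub>E i m\<^esub> v i)))
        = (\<lambda>i. T i ((family x i)(m := u i))) \<oplus>\<^bsub>linfty_space F\<^esub> (\<lambda>i. T i ((family x i)(m := v i)))"
      using multilinD(2)[OF T family_mem[OF x(1)] m comp[OF u(1)] comp[OF v(1)]] by simp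
    also have "ultraclass U F \<dots> = TU (A(m := B)) \<oplus>\<^bsub>FU\<^esub> TU (A(m := D))"
      using linD(2)[OF F.lin_ultraclass upd_op_mem[OF u(1)] upd_op_mem[OF v(1)]]
      unfolding u(2) v(2) upd[OF u(1)] upd[OF v(1)] .
    finally show "TU (A(m := B \<oplus>\<^bsub>EU m\<^esub> D)) = TU (A(m := B)) \<oplus>\<^bsub>FU\<^esub> TU (A(m := D))" . }
  { fix c B assume "B \<in> carrier (EU m)"
    then obtain u where u: "u \<in> carrier (linfty_space (\<lambda>i. E i m))" "B = ultraclass U (\<lambda>i. E i m) u"
      using Em.carrier_ultraproduct by auto
    have "c \<odot>\<^bsub>EU m\<^esub> B = ultraclass U (\<lambda>i. E i m) (\<lambda>i. c \<odot>\<^bsub>E i m\<^esub> u i)"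
      using linD(3)[OF Em.lin_ultraclass u(1)] u(2) by simp
    moreover have "(\<lambda>i. c \<odot>\<^bsub>E i m\<^esub> u i) \<in> carrier (linfty_space (\<lambda>i. E i m))"
      using Em.I.smult_closed'[OF u(1)] by simp
    ultimately have "TU (A(m := c \<odot>\<^bsub>EU m\<^esub> B))
        = ultraclass U F (\<lambda>i. T i ((family x i)(m := c \<odot>\<^bsub>E i m\<^esub> u i)))"
      using upd by simp
    also have "(\<lambda>i. T i ((family x i)(m := c \<odot>\<^bsub>E i m\<^esub> u i)))
        = c \<odot>\<^bsub>linfty_space F\<^esub> (\<lambda>i. T i ((family x i)(m := u i)))"
      using multilinD(3)[OF T family_mem[OF x(1)] m comp[OF u(1)]] by simp
    also have "ultraclass U F \<dots> = c \<odot>\<^bsub>FU\<^esub> TU (A(m := B))"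
      using linD(3)[OF F.lin_ultraclass upd_op_mem[OF u(1)]] unfolding u(2) upd[OF u(1)] .
    finally show "TU (A(m := c \<odot>\<^bsub>EU m\<^esub> B)) = c \<odot>\<^bsub>FU\<^esub> TU (A(m := B))" . }
qed

text \<open>On lifts of the vectors the inequality holds at every index with the same
  \<open>D\<close>; both sides converge along \<open>U\<close>, and a weak inequality survives the
  limit.\<close>

lemma seq_bound_ultraproduct_op:
  assumes "seq_functional \<Phi> S" "\<And>m. m \<in> {1..n} \<Longrightarrow> seq_functional (\<Psi> m) (R m)"
    and bound: "\<And>i. seq_bound n \<Phi> \<Psi> (E i) (F i) (T i) D"
  shows "seq_bound n \<Phi> \<Psi> EU FU TU D"
  unfolding seq_bound_def
proof (intro allI impI)
  fix k :: nat and A :: "nat \<Rightarrow> nat \<Rightarrow> ('i \<Rightarrow> 'a) set"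
  assume A: "\<forall>j\<in>{1..k}. A j \<in> (\<Pi>\<^sub>E m\<in>{1..n}. carrier (EU m))"
  have "\<exists>x. (\<forall>m\<in>{1..n}. x m \<in> carrier (linfty_space (\<lambda>i. E i m)) \<and>
      A j m = ultraclass U (\<lambda>i. E i m) (x m))" if "j \<in> {1..k}" for j
    using ultraclass_PiE_obtain[of "A j"] A that by metis
  then obtain x where x: "\<And>j m. j \<in> {1..k} \<Longrightarrow> m \<in> {1..n} \<Longrightarrow> x j m \<in> carrier (linfty_space (\<lambda>i. E i m))"
      "\<And>j m. j \<in> {1..k} \<Longrightarrow> m \<in> {1..n} \<Longrightarrow> A j m = ultraclass U (\<lambda>i. E i m) (x j m)"
    by metis
  have TA: "TU (A j) = ultraclass U F (\<lambda>i. T i (family (x j) i))"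
    and Tx: "(\<lambda>i. T i (family (x j) i)) \<in> carrier (linfty_space F)" if "j \<in> {1..k}" for j
    using op_ultraclass[of "x j" "A j"] op_family_mem[of "x j"] x that by auto
  have "snorm \<Phi> FU k (\<lambda>j. TU (A j)) = snorm \<Phi> FU k (\<lambda>j. ultraclass U F (\<lambda>i. T i (family (x j) i)))"
    using TA Tx F.carrier_ultraproduct by (intro snorm_cong F.ultraproduct_kmodule) auto
  then have left: "((\<lambda>i. snorm \<Phi> (F i) k (\<lambda>j. T i (family (x j) i))) \<longlongrightarrow> snorm \<Phi> FU k (\<lambda>j. TU (A j))) U"
    using F.tendsto_snorm_ultraclass[OF assms(1), of k "\<lambda>j i. T i (family (x j) i)"] Tx by simp
  have "((\<lambda>i. snorm (\<Psi> m) (E i m) k (\<lambda>j. family (x j) i m)) \<longlongrightarrow> snorm (\<Psi> m) (EU m) k (\<lambda>j. A j m)) U"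
    if m: "m \<in> {1..n}" for m
  proof -
    interpret Em: ultraproduct_of_normed U "\<lambda>i. E i m" by (rule UE[OF m])
    have "snorm (\<Psi> m) (EU m) k (\<lambda>j. A j m) = snorm (\<Psi> m) (EU m) k (\<lambda>j. ultraclass U (\<lambda>i. E i m) (x j m))"
      using x m Em.carrier_ultraproduct by (intro snorm_cong Em.ultraproduct_kmodule) auto
    then show ?thesis
      using Em.tendsto_snorm_ultraclass[OF assms(2)[OF m], of k "\<lambda>j. x j m"] x m by simp
  qed
  then have right: "((\<lambda>i. D * (\<Prod>m=1..n. snorm (\<Psi> m) (E i m) k (\<lambda>j. family (x j) i m)))
      \<longlongrightarrow> D * (\<Prod>m=1..n. snorm (\<Psi> m) (EU m) k (\<lambda>j. A j m))) U"
    by (intro tendsto_mult_left tendsto_prod)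
  have "\<forall>j\<in>{1..k}. family (x j) i \<in> (\<Pi>\<^sub>E m\<in>{1..n}. carrier (E i m))" for i
    using family_mem[of "x j" for j] x(1) by blast
  then have "snorm \<Phi> (F i) k (\<lambda>j. T i (family (x j) i))
      \<le> D * (\<Prod>m=1..n. snorm (\<Psi> m) (E i m) k (\<lambda>j. family (x j) i m))" for i
    using bound[of i, unfolded seq_bound_def, THEN spec, THEN spec, of k "\<lambda>j. family (x j) i"] by blast
  then show "snorm \<Phi> FU k (\<lambda>j. TU (A j)) \<le> D * (\<Prod>m=1..n. snorm (\<Psi> m) (EU m) k (\<lambda>j. A j m))"
    by (intro tendsto_le[OF F.U_not_bot right left]) simp
qed

lemma op_bound_ultraproduct_op: "op_bound n EU FU TU C"
  unfolding op_bound_def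
proof
  fix A assume "A \<in> (\<Pi>\<^sub>E m\<in>{1..n}. carrier (EU m))"
  then obtain x where x: "\<And>m. m \<in> {1..n} \<Longrightarrow> x m \<in> carrier (linfty_space (\<lambda>i. E i m))"
      "\<And>m. m \<in> {1..n} \<Longrightarrow> A m = ultraclass U (\<lambda>i. E i m) (x m)"
    using ultraclass_PiE_obtain by blast
  have left: "((\<lambda>i. nrm (F i) (T i (family x i))) \<longlongrightarrow> nrm FU (TU A)) U"
    using F.tendsto_nrm_ultraclass[OF op_family_mem[of x]] op_ultraclass[of x A] x by simp
  have "((\<lambda>i. nrm (E i m) (family x i m)) \<longlongrightarrow> nrm (EU m) (A m)) U" if m: "m \<in> {1..n}" for m
  proof -
    interpret Em: ultraproduct_of_normed U "\<lambda>i. E i m" by (rule UE[OF m])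
    show ?thesis using Em.tendsto_nrm_ultraclass[OF x(1)[OF m]] x(2)[OF m] m by simp
  qed
  then have right: "((\<lambda>i. C * (\<Prod>m=1..n. nrm (E i m) (family x i m))) \<longlongrightarrow> C * (\<Prod>m=1..n. nrm (EU m) (A m))) U"
    by (intro tendsto_mult_left tendsto_prod)
  have "nrm (F i) (T i (family x i)) \<le> C * (\<Prod>m=1..n. nrm (E i m) (family x i m))" for i
    using C(1)[of i] family_mem[OF x(1), of i] unfolding op_bound_def by blast
  then show "nrm FU (TU A) \<le> C * (\<Prod>m=1..n. nrm (EU m) (A m))"
    by (intro tendsto_le[OF F.U_not_bot right left]) simp
qed

lemma ultraproduct_op_mem: "TU \<in> multilinear_ops n EU FU"
  using UE ultraproduct_of_normed.ultraproduct_normed_module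
  by (intro bounded_multilin_continuous[OF _ F.ultraproduct_normed_module multilin_ultraproduct_op
        op_bound_ultraproduct_op C(2)]) blast

end

subsection \<open>Regularity, ultrastability and maximality\<close>

lemma seq_bound_canonical_embedding:
  assumes "\<And>m. m \<in> {1..n} \<Longrightarrow> kmodule (E m)" "normed_module F"
    and "T \<in> (\<Pi>\<^sub>E m\<in>{1..n}. carrier (E m)) \<rightarrow> carrier F"
  shows "seq_bound n \<Phi> \<Psi> E (dual_space (dual_space F)) (canonical_embedding F \<circ> T) C
    \<longleftrightarrow> seq_bound n \<Phi> \<Psi> E F T C"
proof -
  interpret F: normed_module F by fact
  interpret D: normed_module "dual_space F" by (rule F.dual_normed_module)
  have eq: "snorm \<Phi> (dual_space (dual_space F)) k (\<lambda>j. (canonical_embedding F \<circ> T) (x j))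
      = snorm \<Phi> F k (\<lambda>j. T (x j))"
    if "\<forall>j\<in>{1..k}. x j \<in> (\<Pi>\<^sub>E m\<in>{1..n}. carrier (E m))" for k x
    unfolding comp_def using that assms(3)
    by (intro snorm_isometry[OF F.kmodule_axioms D.dual_kmodule F.canonical_embedding_lin _
          F.nrm_canonical_embedding]) blast+
  show ?thesis unfolding seq_bound_def by (intro iff_allI imp_cong refl) (simp only: eq)
qed

text \<open>The quotient map contracts and so decreases the left side, while the inclusions of the
  subspaces are isometric and leave the right side unchanged.\<close>

lemma seq_bound_sub_quotient:
  assumes "seq_functional \<Phi> S" "\<And>m. m \<in> {1..n} \<Longrightarrow> kmodule (E m)" "normed_module F"
    and T: "T \<in> (\<Pi>\<^sub>E m\<in>{1..n}. carrier (E m)) \<rightarrow> carrier F"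
    and D: "\<And>m. m \<in> {1..n} \<Longrightarrow> D m \<in> FIN (E m)" and L: "L \<in> COFIN F"
    and bound: "seq_bound n \<Phi> \<Psi> E F T C"
  shows "seq_bound n \<Phi> \<Psi> (\<lambda>m. subspace_of (E m) (D m)) (quotient_space F L)
    (restrict (quotient_map F L \<circ> T) (\<Pi>\<^sub>E m\<in>{1..n}. D m)) C"
  unfolding seq_bound_def subspace_of_simps
proof (intro allI impI)
  fix k :: nat and x assume x: "\<forall>j\<in>{1..k}. x j \<in> (\<Pi>\<^sub>E m\<in>{1..n}. D m)"
  interpret F: normed_module F by fact
  interpret quotient_of_module F L
    using L by (auto simp: COFIN_def intro!: quotient_of_module.intro quotient_of_module_axioms.intro F.kmodule_axioms)
  have D_sub: "submodule (D m) ring_of_type_algebra (E m)" if "m \<in> {1..n}" for m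
    using D[OF that] by (simp add: FIN_def)
  have "D m \<subseteq> carrier (E m)" if "m \<in> {1..n}" for m
    using module.submoduleE(1)[OF kmodule.axioms(1)[OF assms(2)[OF that]] D_sub[OF that]] .
  then have xE: "\<forall>j\<in>{1..k}. x j \<in> (\<Pi>\<^sub>E m\<in>{1..n}. carrier (E m))"
    using x unfolding PiE_iff by blast
  then have Tx: "\<forall>j\<in>{1..k}. T (x j) \<in> carrier F" using T by blast
  have "snorm \<Phi> (quotient_space F L) k (\<lambda>j. restrict (quotient_map F L \<circ> T) (\<Pi>\<^sub>E m\<in>{1..n}. D m) (x j))
      = snorm \<Phi> (quotient_space F L) k (\<lambda>j. quotient_map F L (T (x j)))"
    using x Tx linD(1)[OF lin_quotient_map] by (intro snorm_cong quotient_kmodule) auto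
  also have "\<dots> \<le> snorm \<Phi> F k (\<lambda>j. T (x j))"
    by (rule seq_functional.snorm_lin_le[OF assms(1) F.kmodule_axioms quotient_kmodule lin_quotient_map Tx])
      (use nrm_quotient_map[OF assms(3)] in auto)
  also have "\<dots> \<le> C * (\<Prod>m=1..n. snorm (\<Psi> m) (E m) k (\<lambda>j. x j m))"
    using bound xE unfolding seq_bound_def by blast
  also have "(\<Prod>m=1..n. snorm (\<Psi> m) (E m) k (\<lambda>j. x j m))
      = (\<Prod>m=1..n. snorm (\<Psi> m) (subspace_of (E m) (D m)) k (\<lambda>j. x j m))"
  proof (rule prod.cong[OF refl])
    fix m assume m: "m \<in> {1..n}"
    note E = assms(2)[OF m] and sub = D_sub[OF m]
    show "snorm (\<Psi> m) (E m) k (\<lambda>j. x j m) = snorm (\<Psi> m) (subspace_of (E m) (D m)) k (\<lambda>j. x j m)"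
      by (rule snorm_isometry[OF subspace_kmodule[OF E sub] E lin_subspace[OF E sub]])
        (use x m in \<open>auto simp: PiE_iff\<close>)
  qed
  finally show "snorm \<Phi> (quotient_space F L) k (\<lambda>j. restrict (quotient_map F L \<circ> T) (\<Pi>\<^sub>E m\<in>{1..n}. D m) (x j))
      \<le> C * (\<Prod>m=1..n. snorm (\<Psi> m) (subspace_of (E m) (D m)) k (\<lambda>j. x j m))" .
qed

text \<open>The pair \<open>D\<close>, \<open>L\<close> is chosen after \<open>k\<close> and
  \<open>x\<close>: the \<open>D m\<close> contain the given vectors, and \<open>L\<close> norms the
  finitely many combinations of the \<open>T (x j)\<close> that \<open>\<Phi>\<close> looks at. The
  dependence on \<open>x\<close> is harmless because \<open>C\<close> is the same for all
  pairs.\<close>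

lemma seq_bound_if_sub_quotient:
  assumes "seq_functional \<Phi> S" "\<And>m. m \<in> {1..n} \<Longrightarrow> kmodule (E m)" "normed_module F"
    and T: "T \<in> (\<Pi>\<^sub>E m\<in>{1..n}. carrier (E m)) \<rightarrow> carrier F"
    and bound: "\<And>D L. (\<And>m. m \<in> {1..n} \<Longrightarrow> D m \<in> FIN (E m)) \<Longrightarrow> L \<in> COFIN F \<Longrightarrow>
      seq_bound n \<Phi> \<Psi> (\<lambda>m. subspace_of (E m) (D m)) (quotient_space F L)
        (restrict (quotient_map F L \<circ> T) (\<Pi>\<^sub>E m\<in>{1..n}. D m)) C"
  shows "seq_bound n \<Phi> \<Psi> E F T C"
  unfolding seq_bound_def
proof (intro allI impI)
  fix k :: nat and x assume x: "\<forall>j\<in>{1..k}. x j \<in> (\<Pi>\<^sub>E m\<in>{1..n}. carrier (E m))"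
  interpret \<Phi>: seq_functional \<Phi> S by fact
  interpret F: normed_module F by fact
  have Tx: "\<forall>j\<in>{1..k}. T (x j) \<in> carrier F" using T x by blast
  have "\<exists>D. D \<in> FIN (E m) \<and> (\<forall>j\<in>{1..k}. x j m \<in> D)" if m: "m \<in> {1..n}" for m
  proof -
    have "finite ((\<lambda>j. x j m) ` {1..k})" "(\<lambda>j. x j m) ` {1..k} \<subseteq> carrier (E m)"
      using x m by (auto simp: PiE_iff)
    then obtain D where "D \<in> FIN (E m)" "(\<lambda>j. x j m) ` {1..k} \<subseteq> D"
      using FIN_superset[OF assms(2)[OF m]] by blast
    then show ?thesis by blast
  qed
  then obtain D where D: "\<And>m. m \<in> {1..n} \<Longrightarrow> D m \<in> FIN (E m)"
      "\<And>m j. m \<in> {1..n} \<Longrightarrow> j \<in> {1..k} \<Longrightarrow> x j m \<in> D m"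
    by metis
  let ?z = "\<lambda>s. lincomb F k s (\<lambda>j. T (x j))"
  have z: "?z s \<in> carrier F" for s using lincomb_closed[OF F.kmodule_axioms Tx] .
  obtain L where cofin: "L \<in> COFIN F" and norming:
      "\<And>z. z \<in> ?z ` S k \<Longrightarrow> nrm F z \<le> nrm (quotient_space F L) (quotient_map F L z)"
    using F.norming_COFIN[of "?z ` S k"] \<Phi>.finite_S[of k] z by blast
  interpret quotient_of_module F L
    using cofin by (auto simp: COFIN_def intro!: quotient_of_module.intro quotient_of_module_axioms.intro F.kmodule_axioms)
  have xD: "\<forall>j\<in>{1..k}. x j \<in> (\<Pi>\<^sub>E m\<in>{1..n}. D m)" using D(2) x by (auto simp: PiE_iff)
  have "snorm \<Phi> F k (\<lambda>j. T (x j)) \<le> snorm \<Phi> (quotient_space F L) k (\<lambda>j. quotient_map F L (T (x j)))"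
    by (rule \<Phi>.snorm_lin_ge[OF F.kmodule_axioms quotient_kmodule lin_quotient_map Tx])
      (use z norming in auto)
  also have "\<dots> = snorm \<Phi> (quotient_space F L) k
      (\<lambda>j. restrict (quotient_map F L \<circ> T) (\<Pi>\<^sub>E m\<in>{1..n}. D m) (x j))"
    using xD Tx linD(1)[OF lin_quotient_map] by (intro snorm_cong quotient_kmodule) auto
  also have "\<dots> \<le> C * (\<Prod>m=1..n. snorm (\<Psi> m) (subspace_of (E m) (D m)) k (\<lambda>j. x j m))"
    using bound[OF D(1) cofin] xD unfolding seq_bound_def by simp
  also have "(\<Prod>m=1..n. snorm (\<Psi> m) (subspace_of (E m) (D m)) k (\<lambda>j. x j m))
      = (\<Prod>m=1..n. snorm (\<Psi> m) (E m) k (\<lambda>j. x j m))"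
  proof (rule prod.cong[OF refl])
    fix m assume m: "m \<in> {1..n}"
    have sub: "submodule (D m) ring_of_type_algebra (E m)" using D(1)[OF m] by (simp add: FIN_def)
    note E = assms(2)[OF m]
    show "snorm (\<Psi> m) (subspace_of (E m) (D m)) k (\<lambda>j. x j m) = snorm (\<Psi> m) (E m) k (\<lambda>j. x j m)"
      by (rule snorm_isometry[OF subspace_kmodule[OF E sub] E lin_subspace[OF E sub], symmetric])
        (use D(2) m in auto)
  qed
  finally show "snorm \<Phi> F k (\<lambda>j. T (x j)) \<le> C * (\<Prod>m=1..n. snorm (\<Psi> m) (E m) k (\<lambda>j. x j m))" .
qed

section \<open>Ideals given by admissible constants\<close>

definition bound_ideal :: "nat \<Rightarrow> ((nat \<Rightarrow> ('k::real_or_complex, 'a) nspace) \<Rightarrow> ('k, 'b) nspace \<Rightarrow>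
    ((nat \<Rightarrow> 'a) \<Rightarrow> 'b) \<Rightarrow> real \<Rightarrow> bool) \<Rightarrow> ('k, 'a, 'b) multi_ideal" where
  "bound_ideal n P =
     \<lparr>ops = (\<lambda>E F. {T \<in> multilinear_ops n E F. \<exists>C>0. P E F T C}),
      inorm = (\<lambda>E F T. INF C\<in>{C. 0 < C \<and> P E F T C}. ennreal C)\<rparr>"

lemma type_ideal_eq: "type_ideal n p = bound_ideal n (type_bound n p)"
  by (simp add: type_ideal_def bound_ideal_def)

lemma cotype_ideal_eq: "cotype_ideal n q = bound_ideal n (cotype_bound n q)"
  by (simp add: cotype_ideal_def bound_ideal_def)

lemma inorm_bound_ideal_less:
  assumes "inorm (bound_ideal n P) E F T < ennreal C"
  obtains C' where "0 < C'" "C' < C" "P E F T C'"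
proof -
  obtain C' where "0 < C'" "P E F T C'" "ennreal C' < ennreal C"
    using assms by (auto simp: bound_ideal_def INF_less_iff)
  then show ?thesis using that[of C'] by (simp add: ennreal_less_iff)
qed

text \<open>The bound \<open>a\<close> itself need not be admissible, and it may be 0, whereas
  admissible constants are positive. The infimum is therefore compared with every
  \<open>b > a\<close>.\<close>

lemma inorm_bound_ideal_le:
  assumes "\<And>C. 0 < C \<Longrightarrow> a < ennreal C \<Longrightarrow> P E F T C"
  shows "inorm (bound_ideal n P) E F T \<le> a"
proof (rule dense_ge)
  fix b assume "a < b"
  \<comment> \<open>The intermediate value is finite, as it lies below \<open>b\<close>, and so it
    is given by a real constant, even if \<open>b\<close> is infinite.\<close>
  then obtain c where c: "a < c" "c < b" using dense by blast
  have fin: "c < \<infinity>" using order_less_le_trans[OF c(2) top_greatest] by simp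
  then have eq: "c = ennreal (enn2real c)" by simp
  have "0 < c" using c(1) by (rule order_le_less_trans[OF zero_le])
  then have "0 < enn2real c" using fin by (simp add: enn2real_positive_iff)
  moreover from this have "P E F T (enn2real c)" using assms c(1) eq by metis
  ultimately have "inorm (bound_ideal n P) E F T \<le> ennreal (enn2real c)"
    unfolding bound_ideal_def by (auto intro!: INF_lower)
  with eq c(2) show "inorm (bound_ideal n P) E F T \<le> b" by simp
qed

lemma ennreal_bound_exists:
  fixes a :: ennreal
  assumes "a < \<infinity>"
  obtains C where "0 < C" "a < ennreal C"
proof (rule that)
  have "a = ennreal (enn2real a)" using assms by (simp add: ennreal_enn2real)
  also have "\<dots> < ennreal (enn2real a + 1)" by (simp add: ennreal_less_iff)
  finally show "a < ennreal (enn2real a + 1)" .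
  show "0 < enn2real a + 1" by (rule add_nonneg_pos) auto
qed

text \<open>Off the modules, where finite sums need not behave, \<open>P\<close> and \<open>seq_bound\<close> may differ.\<close>

definition given_by_seq_bound where
  "given_by_seq_bound n \<Phi> \<Psi> P \<longleftrightarrow>
     (\<forall>E F T C. (\<forall>m\<in>{1..n}. kmodule (E m)) \<longrightarrow> kmodule F \<longrightarrow>
        T \<in> (\<Pi>\<^sub>E m\<in>{1..n}. carrier (E m)) \<rightarrow> carrier F \<longrightarrow>
        (P E F T C \<longleftrightarrow> seq_bound n \<Phi> \<Psi> E F T C))"

lemma given_by_seq_boundD:
  assumes "given_by_seq_bound n \<Phi> \<Psi> P" "\<And>m. m \<in> {1..n} \<Longrightarrow> kmodule (E m)" "kmodule F"
    "\<And>x. x \<in> (\<Pi>\<^sub>E m\<in>{1..n}. carrier (E m)) \<Longrightarrow> T x \<in> carrier F"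
  shows "P E F T C \<longleftrightarrow> seq_bound n \<Phi> \<Psi> E F T C"
  using assms unfolding given_by_seq_bound_def by blast

lemma type_bound_given:
  "given_by_seq_bound n rad_functional (\<lambda>m. lp_functional (p m))
    (type_bound n p :: (nat \<Rightarrow> ('k::real_or_complex, 'a) nspace) \<Rightarrow> ('k, 'b) nspace \<Rightarrow> _)"
  unfolding given_by_seq_bound_def
proof (intro allI impI)
  fix E :: "nat \<Rightarrow> ('k::real_or_complex, 'a) nspace" and F :: "('k, 'b) nspace"
    and T :: "(nat \<Rightarrow> 'a) \<Rightarrow> 'b" and C :: real
  assume E: "\<forall>m\<in>{1..n}. kmodule (E m)" and F: "kmodule F"
    and T: "T \<in> (\<Pi>\<^sub>E m\<in>{1..n}. carrier (E m)) \<rightarrow> carrier F"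
  have eq: "rad_norm F k (\<lambda>j. T (x j)) = snorm rad_functional F k (\<lambda>j. T (x j))"
    "(\<Prod>m=1..n. lp_norm (p m) (E m) k (\<lambda>j. x j m))
      = (\<Prod>m=1..n. snorm (lp_functional (p m)) (E m) k (\<lambda>j. x j m))"
    if x: "\<forall>j\<in>{1..k}. x j \<in> (\<Pi>\<^sub>E m\<in>{1..n}. carrier (E m))" for k x
  proof -
    show "rad_norm F k (\<lambda>j. T (x j)) = snorm rad_functional F k (\<lambda>j. T (x j))"
      using x T by (intro rad_norm_eq_snorm F) blast
    show "(\<Prod>m=1..n. lp_norm (p m) (E m) k (\<lambda>j. x j m))
      = (\<Prod>m=1..n. snorm (lp_functional (p m)) (E m) k (\<lambda>j. x j m))"
      using x E by (intro prod.cong lp_norm_eq_snorm refl) (auto simp: PiE_iff)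
  qed
  show "type_bound n p E F T C \<longleftrightarrow> seq_bound n rad_functional (\<lambda>m. lp_functional (p m)) E F T C"
    unfolding type_bound_def seq_bound_def by (intro iff_allI imp_cong refl) (simp only: eq)
qed

lemma cotype_bound_given:
  "given_by_seq_bound n (lp_functional q) (\<lambda>m. rad_functional)
    (cotype_bound n q :: (nat \<Rightarrow> ('k::real_or_complex, 'a) nspace) \<Rightarrow> ('k, 'b) nspace \<Rightarrow> _)"
  unfolding given_by_seq_bound_def
proof (intro allI impI)
  fix E :: "nat \<Rightarrow> ('k::real_or_complex, 'a) nspace" and F :: "('k, 'b) nspace"
    and T :: "(nat \<Rightarrow> 'a) \<Rightarrow> 'b" and C :: real
  assume E: "\<forall>m\<in>{1..n}. kmodule (E m)" and F: "kmodule F"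
    and T: "T \<in> (\<Pi>\<^sub>E m\<in>{1..n}. carrier (E m)) \<rightarrow> carrier F"
  have eq: "lp_norm q F k (\<lambda>j. T (x j)) = snorm (lp_functional q) F k (\<lambda>j. T (x j))"
    "(\<Prod>m=1..n. rad_norm (E m) k (\<lambda>j. x j m)) = (\<Prod>m=1..n. snorm rad_functional (E m) k (\<lambda>j. x j m))"
    if x: "\<forall>j\<in>{1..k}. x j \<in> (\<Pi>\<^sub>E m\<in>{1..n}. carrier (E m))" for k x
  proof -
    show "lp_norm q F k (\<lambda>j. T (x j)) = snorm (lp_functional q) F k (\<lambda>j. T (x j))"
      using x T by (intro lp_norm_eq_snorm F) blast
    show "(\<Prod>m=1..n. rad_norm (E m) k (\<lambda>j. x j m)) = (\<Prod>m=1..n. snorm rad_functional (E m) k (\<lambda>j. x j m))"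
      using x E by (intro prod.cong rad_norm_eq_snorm refl) (auto simp: PiE_iff)
  qed
  show "cotype_bound n q E F T C \<longleftrightarrow> seq_bound n (lp_functional q) (\<lambda>m. rad_functional) E F T C"
    unfolding cotype_bound_def seq_bound_def by (intro iff_allI imp_cong refl) (simp only: eq)
qed

lemma banach_space_normed_module: "banach_space E \<Longrightarrow> normed_module E"
  by (simp add: banach_space_def normed_space_iff)

text \<open>\<open>T\<close> and its composition with the canonical embedding have the same
  admissible constants, which settles membership and equality of norms together.\<close>

theorem regular_bound_ideal:
  fixes P :: "(nat \<Rightarrow> ('k::real_or_complex, 'a) nspace) \<Rightarrow> ('k, 'b) nspace \<Rightarrow> ((nat \<Rightarrow> 'a) \<Rightarrow> 'b) \<Rightarrow> real \<Rightarrow> bool"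
    and P' :: "(nat \<Rightarrow> ('k, 'a) nspace) \<Rightarrow> ('k, ('b \<Rightarrow> 'k) \<Rightarrow> 'k) nspace \<Rightarrow>
      ((nat \<Rightarrow> 'a) \<Rightarrow> ('b \<Rightarrow> 'k) \<Rightarrow> 'k) \<Rightarrow> real \<Rightarrow> bool"
  assumes "given_by_seq_bound n \<Phi> \<Psi> P" "given_by_seq_bound n \<Phi> \<Psi> P'"
  shows "regular n (bound_ideal n P) (bound_ideal n P')"
  unfolding regular_def
proof (intro allI impI, elim conjE)
  fix E :: "nat \<Rightarrow> ('k, 'a) nspace" and F :: "('k, 'b) nspace"
    and T :: "(nat \<Rightarrow> 'a) \<Rightarrow> 'b"
  let ?F = "dual_space (dual_space F)" and ?T = "canonical_embedding F \<circ> T"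
  assume "\<forall>m\<in>{1..n}. banach_space (E m)" "banach_space F" and T: "T \<in> multilinear_ops n E F"
    and JT: "?T \<in> ops (bound_ideal n P') E ?F"
  then have E: "\<And>m. m \<in> {1..n} \<Longrightarrow> kmodule (E m)" and F: "normed_module F"
    using banach_space_normed_module normed_module.axioms(1) by blast+
  interpret F: normed_module F by (rule F)
  interpret D: normed_module "dual_space F" by (rule F.dual_normed_module)
  have Tx: "\<And>x. x \<in> (\<Pi>\<^sub>E m\<in>{1..n}. carrier (E m)) \<Longrightarrow> T x \<in> carrier F"
    using T multilinD(1) unfolding multilinear_ops_iff by blast
  have "P' E ?F ?T C \<longleftrightarrow> P E F T C" for C
  proof -
    have "P' E ?F ?T C \<longleftrightarrow> seq_bound n \<Phi> \<Psi> E ?F ?T C"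
      using Tx linD(1)[OF F.canonical_embedding_lin]
      by (intro given_by_seq_boundD[OF assms(2)] E D.dual_kmodule) auto
    also have "\<dots> \<longleftrightarrow> seq_bound n \<Phi> \<Psi> E F T C"
      using Tx by (intro seq_bound_canonical_embedding E F) auto
    also have "\<dots> \<longleftrightarrow> P E F T C"
      using Tx by (intro given_by_seq_boundD[OF assms(1), symmetric] E F.kmodule_axioms) auto
    finally show ?thesis .
  qed
  then show "T \<in> ops (bound_ideal n P) E F \<and>
      inorm (bound_ideal n P) E F T = inorm (bound_ideal n P') E ?F ?T"
    using T JT by (simp add: bound_ideal_def)
qed

theorem ultrastable_bound_ideal:
  fixes P :: "(nat \<Rightarrow> ('k::real_or_complex, 'a) nspace) \<Rightarrow> ('k, 'b) nspace \<Rightarrow> ((nat \<Rightarrow> 'a) \<Rightarrow> 'b) \<Rightarrow> real \<Rightarrow> bool"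
    and P' :: "(nat \<Rightarrow> ('k, ('i \<Rightarrow> 'a) set) nspace) \<Rightarrow> ('k, ('i \<Rightarrow> 'b) set) nspace \<Rightarrow>
      ((nat \<Rightarrow> ('i \<Rightarrow> 'a) set) \<Rightarrow> ('i \<Rightarrow> 'b) set) \<Rightarrow> real \<Rightarrow> bool"
  assumes P: "given_by_seq_bound n \<Phi> \<Psi> P" "given_by_seq_bound n \<Phi> \<Psi> P'"
    and \<Phi>: "seq_functional \<Phi> S" and \<Psi>: "\<And>m. m \<in> {1..n} \<Longrightarrow> seq_functional (\<Psi> m) (R m)"
  shows "ultrastable n (bound_ideal n P) (bound_ideal n P')"
  unfolding ultrastable_def
proof (intro allI impI, elim conjE)
  fix U :: "'i filter" and E :: "'i \<Rightarrow> nat \<Rightarrow> ('k, 'a) nspace" and F :: "'i \<Rightarrow> ('k, 'b) nspace"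
    and T :: "'i \<Rightarrow> (nat \<Rightarrow> 'a) \<Rightarrow> 'b"
  let ?N = "SUP i. inorm (bound_ideal n P) (E i) (F i) (T i)"
  let ?E = "\<lambda>m. ultraproduct U (\<lambda>i. E i m)" and ?F = "ultraproduct U F" and ?T = "ultraproduct_op n U F T"
  assume U: "ultrafilter U" and fin: "?N < \<infinity>"
    and all: "\<forall>i. (\<forall>m\<in>{1..n}. banach_space (E i m)) \<and> banach_space (F i) \<and>
      T i \<in> ops (bound_ideal n P) (E i) (F i)"
  have E: "normed_module (E i m)" if "m \<in> {1..n}" for i m
    using all that by (simp add: banach_space_normed_module)
  have F: "normed_module (F i)" for i
    using all by (simp add: banach_space_normed_module)
  have T: "multilin n (E i) (F i) (T i)" for i
    using all by (simp add: bound_ideal_def multilinear_ops_iff)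
  \<comment> \<open>Each operator has some admissible constant below \<open>C\<close>, depending on
    the index; raised to \<open>C\<close> they become uniform. A single such \<open>C\<close> gives
    membership, and all of them together give the norm estimate.\<close>
  have main: "?T \<in> multilinear_ops n ?E ?F \<and> P' ?E ?F ?T C" if C: "0 < C" "?N < ennreal C" for C
  proof -
    have bound: "seq_bound n \<Phi> \<Psi> (E i) (F i) (T i) C" for i
    proof -
      have "inorm (bound_ideal n P) (E i) (F i) (T i) < ennreal C"
        by (rule order_le_less_trans[OF _ C(2)]) (rule SUP_upper, simp)
      then obtain C' where C': "C' < C" "P (E i) (F i) (T i) C'"
        by (rule inorm_bound_ideal_less)
      then have C'_bound: "seq_bound n \<Phi> \<Psi> (E i) (F i) (T i) C'"
        using given_by_seq_boundD[OF P(1)] E F T multilinD(1) normed_module.axioms(1) by metis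
      show ?thesis
        by (rule seq_bound_mono[OF \<Psi> E C'_bound less_imp_le[OF C'(1)]])
    qed
    interpret ultraproduct_of_ops n U E F T C
      by (intro ultraproduct_of_ops.intro U E F T less_imp_le[OF C(1)]
          op_bound_if_seq_bound[OF \<Phi> \<Psi> E F T bound])
    have "kmodule (?E m)" if "m \<in> {1..n}" for m
      by (rule ultraproduct_of_normed.ultraproduct_kmodule[OF UE[OF that]])
    then have "P' ?E ?F ?T C \<longleftrightarrow> seq_bound n \<Phi> \<Psi> ?E ?F ?T C"
      using multilinD(1)[OF multilin_ultraproduct_op]
      by (intro given_by_seq_boundD[OF P(2)] F.ultraproduct_kmodule) auto
    then show ?thesis
      using ultraproduct_op_mem seq_bound_ultraproduct_op[OF \<Phi> \<Psi> bound] by blast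
  qed
  obtain C where "0 < C" "?N < ennreal C" using ennreal_bound_exists[OF fin] by blast
  with main have "?T \<in> ops (bound_ideal n P') ?E ?F"
    by (auto simp: bound_ideal_def)
  moreover have "inorm (bound_ideal n P') ?E ?F ?T \<le> ?N"
    using main by (intro inorm_bound_ideal_le) blast
  ultimately show "?T \<in> ops (bound_ideal n P') ?E ?F \<and> inorm (bound_ideal n P') ?E ?F ?T \<le> ?N" ..
qed

theorem maximal_bound_ideal:
  fixes P :: "(nat \<Rightarrow> ('k::real_or_complex, 'a) nspace) \<Rightarrow> ('k, 'b) nspace \<Rightarrow> ((nat \<Rightarrow> 'a) \<Rightarrow> 'b) \<Rightarrow> real \<Rightarrow> bool"
    and P' :: "(nat \<Rightarrow> ('k, 'a) nspace) \<Rightarrow> ('k, 'b set) nspace \<Rightarrow> ((nat \<Rightarrow> 'a) \<Rightarrow> 'b set) \<Rightarrow> real \<Rightarrow> bool"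
  assumes P: "given_by_seq_bound n \<Phi> \<Psi> P" "given_by_seq_bound n \<Phi> \<Psi> P'"
    and \<Phi>: "seq_functional \<Phi> S" and \<Psi>: "\<And>m. m \<in> {1..n} \<Longrightarrow> seq_functional (\<Psi> m) (R m)"
  shows "maximal n (bound_ideal n P) (bound_ideal n P')"
  unfolding maximal_def
proof (intro allI impI, elim conjE)
  fix E :: "nat \<Rightarrow> ('k, 'a) nspace" and F :: "('k, 'b) nspace"
    and T :: "(nat \<Rightarrow> 'a) \<Rightarrow> 'b"
  let ?N = "max_norm n (bound_ideal n P') E F T"
  assume "\<forall>m\<in>{1..n}. banach_space (E m)" "banach_space F" and T: "T \<in> multilinear_ops n E F"
    and fin: "?N < \<infinity>"
  then have E: "\<And>m. m \<in> {1..n} \<Longrightarrow> normed_module (E m)" and F: "normed_module F"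
    by (auto dest: banach_space_normed_module)
  interpret F: normed_module F by (rule F)
  have Ek: "\<And>m. m \<in> {1..n} \<Longrightarrow> kmodule (E m)" using E by (auto intro: normed_module.axioms)
  have Tx: "T \<in> (\<Pi>\<^sub>E m\<in>{1..n}. carrier (E m)) \<rightarrow> carrier F"
    using T multilinD(1) unfolding multilinear_ops_iff by blast
  let ?E = "\<lambda>D m. subspace_of (E m) (D m)" and ?F = "quotient_space F"
    and ?T = "\<lambda>D L. restrict (quotient_map F L \<circ> T) (\<Pi>\<^sub>E m\<in>{1..n}. D m)"
  have P_iff: "P E F T C \<longleftrightarrow> seq_bound n \<Phi> \<Psi> E F T C" for C
    using Tx by (intro given_by_seq_boundD[OF P(1)] Ek F.kmodule_axioms) auto
  have P'_iff: "P' (?E D) (?F L) (?T D L) C \<longleftrightarrow> seq_bound n \<Phi> \<Psi> (?E D) (?F L) (?T D L) C"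
    and E_normed: "\<And>m. m \<in> {1..n} \<Longrightarrow> normed_module (?E D m)"
    if D: "\<And>m. m \<in> {1..n} \<Longrightarrow> D m \<in> FIN (E m)" and L: "L \<in> COFIN F" for D L C
  proof -
    interpret quotient_of_module F L
      using L by (auto simp: COFIN_def intro!: quotient_of_module.intro quotient_of_module_axioms.intro F.kmodule_axioms)
    have sub: "submodule (D m) ring_of_type_algebra (E m)" if "m \<in> {1..n}" for m
      using D[OF that] by (simp add: FIN_def)
    have DE: "D m \<subseteq> carrier (E m)" if "m \<in> {1..n}" for m
      using module.submoduleE(1)[OF kmodule.axioms(1)[OF Ek[OF that]] sub[OF that]] .
    show "normed_module (?E D m)" if m: "m \<in> {1..n}" for m
    proof -
      interpret Em: normed_module "E m" by (rule E[OF m])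
      show ?thesis
        using subspace_kmodule[OF Ek[OF m] sub[OF m]] DE[OF m]
        by (auto simp: normed_module_def normed_module_axioms_def Em.nrm_eq_0_iff Em.nrm_smult
            Em.nrm_triangle subset_iff)
    qed
    have "?T D L x \<in> carrier (?F L)" if "x \<in> (\<Pi>\<^sub>E m\<in>{1..n}. carrier (?E D m))" for x
    proof -
      have "x \<in> (\<Pi>\<^sub>E m\<in>{1..n}. carrier (E m))" using that DE unfolding PiE_iff subspace_of_simps by blast
      then have "T x \<in> carrier F" using Tx by blast
      then show ?thesis using that linD(1)[OF lin_quotient_map] by auto
    qed
    then show "P' (?E D) (?F L) (?T D L) C \<longleftrightarrow> seq_bound n \<Phi> \<Psi> (?E D) (?F L) (?T D L) C"
      by (intro given_by_seq_boundD[OF P(2)] subspace_kmodule Ek sub quotient_kmodule) auto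
  qed
  \<comment> \<open>Every pair of subspaces and quotient has its own constant below
    \<open>C\<close>; only after raising them all to \<open>C\<close> does
    \<open>seq_bound_if_sub_quotient\<close> apply.\<close>
  have main: "P E F T C" if C: "0 < C" "?N < ennreal C" for C
  proof -
    have bound: "seq_bound n \<Phi> \<Psi> (?E D) (?F L) (?T D L) C"
      if D: "\<And>m. m \<in> {1..n} \<Longrightarrow> D m \<in> FIN (E m)" and L: "L \<in> COFIN F" for D L
    proof -
      have "inorm (bound_ideal n P') (?E D) (?F L) (?T D L) \<le> ?N"
        unfolding max_norm_def using D L by (intro SUP_upper2[of "(D, L)"]) auto
      then have "inorm (bound_ideal n P') (?E D) (?F L) (?T D L) < ennreal C"
        using C(2) by (rule order_le_less_trans)
      then obtain C' where C': "C' < C" "P' (?E D) (?F L) (?T D L) C'"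
        by (rule inorm_bound_ideal_less)
      then have C'_bound: "seq_bound n \<Phi> \<Psi> (?E D) (?F L) (?T D L) C'" using P'_iff[OF D L] by simp
      show ?thesis
        by (rule seq_bound_mono[OF \<Psi> E_normed[OF D L] C'_bound less_imp_le[OF C'(1)]])
    qed
    show ?thesis
      unfolding P_iff by (rule seq_bound_if_sub_quotient[OF \<Phi> Ek F Tx bound])
  qed
  obtain C where "0 < C" "?N < ennreal C" using ennreal_bound_exists[OF fin] by blast
  with main T have "T \<in> ops (bound_ideal n P) E F" by (auto simp: bound_ideal_def)
  moreover have "inorm (bound_ideal n P) E F T \<le> ?N"
    using main by (intro inorm_bound_ideal_le)
  moreover have "?N \<le> inorm (bound_ideal n P) E F T"
    unfolding max_norm_def
  proof (rule SUP_least, clarify)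
    fix D L assume D: "\<forall>m\<in>{1..n}. D m \<in> FIN (E m)" and L: "L \<in> COFIN F"
    have "P' (?E D) (?F L) (?T D L) C" if "P E F T C" for C
      using seq_bound_sub_quotient[OF \<Phi> Ek F Tx _ L, of D] P'_iff[of D L C] P_iff[of C] that D L by blast
    \<comment> \<open>A constant admissible for \<open>T\<close> is admissible for every restricted
      and projected operator, so the infimum for the latter runs over a larger set.\<close>
    then show "inorm (bound_ideal n P') (?E D) (?F L) (?T D L) \<le> inorm (bound_ideal n P) E F T"
      unfolding bound_ideal_def by (auto intro!: INF_superset_mono)
  qed
  ultimately show "T \<in> ops (bound_ideal n P) E F \<and> inorm (bound_ideal n P) E F T = ?N"
    by (simp add: antisym)
qed

theorem theorem4p1:
  fixes n :: nat and p :: "nat \<Rightarrow> real" and q :: real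
  assumes "2 \<le> n"
    and "\<forall>m\<in>{1..n}. 0 < p m"
    and "1 / 2 \<le> (\<Sum>m=1..n. 1 / p m)" and "(\<Sum>m=1..n. 1 / p m) < 1"
    and "2 / real n \<le> q"
  shows
    "regular n (type_ideal n p :: ('k::real_or_complex, 'a, 'b) multi_ideal)
       (type_ideal n p :: ('k, 'a, ('b \<Rightarrow> 'k) \<Rightarrow> 'k) multi_ideal) \<and>
     ultrastable n (type_ideal n p :: ('k, 'a, 'b) multi_ideal)
       (type_ideal n p :: ('k, ('i \<Rightarrow> 'a) set, ('i \<Rightarrow> 'b) set) multi_ideal) \<and>
     maximal n (type_ideal n p :: ('k, 'a, 'b) multi_ideal)
       (type_ideal n p :: ('k, 'a, 'b set) multi_ideal) \<and>
     regular n (cotype_ideal n q :: ('k, 'a, 'b) multi_ideal)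
       (cotype_ideal n q :: ('k, 'a, ('b \<Rightarrow> 'k) \<Rightarrow> 'k) multi_ideal) \<and>
     ultrastable n (cotype_ideal n q :: ('k, 'a, 'b) multi_ideal)
       (cotype_ideal n q :: ('k, ('i \<Rightarrow> 'a) set, ('i \<Rightarrow> 'b) set) multi_ideal) \<and>
     maximal n (cotype_ideal n q :: ('k, 'a, 'b) multi_ideal)
       (cotype_ideal n q :: ('k, 'a, 'b set) multi_ideal)"
proof -
  \<comment> \<open>The monotonicity and continuity of the q-norm rest on a positive exponent, which
    the lower bound \<open>2 / real n\<close> for \<open>q\<close> provides.\<close>
  have "0 < 2 / real n" using assms(1) by simp
  with assms(5) have "0 < q" by linarith
  note lp_q = seq_functional_lp[OF this]
  have lp_p: "seq_functional (lp_functional (p m)) (\<lambda>k. unit_coeff ` {1..k})" if "m \<in> {1..n}" for m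
    using assms(2) that by (intro seq_functional_lp) auto
  show ?thesis
    unfolding type_ideal_eq cotype_ideal_eq
    by (intro conjI regular_bound_ideal[OF type_bound_given type_bound_given]
        regular_bound_ideal[OF cotype_bound_given cotype_bound_given]
        ultrastable_bound_ideal[OF type_bound_given type_bound_given seq_functional_rad lp_p]
        ultrastable_bound_ideal[OF cotype_bound_given cotype_bound_given lp_q seq_functional_rad]
        maximal_bound_ideal[OF type_bound_given type_bound_given seq_functional_rad lp_p]
        maximal_bound_ideal[OF cotype_bound_given cotype_bound_given lp_q seq_functional_rad])
qed

end
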